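(* There exist infinitely many pairwise nonisomorphic finite posets that are minimal, under weak subposet containment, among the finite posets $P$ satisfying \[ e(P)=1\qquad\text{and}\qquad \pi^-(P)>1. \]
   Context: A family $\mathcal G$ of sets is a weak copy of a finite poset $(P,\leqslant)$ if there is a bijection $\psi:P\to\mathcal G$ such that $\psi(p)\subseteq\psi(p')$ whenever $p\leqslant p'$. A family $\mathcal F$ is (weak) $P$-free if no subfamily of it is a weak copy of $P$. $\mathrm{La}(n,P)$ is the maximum size of a weak $P$-free family $\mathcal F\subseteq 2^{[n]}$, and $\pi^-(P)=\liminf_{n\to\infty}\mathrm{La}(n,P)/\binom{n}{\lfloor n/2\rfloor}$. $e(P)$ is the maximum integer $k$ such that, for every $n$, the union of any $k$ consecutive layers of $2^{[n]}$ is weak $P$-free; a layer of $2^{[n]}$ is $\binom{[n]}{s}=\{Y\subseteq[n]:|Y|=s\}$. A poset $Q$ is weakly contained in (is a weak subposet of) a poset $P$ if there is an injection $\varphi:Q\to P$ such that $x\le y$ in $Q$ implies $\varphi(x)\le\varphi(y)$ in $P$. A poset $P$ in a class of finite posets is minimal under weak subposet containment if every poset in the class that is weakly contained in $P$ is isomorphic to $P$. *)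

theory Defs
  imports "HOL-Analysis.Analysis"
begin

text \<open>A poset is represented by its order relation \<open>P\<close>; by reflexivity the ground set is
  \<open>Field P\<close>.\<close>

definition finite_poset :: "'a rel \<Rightarrow> bool" where
  "finite_poset P \<longleftrightarrow> Partial_order P \<and> finite (Field P)"

definition poset_iso :: "'a rel \<Rightarrow> 'b rel \<Rightarrow> bool" where
  "poset_iso P Q \<longleftrightarrow>
     (\<exists>f. bij_betw f (Field P) (Field Q) \<and>
          (\<forall>x\<in>Field P. \<forall>y\<in>Field P. (x, y) \<in> P \<longleftrightarrow> (f x, f y) \<in> Q))"

definition weakly_contained :: "'a rel \<Rightarrow> 'b rel \<Rightarrow> bool" where
  "weakly_contained Q P \<longleftrightarrow>
     (\<exists>\<phi>. inj_on \<phi> (Field Q) \<and> \<phi> ` Field Q \<subseteq> Field P \<and>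
          (\<forall>x y. (x, y) \<in> Q \<longrightarrow> (\<phi> x, \<phi> y) \<in> P))"

definition weak_copy :: "'a rel \<Rightarrow> 'b set set \<Rightarrow> bool" where
  "weak_copy P \<G> \<longleftrightarrow>
     (\<exists>\<psi>. bij_betw \<psi> (Field P) \<G> \<and> (\<forall>p q. (p, q) \<in> P \<longrightarrow> \<psi> p \<subseteq> \<psi> q))"

definition weak_free :: "'a rel \<Rightarrow> 'b set set \<Rightarrow> bool" where
  "weak_free P \<F> \<longleftrightarrow> \<not> (\<exists>\<G>. \<G> \<subseteq> \<F> \<and> weak_copy P \<G>)"

text \<open>The maxima in \<open>La\<close> and \<open>e_num\<close> are written with \<open>Sup\<close> on \<open>nat\<close>, which is \<open>Max\<close> on finite
  nonempty sets; the lemmas below show that this is the case for every nonempty finite poset.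
  No family is free of the empty poset, and since \<open>Sup {} = 0\<close> both numbers are then \<open>0\<close>.\<close>

definition La :: "nat \<Rightarrow> 'a rel \<Rightarrow> nat" where
  "La n P = Sup {card \<F> | \<F>. \<F> \<subseteq> Pow {1..n} \<and> weak_free P \<F>}"

definition pi_minus :: "'a rel \<Rightarrow> ereal" where
  "pi_minus P = liminf (\<lambda>n. ereal (real (La n P) / real (n choose (n div 2))))"

definition layer :: "nat \<Rightarrow> nat \<Rightarrow> nat set set" where
  "layer n s = {Y. Y \<subseteq> {1..n} \<and> card Y = s}"

text \<open>The condition \<open>s + k \<le> n + 1\<close> says that the \<open>k\<close> layers \<open>s, \<dots>, s + k - 1\<close> are among the
  layers \<open>0, \<dots>, n\<close> of \<open>Pow {1..n}\<close>.\<close>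

definition layers_free :: "'a rel \<Rightarrow> nat \<Rightarrow> bool" where
  "layers_free P k \<longleftrightarrow>
     (\<forall>n s. s + k \<le> n + 1 \<longrightarrow> weak_free P (\<Union>i\<in>{s..<s + k}. layer n i))"

definition e_num :: "'a rel \<Rightarrow> nat" where
  "e_num P = Sup {k. layers_free P k}"

text \<open>Every finite poset is isomorphic to one on a finite set of natural numbers, so a class of
  finite posets closed under isomorphism is given by its members of type \<open>nat rel\<close>.\<close>

definition minimal_poset :: "nat rel set \<Rightarrow> nat rel \<Rightarrow> bool" where
  "minimal_poset \<C> P \<longleftrightarrow>
     P \<in> \<C> \<and> (\<forall>Q\<in>\<C>. weakly_contained Q P \<longrightarrow> poset_iso Q P)"

lemma weak_free_empty:
  assumes "Field P \<noteq> {}"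
  shows "weak_free P {}"
  using assms by (auto simp: weak_free_def weak_copy_def bij_betw_def)

lemma La_eq_Max:
  assumes "Field P \<noteq> {}"
  shows "La n P = Max {card \<F> | \<F>. \<F> \<subseteq> Pow {1..n} \<and> weak_free P \<F>}"
proof -
  let ?X = "{card \<F> | \<F>. \<F> \<subseteq> Pow {1..n} \<and> weak_free P \<F>}"
  have "?X \<subseteq> card ` Pow (Pow {1..n})" by auto
  then have "finite ?X" by (rule finite_subset) simp
  moreover have "card ({} :: nat set set) \<in> ?X"
    using weak_free_empty[OF assms] by blast
  ultimately show ?thesis
    unfolding La_def by (intro cSup_eq_Max) auto
qed

lemma not_layers_free:
  fixes P :: "nat rel"
  assumes "finite_poset P" "Max (Field P) + 1 < k"
  shows "\<not> layers_free P k"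
proof
  assume free: "layers_free P k"
  have po: "Partial_order P" and fin: "finite (Field P)"
    using assms(1) by (auto simp: finite_poset_def)
  have refl: "(p, p) \<in> P" if "p \<in> Field P" for p
    using po that by (auto simp: partial_order_on_def preorder_on_def refl_on_def)
  have trans: "trans P" and antisym: "antisym P"
    using po by (auto simp: partial_order_on_def preorder_on_def)
  define \<psi> where "\<psi> p = Suc ` {q. (q, p) \<in> P}" for p
  have inj: "inj_on \<psi> (Field P)"
  proof (rule inj_onI)
    fix x y assume "x \<in> Field P" "y \<in> Field P" "\<psi> x = \<psi> y"
    then have "{q. (q, x) \<in> P} = {q. (q, y) \<in> P}"
      by (simp add: \<psi>_def inj_image_eq_iff)
    then have "(x, y) \<in> P" "(y, x) \<in> P"
      using refl[OF \<open>x \<in> Field P\<close>] refl[OF \<open>y \<in> Field P\<close>] by auto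
    then show "x = y" using antisym by (auto dest: antisymD)
  qed
  have mono: "\<psi> p \<subseteq> \<psi> q" if "(p, q) \<in> P" for p q
    using that trans by (auto simp: \<psi>_def dest: transD)
  have copy: "weak_copy P (\<psi> ` Field P)"
    unfolding weak_copy_def using inj mono by (auto simp: bij_betw_def)
  have sub: "\<psi> p \<subseteq> {1..k - 1}" for p
  proof
    fix x assume "x \<in> \<psi> p"
    then obtain q where q: "x = Suc q" "(q, p) \<in> P" by (auto simp: \<psi>_def)
    then have "q \<le> Max (Field P)" using fin by (auto simp: Field_def intro!: Max_ge)
    then show "x \<in> {1..k - 1}" using q(1) assms(2) by auto
  qed
  have "\<psi> ` Field P \<subseteq> (\<Union>i\<in>{0..<0 + k}. layer (k - 1) i)"
  proof
    fix Y assume "Y \<in> \<psi> ` Field P"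
    then have Y: "Y \<subseteq> {1..k - 1}" using sub by auto
    then have "card Y \<le> k - 1" using card_mono[OF _ Y] by simp
    then have "card Y < k" using assms(2) by linarith
    then show "Y \<in> (\<Union>i\<in>{0..<0 + k}. layer (k - 1) i)" using Y by (auto simp: layer_def)
  qed
  moreover have "weak_free P (\<Union>i\<in>{0..<0 + k}. layer (k - 1) i)"
    using free assms(2) unfolding layers_free_def by (metis add_0 le_add_diff_inverse2 le_add2 le_refl less_imp_le order_trans)
  ultimately show False using copy by (auto simp: weak_free_def)
qed

lemma e_num_eq_Max:
  fixes P :: "nat rel"
  assumes "finite_poset P" "Field P \<noteq> {}"
  shows "finite {k. layers_free P k}" "layers_free P 0" "e_num P = Max {k. layers_free P k}"
proof -
  have "{k. layers_free P k} \<subseteq> {..Max (Field P) + 1}"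
    using not_layers_free[OF assms(1)] by (auto simp: not_less[symmetric])
  then show fin: "finite {k. layers_free P k}" by (rule finite_subset) simp
  show zero: "layers_free P 0"
    using weak_free_empty[OF assms(2)] by (auto simp: layers_free_def)
  show "e_num P = Max {k. layers_free P k}"
    unfolding e_num_def using fin zero by (intro cSup_eq_Max) auto
qed

end

theory Submission
  imports Defs "HOL-Real_Asymp.Real_Asymp" "HOL-Combinatorics.Multiset_Permutations"
begin

text \<open>For a graph \<open>G\<close> let \<open>I(G)\<close> be the poset of its vertices and edges, ordered by incidence. If every
  small vertex set of \<open>G\<close> spans fewer edges than it has vertices, then every small weak subposet of
  \<open>I(G)\<close> is a forest of height at most two, and these embed greedily into every family of
  \<open>(1 + \<epsilon>) * (n choose (n div 2))\<close> sets, so they have \<open>\<pi>\<^sup>- \<le> 1\<close>. Hence, if also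
  \<open>\<pi>\<^sup>-(I(G)) > 1\<close>, a minimal poset below \<open>I(G)\<close> is large.

  To get \<open>\<pi>\<^sup>-(I(G)) > 1\<close>, take the middle layer \<open>m\<close> together with at least half of layer \<open>m + 1\<close>,
  namely the sets whose elements receive linearly independent vectors over the two-element field
  under a suitable assignment of vectors of length \<open>m + 2\<close>. Given an \<open>(m - 1)\<close>-set \<open>Z\<close>, the pairs
  that complete it to such a set form an 8-colourable graph. A copy of \<open>I(G)\<close> maps the vertices of
  \<open>G\<close> to \<open>m\<close>-sets, adjacent ones being at distance two. If \<open>G\<close> is a sparse random graph, all its cuts
  have about the expected size, and summing over the cuts given by the coordinates shows that almost
  all pairs of vertices are mapped to sets at distance two. Then a positive proportion of these
  \<open>m\<close>-sets share an \<open>(m - 1)\<close>-subset or lie in a common \<open>(m + 1)\<close>-set, and \<open>G\<close> has a linearly large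
  vertex set spanning at most one edge, which a random graph does not have.\<close>

section \<open>Embeddings of expanders into a layer\<close>

text \<open>All of layers \<open>m\<close> and \<open>m + 1\<close> would be too much: the sets with
  one and two further elements above a fixed \<open>(m - 1)\<close>-set \<open>Z\<close> form a copy
  of \<open>I(G)\<close>. Thinning out the upper layer has to deal with copies of this kind. Many
  \<open>m\<close>-sets pairwise at distance two either lie in one \<open>(m + 1)\<close>-set, which
  is then the only possible image of an edge, or they share such a \<open>Z\<close>; in the second
  case a colour class of the pairs completing \<open>Z\<close> spans no edge of \<open>G\<close>. So
  a bounded chromatic number is the property to keep, and independence over the two-element field
  provides it at the price of half a layer.

  The graph has edge probability \<open>p = (ln N)^2 / N\<close>. Already for the cuts of single
  vertices the union bound needs a mean degree that is a large multiple of \<open>ln N\<close>; for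
  small sets with more edges than vertices to be absent, \<open>N ^ w * p ^ (w + 1)\<close> has to
  vanish for every fixed \<open>w\<close>, so the mean degree must stay below all powers of
  \<open>N\<close>. Short cycles still occur at this density. They are destroyed by deleting a
  matching, which costs a cut no more than the size of its smaller side.\<close>

definition pairs :: "'v set \<Rightarrow> 'v set set" where
  "pairs V = {e. e \<subseteq> V \<and> card e = 2}"

definition cut :: "'v set set \<Rightarrow> 'v set \<Rightarrow> 'v set set" where
  "cut E S = {e \<in> E. e \<inter> S \<noteq> {} \<and> \<not> e \<subseteq> S}"

lemma finite_pairs: "finite V \<Longrightarrow> finite (pairs V)"
  by (rule finite_subset[of _ "Pow V"]) (auto simp: pairs_def)

lemma card_pairs: "finite V \<Longrightarrow> card (pairs V) = card V choose 2"
  unfolding pairs_def by (rule n_subsets)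

lemma pairsE:
  assumes "e \<in> pairs V"
  obtains u v where "e = {u, v}" "u \<noteq> v" "u \<in> V" "v \<in> V"
  using assms unfolding pairs_def by (auto simp: card_2_iff)

lemma card_Diff_eq_1:
  assumes "finite A" "finite B" "card A = m" "card B = m" "card (A \<union> B) = Suc m"
  shows "card (A - B) = 1" "card (B - A) = 1"
proof -
  have "card (A \<union> B) = card A + card (B - A)" "card (A \<union> B) = card B + card (A - B)"
    using assms by (metis Un_Diff_cancel card_Un_disjoint Diff_disjoint finite_Diff Un_commute)+
  then show "card (A - B) = 1" "card (B - A) = 1" using assms by auto
qed

text \<open>Each coordinate \<open>x\<close> gives the cut \<open>{v. x \<in> f v}\<close>, and every edge crosses exactly two of
  these cuts.\<close>

lemma sum_card_Diff_le:
  fixes f :: "'v \<Rightarrow> 'a set" and \<theta> \<kappa> :: real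
  assumes V: "finite V" and E: "E \<subseteq> pairs V"
    and fin: "\<And>v. v \<in> V \<Longrightarrow> finite (f v)"
    and edge: "\<And>u v. {u, v} \<in> E \<Longrightarrow> card (f u - f v) = 1"
    and cut: "\<And>S. S \<subseteq> V \<Longrightarrow> \<theta> * card S * card (V - S) \<le> card (cut E S)"
    and \<theta>: "\<theta> > 0"
    and cardE: "2 * card E \<le> \<theta> * ((1 + \<kappa>) * (real (card V))\<^sup>2)"
  shows "(\<Sum>u\<in>V. \<Sum>v\<in>V. real (card (f u - f v))) \<le> (1 + \<kappa>) * (real (card V))\<^sup>2"
proof -
  define X where "X = \<Union> (f ` V)"
  define W where "W x = {v \<in> V. x \<in> f v}" for x
  have X: "finite X" using V fin by (auto simp: X_def)
  have finE: "finite E" using E finite_pairs[OF V] finite_subset by blast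
  have "(\<Sum>u\<in>V. \<Sum>v\<in>V. real (card (f u - f v)))
      = (\<Sum>u\<in>V. \<Sum>v\<in>V. \<Sum>x\<in>X. of_bool (x \<in> f u) * of_bool (x \<notin> f v))"
  proof (intro sum.cong refl)
    fix u v assume uv: "u \<in> V" "v \<in> V"
    have "(\<Sum>x\<in>X. of_bool (x \<in> f u) * of_bool (x \<notin> f v) :: real)
        = (\<Sum>x\<in>f u - f v. 1)"
      using X uv by (intro sum.mono_neutral_cong_right) (auto simp: X_def)
    then show "real (card (f u - f v)) = (\<Sum>x\<in>X. of_bool (x \<in> f u) * of_bool (x \<notin> f v))"
      by simp
  qed
  also have "\<dots> = (\<Sum>x\<in>X. \<Sum>u\<in>V. \<Sum>v\<in>V. of_bool (x \<in> f u) * of_bool (x \<notin> f v))"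
    by (subst (2) sum.swap, subst sum.swap) (rule refl)
  also have "\<dots> = (\<Sum>x\<in>X. (\<Sum>u\<in>V. of_bool (x \<in> f u)) * (\<Sum>v\<in>V. of_bool (x \<notin> f v)))"
    by (simp add: sum_product)
  also have "\<dots> = (\<Sum>x\<in>X. real (card (W x)) * real (card (V - W x)))"
  proof (intro sum.cong refl)
    fix x
    have "V - W x = {v \<in> V. x \<notin> f v}" by (auto simp: W_def)
    then show "(\<Sum>u\<in>V. of_bool (x \<in> f u)) * (\<Sum>v\<in>V. of_bool (x \<notin> f v))
        = real (card (W x)) * real (card (V - W x))"
      using V by (simp add: W_def Int_def)
  qed
  finally have 1: "(\<Sum>u\<in>V. \<Sum>v\<in>V. real (card (f u - f v)))
      = (\<Sum>x\<in>X. real (card (W x)) * real (card (V - W x)))" .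
  have "(\<Sum>x\<in>X. card {e \<in> E. e \<in> cut E (W x)}) = 2 * card E"
  proof (rule sum_multicount[OF X finE], intro ballI)
    fix e assume e: "e \<in> E"
    then obtain u v where uv: "e = {u, v}" "u \<noteq> v" "u \<in> V" "v \<in> V" using E pairsE by blast
    have "{x \<in> X. e \<in> cut E (W x)} = (f u - f v) \<union> (f v - f u)"
      using uv e by (auto simp: cut_def W_def X_def)
    moreover have "card (f u - f v) = 1" "card (f v - f u) = 1"
      using edge e uv by (auto simp: insert_commute)
    moreover have "(f u - f v) \<inter> (f v - f u) = {}" by auto
    ultimately show "card {x \<in> X. e \<in> cut E (W x)} = 2"
      using fin uv card_Un_disjoint[of "f u - f v" "f v - f u"] by simp
  qed
  moreover have "{e \<in> E. e \<in> cut E (W x)} = cut E (W x)" for x by (auto simp: cut_def)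
  ultimately have 2: "(\<Sum>x\<in>X. card (cut E (W x))) = 2 * card E" by simp
  have "\<theta> * (\<Sum>x\<in>X. real (card (W x)) * real (card (V - W x)))
      = (\<Sum>x\<in>X. \<theta> * card (W x) * card (V - W x))"
    by (simp add: sum_distrib_left mult.assoc)
  also have "\<dots> \<le> (\<Sum>x\<in>X. real (card (cut E (W x))))"
    by (intro sum_mono cut) (auto simp: W_def)
  also have "\<dots> = 2 * card E" using 2 by (metis of_nat_sum)
  also have "\<dots> \<le> \<theta> * ((1 + \<kappa>) * (real (card V))\<^sup>2)" by (rule cardE)
  finally show ?thesis using \<theta> 1 by simp
qed

section \<open>Vertices whose images are pairwise at distance two\<close>

lemma sum_sum_of_bool:
  assumes "finite V"
  shows "(\<Sum>u\<in>V. \<Sum>v\<in>V. of_bool (P u v)) = real (card {(u, v) \<in> V \<times> V. P u v})"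
proof -
  have "(\<Sum>u\<in>V. \<Sum>v\<in>V. of_bool (P u v) :: real) = (\<Sum>x\<in>V\<times>V. of_bool (P (fst x) (snd x)))"
    by (simp add: sum.cartesian_product case_prod_beta)
  also have "\<dots> = real (card ((V\<times>V) \<inter> {x. P (fst x) (snd x)}))"
    using assms by (subst sum_of_bool_eq) auto
  also have "(V\<times>V) \<inter> {x. P (fst x) (snd x)} = {(u, v) \<in> V \<times> V. P u v}" by auto
  finally show ?thesis .
qed

text \<open>Average over all triples \<open>(u, v, w)\<close>: at most \<open>3 * N\<close> times
  the number of bad pairs of them contain a bad pair. The condition \<open>R u v\<close> sits inside
  the counted set, so that a nonempty count also certifies that the chosen \<open>u\<close> and
  \<open>v\<close> are related.\<close>

lemma common_neighbours:
  fixes \<tau> :: real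
  assumes V: "finite V" "V \<noteq> {}"
    and bad: "real (card {(u, v) \<in> V \<times> V. \<not> R u v}) \<le> \<tau> * (real (card V))\<^sup>2"
  shows "\<exists>u\<in>V. \<exists>v\<in>V. real (card {w \<in> V. R u v \<and> R u w \<and> R v w}) \<ge> (1 - 3 * \<tau>) * card V"
proof (rule ccontr)
  assume "\<not> ?thesis"
  then have less: "real (card {w \<in> V. R u v \<and> R u w \<and> R v w}) < (1 - 3 * \<tau>) * card V"
    if "u \<in> V" "v \<in> V" for u v using that by force
  let ?N = "real (card V)"
  let ?b = "\<lambda>u v. of_bool (\<not> R u v) :: real"
  have *: "real (card {w \<in> V. R u v \<and> R u w \<and> R v w})
      \<ge> (\<Sum>w\<in>V. 1 - ?b u v - ?b u w - ?b v w)" for u v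
  proof -
    have "(\<Sum>w\<in>V. 1 - ?b u v - ?b u w - ?b v w) \<le> (\<Sum>w\<in>V. of_bool (R u v \<and> R u w \<and> R v w))"
      by (intro sum_mono) auto
    also have "\<dots> = real (card {w \<in> V. R u v \<and> R u w \<and> R v w})"
      using V by (simp add: Int_def)
    finally show ?thesis .
  qed
  have B: "(\<Sum>u\<in>V. \<Sum>v\<in>V. ?b u v) \<le> \<tau> * ?N\<^sup>2"
    using bad by (simp only: sum_sum_of_bool[OF V(1)])
  have "?N ^ 3 * (1 - 3 * \<tau>) = ?N ^ 3 - 3 * ?N * (\<tau> * ?N\<^sup>2)"
    by (simp add: algebra_simps power3_eq_cube power2_eq_square)
  also have "\<dots> \<le> ?N ^ 3 - 3 * ?N * (\<Sum>u\<in>V. \<Sum>v\<in>V. ?b u v)"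
    using B by (intro diff_left_mono mult_left_mono) auto
  also have "\<dots> = (\<Sum>u\<in>V. \<Sum>v\<in>V. \<Sum>w\<in>V. 1 - ?b u v - ?b u w - ?b v w)"
    by (simp add: sum_subtractf sum_distrib_left[symmetric] power3_eq_cube del: sum_of_bool_eq)
       (simp add: algebra_simps)
  also have "\<dots> \<le> (\<Sum>u\<in>V. \<Sum>v\<in>V. real (card {w \<in> V. R u v \<and> R u w \<and> R v w}))"
    by (intro sum_mono *)
  also have "\<dots> < (\<Sum>u\<in>V. \<Sum>v\<in>V. (1 - 3 * \<tau>) * ?N)"
    using V less by (intro sum_strict_mono) auto
  also have "\<dots> = ?N ^ 3 * (1 - 3 * \<tau>)" by (simp add: power3_eq_cube)
  finally show False by simp
qed

text \<open>An element of \<open>C\<close> outside \<open>A\<close> and \<open>B\<close> is the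
  whole of \<open>C - A\<close> and of \<open>C - B\<close>, so the other \<open>m - 1\<close>
  elements of \<open>C\<close> fill the \<open>(m - 1)\<close>-set \<open>A \<inter> B\<close>. The
  two alternatives are the two types of maximal cliques in the Johnson graph.\<close>

lemma star_or_top:
  assumes fin: "finite A" "finite B" "finite C"
    and card: "card A = m" "card B = m" "card C = m"
    and d: "card (A - B) = 1" "card (A - C) = 1" "card (B - C) = 1"
  shows "A \<inter> B \<subseteq> C \<or> C \<subseteq> A \<union> B"
proof (rule disjCI)
  assume nt: "\<not> C \<subseteq> A \<union> B"
  then obtain c where c: "c \<in> C" "c \<notin> A" "c \<notin> B" by auto
  have "card (C - A) = 1" using d(2) fin card
    by (metis card_le_sym_Diff le_antisym order_refl)
  then have CA: "C - A = {c}" using c by (metis card_1_singletonE DiffI singletonD)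
  have "card (C - B) = 1" using d(3) fin card
    by (metis card_le_sym_Diff le_antisym order_refl)
  then have CB: "C - B = {c}" using c by (metis card_1_singletonE DiffI singletonD)
  have sub: "C - {c} \<subseteq> A \<inter> B" using CA CB by auto
  have "card (C - {c}) = m - 1" using c fin card by simp
  moreover have "card (A \<inter> B) = m - 1"
    using d(1) card(1) fin by (simp add: card_Diff_subset_Int)
  ultimately have "C - {c} = A \<inter> B" using sub fin by (intro card_subset_eq) auto
  then show "A \<inter> B \<subseteq> C" by auto
qed


text \<open>In hypergraph terms, the link graph of every \<open>m\<close>-set in \<open>H\<close>
  has chromatic number at most \<open>k\<close>. No two elements of a colour class complete
  \<open>Z\<close> to a member of \<open>H\<close>, and this is how edges of the graph get
  excluded.\<close>

definition link_colourable :: "nat \<Rightarrow> nat \<Rightarrow> nat set set \<Rightarrow> bool" where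
  "link_colourable k m H \<longleftrightarrow>
     (\<forall>Z. finite Z \<and> card Z = m \<longrightarrow> (\<exists>c::nat \<Rightarrow> nat. (\<forall>x. c x < k) \<and>
        (\<forall>x y. x \<noteq> y \<and> x \<notin> Z \<and> y \<notin> Z \<and> insert x (insert y Z) \<in> H \<longrightarrow> c x \<noteq> c y)))"

lemma colour_class:
  fixes c :: "'v \<Rightarrow> nat"
  assumes "finite W" "\<And>x. x \<in> W \<Longrightarrow> c x < k"
  shows "\<exists>i. card W \<le> k * card {x \<in> W. c x = i}"
proof (rule ccontr)
  assume "\<not> ?thesis"
  then have *: "k * card {x \<in> W. c x = i} < card W" for i by (auto simp: not_le)
  then have "W \<noteq> {}" by fastforce
  then have k: "k > 0" using assms(2) by (metis all_not_in_conv gr_zeroI not_less_zero)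
  have "W = (\<Union>i<k. {x \<in> W. c x = i})" using assms(2) by auto
  then have "card W \<le> (\<Sum>i<k. card {x \<in> W. c x = i})"
    using card_UN_le[of "{..<k}" "\<lambda>i. {x \<in> W. c x = i}"] by simp
  then have "k * card W \<le> (\<Sum>i<k. k * card {x \<in> W. c x = i})"
    by (metis mult_le_mono2 sum_distrib_left)
  also have "\<dots> < (\<Sum>i<k. card W)" using * k by (intro sum_strict_mono) auto
  finally show False by simp
qed

text \<open>The constants: the cuts leave at most \<open>N^2 / 60 + 2 * N\<close>, hence at most
  \<open>N^2 / 30\<close>, bad ordered pairs, which gives a set \<open>W\<close> of
  \<open>9/10 * N\<close> vertices around one pair. One of the two clique types takes half of
  \<open>W\<close>, and one of 8 colour classes takes an eighth of that; finally
  \<open>9/160 > 1/20\<close>.\<close>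

lemma nearly_independent_set:
  fixes f :: "'v \<Rightarrow> nat set" and \<theta> :: real
  assumes V: "finite V" "card V \<ge> 120" and E: "E \<subseteq> pairs V"
    and f: "\<And>v. v \<in> V \<Longrightarrow> finite (f v) \<and> card (f v) = m" and injf: "inj_on f V"
    and h: "\<And>u v. {u, v} \<in> E \<Longrightarrow> h {u, v} = f u \<union> f v"
    and hH: "\<And>e. e \<in> E \<Longrightarrow> h e \<in> H \<and> card (h e) = Suc m" and injh: "inj_on h E"
    and H: "link_colourable 8 (m - 1) H"
    and cut: "\<And>S. S \<subseteq> V \<Longrightarrow> \<theta> * card S * card (V - S) \<le> card (cut E S)"
    and \<theta>: "\<theta> > 0"
    and cardE: "2 * card E \<le> \<theta> * ((1 + 1/60) * (real (card V))\<^sup>2)"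
  shows "\<exists>C \<subseteq> V. card V \<le> 20 * card C \<and> card {e \<in> E. e \<subseteq> C} \<le> 1"
proof -
  let ?N = "real (card V)"
  define R where "R u v \<longleftrightarrow> card (f u - f v) = 1" for u v
  have edge: "card (f u - f v) = 1" if "{u, v} \<in> E" for u v
  proof -
    have "u \<in> V" "v \<in> V" using that E by (auto simp: pairs_def)
    then show ?thesis
      using card_Diff_eq_1[of "f u" "f v" m] f h[OF that] hH[OF that] by auto
  qed
  have avg: "(\<Sum>u\<in>V. \<Sum>v\<in>V. real (card (f u - f v))) \<le> (1 + 1/60) * ?N\<^sup>2"
  proof (rule sum_card_Diff_le[OF V(1) E])
    show "2 * card E \<le> \<theta> * ((1 + 1/60) * ?N\<^sup>2)" by (rule cardE)
  qed (use f edge cut \<theta> in auto)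
  let ?b = "\<lambda>u v. of_bool (\<not> R u v) :: real"
  have B: "(\<Sum>u\<in>V. \<Sum>v\<in>V. ?b u v) = real (card {(u, v) \<in> V \<times> V. \<not> R u v})"
    by (rule sum_sum_of_bool[OF V(1)])
  \<comment> \<open>The mean of \<open>card (f u - f v)\<close> is hardly above 1, while distinct
    \<open>u\<close> and \<open>v\<close> contribute at least 1, and bad ones at least 2. On the
    diagonal the summand is \<open>1 - 2 + 1 = 0\<close>, since \<open>R u u\<close> fails.\<close>
  have "?N\<^sup>2 - 2 * ?N + (\<Sum>u\<in>V. \<Sum>v\<in>V. ?b u v)
      = (\<Sum>u\<in>V. \<Sum>v\<in>V. 1 - 2 * of_bool (u = v) + ?b u v)"
  proof -
    have "(\<Sum>u\<in>V. \<Sum>v\<in>V. of_bool (u = v) :: real) = (\<Sum>u\<in>V. 1)"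
      using V by (intro sum.cong refl) (simp add: of_bool_def)
    then show ?thesis
      by (simp add: sum.distrib sum_subtractf sum_distrib_left[symmetric] power2_eq_square
          del: sum_of_bool_eq)
  qed
  also have "\<dots> \<le> (\<Sum>u\<in>V. \<Sum>v\<in>V. real (card (f u - f v)))"
  proof (intro sum_mono)
    fix u v assume uv: "u \<in> V" "v \<in> V"
    show "1 - 2 * of_bool (u = v) + ?b u v \<le> real (card (f u - f v))"
    proof (cases "u = v")
      case False
      then have "f u \<noteq> f v" using injf uv by (auto dest: inj_onD)
      then have "f u - f v \<noteq> {}" using f[OF uv(1)] f[OF uv(2)] card_subset_eq[of "f v" "f u"] by auto
      then have "card (f u - f v) > 0" using f uv by (simp add: card_gt_0_iff)
      then show ?thesis using False by (auto simp: R_def)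
    qed (auto simp: R_def)
  qed
  finally have "(\<Sum>u\<in>V. \<Sum>v\<in>V. ?b u v) \<le> 1/60 * ?N\<^sup>2 + 2 * ?N" using avg by (simp add: algebra_simps)
  also have "\<dots> \<le> 1/30 * ?N\<^sup>2"
  proof -
    have "120 * ?N \<le> ?N * ?N" using V(2) by (intro mult_right_mono) auto
    then show ?thesis by (simp add: power2_eq_square)
  qed
  finally have "real (card {(u, v) \<in> V \<times> V. \<not> R u v}) \<le> 1/30 * ?N\<^sup>2" using B by simp
  from common_neighbours[OF V(1) _ this] V(2)
  obtain u v where uv: "u \<in> V" "v \<in> V"
    and W: "real (card {w \<in> V. R u v \<and> R u w \<and> R v w}) \<ge> 9/10 * ?N" by fastforce
  define W where "W = {w \<in> V. R u v \<and> R u w \<and> R v w}"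
  have cW: "real (card W) \<ge> 9/10 * ?N" using W by (simp add: W_def)
  then have "W \<noteq> {}" using V(2) by auto
  then have Ruv: "R u v" by (auto simp: W_def)
  define Z where "Z = f u \<inter> f v"
  define U where "U = f u \<union> f v"
  have fU: "finite U" "finite Z" using f uv by (auto simp: U_def Z_def)
  have cardZ: "card Z = m - 1"
    using Ruv f uv by (simp add: Z_def R_def card_Diff_subset_Int)
  have cardU: "card U = Suc m"
  proof -
    have "card U = card (f v) + card (f u - f v)"
      using f uv by (metis U_def Un_Diff_cancel card_Un_disjoint Diff_disjoint finite_Diff Un_commute)
    then show ?thesis using Ruv f uv by (simp add: R_def)
  qed
  have m: "m > 0" using Ruv f uv by (metis R_def card_gt_0_iff card.empty empty_Diff zero_neq_one)
  define T where "T = {w \<in> W. f w \<subseteq> U}"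
  define S where "S = {w \<in> W. Z \<subseteq> f w}"
  have "W \<subseteq> S \<union> T"
  proof
    fix w assume "w \<in> W"
    then show "w \<in> S \<union> T"
      using star_or_top[of "f u" "f v" "f w" m] f uv by (auto simp: S_def T_def U_def Z_def W_def R_def)
  qed
  moreover have fin: "finite W" "finite S" "finite T" using V by (auto simp: W_def S_def T_def)
  ultimately have "card W \<le> card S + card T"
    by (meson card_Un_le card_mono finite_UnI le_trans)
  then consider "real (card T) \<ge> 9/20 * ?N" | "real (card S) \<ge> 9/20 * ?N" using cW by linarith
  then show ?thesis
  proof cases
    case 1
    \<comment> \<open>The image of an edge inside \<open>T\<close> is an
      \<open>(m + 1)\<close>-subset of \<open>U\<close> and thus \<open>U\<close> itself;
      injectivity of \<open>h\<close> leaves at most one such edge.\<close>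
    have "h e = U" if e: "e \<in> E" "e \<subseteq> T" for e
    proof -
      obtain x y where xy: "e = {x, y}" using E e pairsE by blast
      have "h e \<subseteq> U" using h e xy by (auto simp: T_def)
      then show ?thesis using hH[OF e(1)] cardU fU by (intro card_subset_eq) auto
    qed
    then have "\<forall>a\<in>{e \<in> E. e \<subseteq> T}. \<forall>b\<in>{e \<in> E. e \<subseteq> T}. a = b"
      by (metis (mono_tags, lifting) inj_onD injh mem_Collect_eq)
    then have "card {e \<in> E. e \<subseteq> T} \<le> 1"
      by (metis (no_types, lifting) One_nat_def card_le_Suc0_iff_eq card.infinite le0)
    moreover have "T \<subseteq> V" by (auto simp: T_def W_def)
    moreover have "card V \<le> 20 * card T" using 1 by linarith
    ultimately show ?thesis by blast
  next
    case 2
    obtain c :: "nat \<Rightarrow> nat" where c: "\<And>x. c x < 8"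
      "\<And>x y. x \<noteq> y \<Longrightarrow> x \<notin> Z \<Longrightarrow> y \<notin> Z \<Longrightarrow> insert x (insert y Z) \<in> H \<Longrightarrow> c x \<noteq> c y"
      using H fU cardZ unfolding link_colourable_def by metis
    have "\<exists>y. y \<notin> Z \<and> f w = insert y Z" if "w \<in> S" for w
    proof -
      have w: "w \<in> V" "Z \<subseteq> f w" using that by (auto simp: S_def W_def)
      then have "card (f w - Z) = 1" using f[OF w(1)] cardZ fU m by (simp add: card_Diff_subset)
      then obtain y where "f w - Z = {y}" by (auto simp: card_1_singleton_iff)
      then show ?thesis using w by blast
    qed
    then obtain y where y: "\<And>w. w \<in> S \<Longrightarrow> y w \<notin> Z \<and> f w = insert (y w) Z" by metis
    obtain i where i: "card S \<le> 8 * card {w \<in> S. c (y w) = i}"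
      using colour_class[of S "\<lambda>w. c (y w)" 8] fin c(1) by auto
    define C where "C = {w \<in> S. c (y w) = i}"
    \<comment> \<open>The image of an edge inside \<open>C\<close> would be \<open>Z\<close>
      together with \<open>y a\<close> and \<open>y b\<close>, a member of \<open>H\<close>,
      although \<open>y a\<close> and \<open>y b\<close> have the same colour.\<close>
    have "\<not> e \<subseteq> C" if e: "e \<in> E" for e
    proof
      assume eC: "e \<subseteq> C"
      obtain a b where ab: "e = {a, b}" "a \<noteq> b" "a \<in> V" "b \<in> V" using E e pairsE by blast
      have S: "a \<in> S" "b \<in> S" using eC ab by (auto simp: C_def)
      have "f a \<noteq> f b" using injf ab by (auto dest: inj_onD)
      then have "y a \<noteq> y b" using y S by metis
      moreover have "insert (y a) (insert (y b) Z) \<in> H"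
        using h[of a b] hH[OF e] e ab(1) y[OF S(1)] y[OF S(2)] by (simp add: insert_commute)
      ultimately have "c (y a) \<noteq> c (y b)" using c(2) y S by metis
      then show False using eC ab by (auto simp: C_def)
    qed
    then have "{e \<in> E. e \<subseteq> C} = {}" by auto
    then have "card {e \<in> E. e \<subseteq> C} \<le> 1" by (metis card.empty zero_le)
    moreover have "C \<subseteq> V" by (auto simp: C_def S_def W_def)
    moreover have "card V \<le> 20 * card C" using 2 i by (simp add: C_def)
    ultimately show ?thesis by blast
  qed
qed

section \<open>Half of a layer with colourable links\<close>

text \<open>An element \<open>x\<close> carries the vector over the two-element field whose
  coordinate \<open>i\<close> tells whether \<open>x \<in> R i\<close>. The signature is the support
  of the sum of the vectors in \<open>X\<close>, so addition of vectors becomes symmetric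
  difference.\<close>

definition signature :: "nat \<Rightarrow> (nat \<Rightarrow> nat set) \<Rightarrow> nat set \<Rightarrow> nat set" where
  "signature d R X = {i. i < d \<and> odd (card (X \<inter> R i))}"

text \<open>This is linear independence: over the two-element field the nontrivial linear
  combinations are the sums over nonempty subsets.\<close>

definition indep :: "nat \<Rightarrow> (nat \<Rightarrow> nat set) \<Rightarrow> nat set \<Rightarrow> bool" where
  "indep d R X \<longleftrightarrow> (\<forall>Y \<subseteq> X. Y \<noteq> {} \<longrightarrow> signature d R Y \<noteq> {})"

lemma signature_empty [simp]: "signature d R {} = {}"
  by (simp add: signature_def)

lemma signature_subset: "signature d R X \<subseteq> {..<d}"
  by (auto simp: signature_def)

lemma signature_Un:
  assumes "finite A" "finite B" "A \<inter> B = {}"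
  shows "signature d R (A \<union> B) = (signature d R A - signature d R B) \<union> (signature d R B - signature d R A)"
proof -
  have "card ((A \<union> B) \<inter> R i) = card (A \<inter> R i) + card (B \<inter> R i)" for i
    using assms by (subst card_Un_disjoint[symmetric]) (auto intro!: arg_cong[of _ _ card])
  then show ?thesis by (auto simp: signature_def)
qed

lemma signature_sym_diff:
  assumes "finite A" "finite B"
  shows "signature d R ((A - B) \<union> (B - A))
       = (signature d R A - signature d R B) \<union> (signature d R B - signature d R A)"
proof -
  have "signature d R ((A - B) \<union> (A \<inter> B))
      = (signature d R (A - B) - signature d R (A \<inter> B)) \<union> (signature d R (A \<inter> B) - signature d R (A - B))"
    using assms by (intro signature_Un) auto
  moreover have "signature d R ((B - A) \<union> (A \<inter> B))
      = (signature d R (B - A) - signature d R (A \<inter> B)) \<union> (signature d R (A \<inter> B) - signature d R (B - A))"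
    using assms by (intro signature_Un) auto
  moreover have "signature d R ((A - B) \<union> (B - A))
      = (signature d R (A - B) - signature d R (B - A)) \<union> (signature d R (B - A) - signature d R (A - B))"
    using assms by (intro signature_Un) auto
  moreover have "(A - B) \<union> (A \<inter> B) = A" "(B - A) \<union> (A \<inter> B) = B" by auto
  ultimately show ?thesis by auto
qed

lemma indep_inj_on_signature:
  assumes "finite Z" "indep d R Z"
  shows "inj_on (signature d R) (Pow Z)"
proof (rule inj_onI)
  fix A B assume AB: "A \<in> Pow Z" "B \<in> Pow Z" "signature d R A = signature d R B"
  then have "finite A" "finite B" using assms finite_subset by auto
  then have "signature d R ((A - B) \<union> (B - A)) = {}" using AB by (simp add: signature_sym_diff)
  moreover have "(A - B) \<union> (B - A) \<subseteq> Z" using AB by auto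
  ultimately have "(A - B) \<union> (B - A) = {}" using assms unfolding indep_def by blast
  then show "A = B" by auto
qed

text \<open>Over the two-element field, an element outside \<open>Z\<close> is coloured with its coset modulo the
  span of \<open>Z\<close>; there are \<open>2 ^ (m + 3) / 2 ^ m = 8\<close> cosets.\<close>

lemma link_colourable_indep:
  "link_colourable 8 m {X. finite X \<and> indep (m + 3) R X}"
  unfolding link_colourable_def
proof (intro allI impI, elim conjE)
  fix Z :: "nat set" assume Z: "finite Z" "card Z = m"
  let ?d = "m + 3"
  let ?s = "signature ?d R"
  let ?H = "{X. finite X \<and> indep ?d R X}"
  show "\<exists>c::nat \<Rightarrow> nat. (\<forall>x. c x < 8) \<and>
        (\<forall>x y. x \<noteq> y \<and> x \<notin> Z \<and> y \<notin> Z \<and> insert x (insert y Z) \<in> ?H \<longrightarrow> c x \<noteq> c y)"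
  proof (cases "indep ?d R Z")
    \<comment> \<open>No set containing a dependent \<open>Z\<close> is in \<open>?H\<close>, so
      every colouring works.\<close>
    case False
    then have "insert x (insert y Z) \<notin> ?H" for x y unfolding indep_def by blast
    then show ?thesis by (intro exI[of _ "\<lambda>_. 0"]) auto
  next
    case True
    define coset where "coset x = (\<lambda>Y. (?s {x} - ?s Y) \<union> (?s Y - ?s {x})) ` Pow Z" for x
    have finY: "finite Y" if "Y \<in> Pow Z" for Y using that Z finite_subset by auto
    have card_coset: "card (coset x) = 2 ^ m" for x
    proof -
      have "inj_on (\<lambda>Y. (?s {x} - ?s Y) \<union> (?s Y - ?s {x})) (Pow Z)"
      proof (rule inj_onI)
        fix A B assume "A \<in> Pow Z" "B \<in> Pow Z"
          "(?s {x} - ?s A) \<union> (?s A - ?s {x}) = (?s {x} - ?s B) \<union> (?s B - ?s {x})"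
        moreover from this(3) have "?s A = ?s B" by blast
        ultimately show "A = B"
          using indep_inj_on_signature[OF Z(1) True] by (auto dest: inj_onD)
      qed
      then show ?thesis using Z by (simp add: coset_def card_image card_Pow)
    qed
    \<comment> \<open>Cosets that meet coincide: if the vector of \<open>x\<close> plus the sum of
      \<open>A\<close> equals the vector of \<open>y\<close> plus the sum of \<open>B\<close>, then
      the vector of \<open>x\<close> plus the sum of \<open>C\<close> is the vector of
      \<open>y\<close> plus the sum of \<open>?E\<close>, the symmetric difference of
      \<open>A\<close>, \<open>B\<close> and \<open>C\<close>.\<close>
    have sub: "coset x \<subseteq> coset y" if "coset x \<inter> coset y \<noteq> {}" for x y
    proof
      from that obtain A B where AB: "A \<in> Pow Z" "B \<in> Pow Z"
        "(?s {x} - ?s A) \<union> (?s A - ?s {x}) = (?s {y} - ?s B) \<union> (?s B - ?s {y})"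
        by (auto simp: coset_def)
      fix v assume "v \<in> coset x"
      then obtain C where C: "C \<in> Pow Z" "v = (?s {x} - ?s C) \<union> (?s C - ?s {x})"
        by (auto simp: coset_def)
      let ?D = "(A - B) \<union> (B - A)"
      let ?E = "(?D - C) \<union> (C - ?D)"
      have "?E \<in> Pow Z" using AB C by auto
      moreover have "?s ?D = (?s A - ?s B) \<union> (?s B - ?s A)"
        using AB finY by (intro signature_sym_diff) auto
      moreover have "?s ?E = (?s ?D - ?s C) \<union> (?s C - ?s ?D)"
        using AB C finY by (intro signature_sym_diff) auto
      ultimately have "v = (?s {y} - ?s ?E) \<union> (?s ?E - ?s {y})"
        using AB(3) C(2) by blast
      then show "v \<in> coset y" using \<open>?E \<in> Pow Z\<close> unfolding coset_def by blast
    qed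
    have "range coset \<subseteq> Pow (Pow {..<?d})"
      using signature_subset[of ?d R] by (fastforce simp: coset_def)
    then have fin: "finite (range coset)" "finite (\<Union> (range coset))"
      and U: "\<Union> (range coset) \<subseteq> Pow {..<?d}"
      by (auto intro: finite_subset)
    have "2 ^ m * card (range coset) = card (\<Union> (range coset))"
      using sub card_coset by (intro card_partition fin) blast+
    also have "\<dots> \<le> card (Pow {..<?d})" using U by (intro card_mono) auto
    also have "\<dots> = 2 ^ m * 8" by (simp add: card_Pow power_add)
    finally have le8: "card (range coset) \<le> 8" by simp
    obtain g where g: "bij_betw g (range coset) {0..<card (range coset)}"
      using ex_bij_betw_finite_nat[OF fin(1)] by blast
    have lt: "g (coset x) < 8" for x
    proof -
      have "g (coset x) \<in> {0..<card (range coset)}" by (rule bij_betwE[OF g, rule_format]) simp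
      then show ?thesis using le8 by simp
    qed
    \<comment> \<open>If \<open>x\<close> and \<open>y\<close> had a common coset, the vectors of
      \<open>x\<close>, \<open>y\<close> and some \<open>Y \<subseteq> Z\<close> would add up to
      zero, a dependency inside the completed set.\<close>
    have "g (coset x) \<noteq> g (coset y)"
      if xy: "x \<noteq> y" "x \<notin> Z" "y \<notin> Z" "insert x (insert y Z) \<in> ?H" for x y
    proof
      assume "g (coset x) = g (coset y)"
      then have "coset x = coset y" using bij_betw_imp_inj_on[OF g] by (auto dest: inj_onD)
      moreover have "?s {x} \<in> coset x" unfolding coset_def by (rule image_eqI[of _ _ "{}"]) auto
      ultimately have "?s {x} \<in> coset y" by simp
      then obtain Y where Y: "Y \<in> Pow Z" "?s {x} = (?s {y} - ?s Y) \<union> (?s Y - ?s {y})"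
        unfolding coset_def by blast
      have 1: "?s ({y} \<union> Y) = ?s {x}"
        unfolding Y(2) using Y(1) xy finY by (intro signature_Un) auto
      have "?s ({x} \<union> ({y} \<union> Y)) = (?s {x} - ?s ({y} \<union> Y)) \<union> (?s ({y} \<union> Y) - ?s {x})"
        using Y(1) xy finY by (intro signature_Un) auto
      then have "?s ({x} \<union> ({y} \<union> Y)) = {}" using 1 by simp
      moreover have "{x} \<union> ({y} \<union> Y) \<subseteq> insert x (insert y Z)" using Y by auto
      ultimately show False using xy(4) unfolding indep_def by blast
    qed
    then show ?thesis using lt by (intro exI[of _ "\<lambda>x. g (coset x)"]) simp
  qed
qed

lemma link_colourable_subset:
  assumes "link_colourable k m H" "H' \<subseteq> H"
  shows "link_colourable k m H'"
  unfolding link_colourable_def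
proof (intro allI impI)
  fix Z :: "nat set" assume "finite Z \<and> card Z = m"
  then obtain c :: "nat \<Rightarrow> nat" where "\<forall>x. c x < k"
    "\<forall>x y. x \<noteq> y \<and> x \<notin> Z \<and> y \<notin> Z \<and> insert x (insert y Z) \<in> H \<longrightarrow> c x \<noteq> c y"
    using assms(1) unfolding link_colourable_def by blast
  then show "\<exists>c::nat \<Rightarrow> nat. (\<forall>x. c x < k) \<and>
      (\<forall>x y. x \<noteq> y \<and> x \<notin> Z \<and> y \<notin> Z \<and> insert x (insert y Z) \<in> H' \<longrightarrow> c x \<noteq> c y)"
    using assms(2) by (intro exI[of _ c]) auto
qed

section \<open>Random vectors keep half of a layer\<close>

text \<open>Toggling a fixed element of \<open>Y\<close> exchanges the sets that meet
  \<open>Y\<close> in an even number of elements with those that meet it in an odd number.\<close>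

lemma card_even_Int:
  assumes U: "finite U" and Y: "Y \<subseteq> U" "Y \<noteq> {}"
  shows "2 * card {A \<in> Pow U. even (card (Y \<inter> A))} = 2 ^ card U"
proof -
  obtain y where y: "y \<in> Y" using Y by auto
  define f where "f A = (if y \<in> A then A - {y} else insert y A)" for A
  let ?E = "{A \<in> Pow U. even (card (Y \<inter> A))}" and ?O = "{A \<in> Pow U. odd (card (Y \<inter> A))}"
  have par: "even (card (Y \<inter> f A)) \<longleftrightarrow> odd (card (Y \<inter> A))" if "A \<subseteq> U" for A
  proof (cases "y \<in> A")
    case True
    have fin: "finite (Y \<inter> A)" using that U finite_subset by blast
    have "Y \<inter> f A = (Y \<inter> A) - {y}" using True by (auto simp: f_def)
    moreover have "card (Y \<inter> A) = Suc (card ((Y \<inter> A) - {y}))"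
      using True y fin by (intro card.remove) auto
    ultimately show ?thesis by simp
  next
    case False
    have fin: "finite (Y \<inter> A)" using that U finite_subset by blast
    have "Y \<inter> f A = insert y (Y \<inter> A)" using False y by (auto simp: f_def)
    then show ?thesis using fin False by simp
  qed
  have "bij_betw f ?E ?O"
  proof (rule bij_betw_byWitness[of _ f])
    have sub: "f A \<subseteq> U" if "A \<subseteq> U" for A using that y Y by (auto simp: f_def)
    show "f ` ?E \<subseteq> ?O"
    proof
      fix B assume "B \<in> f ` ?E"
      then obtain A where A: "A \<subseteq> U" "even (card (Y \<inter> A))" "B = f A" by blast
      then show "B \<in> ?O" using par[OF A(1)] sub[OF A(1)] by simp
    qed
    show "f ` ?O \<subseteq> ?E"
    proof
      fix B assume "B \<in> f ` ?O"
      then obtain A where A: "A \<subseteq> U" "odd (card (Y \<inter> A))" "B = f A" by blast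
      then show "B \<in> ?E" using par[OF A(1)] sub[OF A(1)] by simp
    qed
  qed (auto simp: f_def)
  then have "card ?E = card ?O" by (rule bij_betw_same_card)
  moreover have "card (Pow U) = card ?E + card ?O"
    using U by (subst card_Un_disjoint[symmetric]) (auto intro!: arg_cong[of _ _ card])
  ultimately show ?thesis using U by (simp add: card_Pow)
qed

text \<open>First moment method, written as a count: for a random \<open>R\<close> a fixed nonempty
  \<open>Y\<close> has sum zero with probability \<open>1 / 2 ^ (m + 3)\<close>, and an
  \<open>X\<close> in the layer has fewer than \<open>2 ^ (m + 2)\<close> nonempty subsets, so
  \<open>X\<close> is dependent with probability at most 1/2. One coordinate more than
  \<open>X\<close> has elements therefore suffices, and the number of colours does not depend on
  \<open>m\<close>.\<close>

lemma exists_link_colourable: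
  "\<exists>H \<subseteq> layer n (m + 2). link_colourable 8 m H \<and> card (layer n (m + 2)) \<le> 2 * card H"
proof -
  let ?d = "m + 3" and ?U = "{1..n}" and ?L = "layer n (m + 2)"
  let ?\<Omega> = "{..<?d} \<rightarrow>\<^sub>E Pow ?U"
  have finL: "finite ?L" by (rule finite_subset[of _ "Pow ?U"]) (auto simp: layer_def)
  have fin\<Omega>: "finite ?\<Omega>" by (intro finite_PiE) auto
  have card\<Omega>: "card ?\<Omega> = (2 ^ n) ^ ?d" by (simp add: card_PiE card_Pow)
  have one: "2 ^ ?d * card {R \<in> ?\<Omega>. signature ?d R Y = {}} = card ?\<Omega>"
    if "Y \<subseteq> ?U" "Y \<noteq> {}" for Y
  proof -
    have "{R \<in> ?\<Omega>. signature ?d R Y = {}} = {..<?d} \<rightarrow>\<^sub>E {A \<in> Pow ?U. even (card (Y \<inter> A))}"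
      by (auto simp: signature_def PiE_iff extensional_def)
    then have *: "card {R \<in> ?\<Omega>. signature ?d R Y = {}} = card {A \<in> Pow ?U. even (card (Y \<inter> A))} ^ ?d"
      by (simp add: card_PiE)
    have "2 * card {A \<in> Pow ?U. even (card (Y \<inter> A))} = 2 ^ n"
      using card_even_Int[of ?U Y] that by simp
    then show ?thesis unfolding * card\<Omega> power_mult_distrib[symmetric] by (rule arg_cong)
  qed
  have bad: "2 * card {R \<in> ?\<Omega>. \<not> indep ?d R X} \<le> card ?\<Omega>" if X: "X \<in> ?L" for X
  proof -
    have XU: "X \<subseteq> ?U" "card X = m + 2" "finite X" using X by (auto simp: layer_def intro: finite_subset)
    define B where "B Y = {R \<in> ?\<Omega>. signature ?d R Y = {}}" for Y
    have "{R \<in> ?\<Omega>. \<not> indep ?d R X} \<subseteq> (\<Union>Y\<in>Pow X - {{}}. B Y)"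
      unfolding indep_def B_def by blast
    moreover have "finite (\<Union>Y\<in>Pow X - {{}}. B Y)"
      using XU(3) fin\<Omega> by (auto simp: B_def)
    ultimately have "card {R \<in> ?\<Omega>. \<not> indep ?d R X} \<le> card (\<Union>Y\<in>Pow X - {{}}. B Y)"
      by (intro card_mono)
    also have "\<dots> \<le> (\<Sum>Y\<in>Pow X - {{}}. card (B Y))"
      using XU(3) by (intro card_UN_le) simp
    finally have "2 ^ ?d * card {R \<in> ?\<Omega>. \<not> indep ?d R X} \<le> 2 ^ ?d * (\<Sum>Y\<in>Pow X - {{}}. card (B Y))"
      by (rule mult_le_mono2)
    also have "\<dots> = (\<Sum>Y\<in>Pow X - {{}}. 2 ^ ?d * card (B Y))" by (rule sum_distrib_left)
    also have "\<dots> = (\<Sum>Y\<in>Pow X - {{}}. card ?\<Omega>)"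
      unfolding B_def using XU(1) by (intro sum.cong refl one) auto
    also have "\<dots> = card (Pow X - {{}}) * card ?\<Omega>" by simp
    also have "\<dots> \<le> 2 ^ (m + 2) * card ?\<Omega>"
      using XU(2,3) by (intro mult_le_mono1) (simp add: card_Pow)
    finally have "2 ^ (m + 2) * (2 * card {R \<in> ?\<Omega>. \<not> indep ?d R X}) \<le> 2 ^ (m + 2) * card ?\<Omega>"
      by (simp add: power_add)
    then show ?thesis by simp
  qed
  have "\<exists>R\<in>?\<Omega>. 2 * card {X \<in> ?L. \<not> indep ?d R X} \<le> card ?L"
  proof (rule ccontr)
    assume *: "\<not> ?thesis"
    have ne: "?\<Omega> \<noteq> {}" using card\<Omega> by (metis card.empty power_not_zero zero_neq_numeral)
    have "card ?\<Omega> * card ?L = (\<Sum>R\<in>?\<Omega>. card ?L)" by simp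
    also have "\<dots> < (\<Sum>R\<in>?\<Omega>. 2 * card {X \<in> ?L. \<not> indep ?d R X})"
      using * fin\<Omega> ne by (intro sum_strict_mono) (auto simp: not_le)
    also have "\<dots> = 2 * (\<Sum>R\<in>?\<Omega>. card {X \<in> ?L. \<not> indep ?d R X})"
      by (rule sum_distrib_left[symmetric])
    also have "(\<Sum>R\<in>?\<Omega>. card {X \<in> ?L. \<not> indep ?d R X}) = (\<Sum>X\<in>?L. card {R \<in> ?\<Omega>. \<not> indep ?d R X})"
      using sum.swap_restrict[OF fin\<Omega> finL, of "\<lambda>_ _. 1::nat" "\<lambda>R X. \<not> indep ?d R X"] by simp
    also have "2 * \<dots> = (\<Sum>X\<in>?L. 2 * card {R \<in> ?\<Omega>. \<not> indep ?d R X})" by (rule sum_distrib_left)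
    also have "\<dots> \<le> (\<Sum>X\<in>?L. card ?\<Omega>)" by (intro sum_mono bad)
    finally show False by (simp add: mult.commute)
  qed
  then obtain R where R: "2 * card {X \<in> ?L. \<not> indep ?d R X} \<le> card ?L" by blast
  let ?H = "{X \<in> ?L. indep ?d R X}"
  have "card ?L = card ?H + card {X \<in> ?L. \<not> indep ?d R X}"
    using finL by (subst card_Un_disjoint[symmetric]) (auto intro!: arg_cong[of _ _ card])
  then have "card ?L \<le> 2 * card ?H" using R by linarith
  moreover have "link_colourable 8 m ?H"
    by (rule link_colourable_subset[OF link_colourable_indep[of m R]])
       (auto simp: layer_def intro: finite_subset)
  ultimately show ?thesis by (intro exI[of _ ?H]) auto
qed

section \<open>Forests of height two\<close>

text \<open>A permutation of \<open>U\<close> encodes the maximal chain of the sets of its first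
  \<open>k\<close> entries, and \<open>B\<close> is on this chain iff the first
  \<open>card B\<close> entries make up \<open>B\<close>. The predicate \<open>P\<close> on the
  prefix permits a second application to a set below \<open>B\<close>.\<close>

lemma card_permutations_prefix:
  assumes U: "finite U" and B: "B \<subseteq> U"
  shows "card {xs \<in> permutations_of_set U. set (take (card B) xs) = B \<and> P (take (card B) xs)}
       = card {ys \<in> permutations_of_set B. P ys} * fact (card U - card B)"
proof -
  let ?S = "{ys \<in> permutations_of_set B. P ys} \<times> permutations_of_set (U - B)"
  have len: "length ys = card B" if "ys \<in> permutations_of_set B" for ys
    using that B U by (intro length_finite_permutations_of_set)
  have "{xs \<in> permutations_of_set U. set (take (card B) xs) = B \<and> P (take (card B) xs)}
      = (\<lambda>(ys, zs). ys @ zs) ` ?S" (is "?L = ?R")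
  proof
    show "?L \<subseteq> ?R"
    proof
      fix xs assume "xs \<in> ?L"
      then have xs: "set xs = U" "distinct xs" "set (take (card B) xs) = B" "P (take (card B) xs)"
        by (auto simp: permutations_of_set_def)
      have "set (drop (card B) xs) = U - B"
        using xs set_take_disj_set_drop_if_distinct[of xs "card B" "card B"]
        by (metis Un_Diff Diff_cancel Diff_triv append_take_drop_id inf_commute le_refl set_append sup_bot.left_neutral)
      then have "(take (card B) xs, drop (card B) xs) \<in> ?S"
        using xs by (auto simp: permutations_of_set_def)
      then show "xs \<in> ?R" by (metis (no_types, lifting) append_take_drop_id case_prod_conv image_eqI)
    qed
    show "?R \<subseteq> ?L"
      using B len by (auto simp: permutations_of_set_def)
  qed
  moreover have "inj_on (\<lambda>(ys, zs). ys @ zs) ?S"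
    using len by (auto simp: inj_on_def)
  ultimately have "card ?L = card ?S" by (simp add: card_image)
  also have "\<dots> = card {ys \<in> permutations_of_set B. P ys} * fact (card U - card B)"
    using U B by (simp add: card_cartesian_product card_Diff_subset finite_subset)
  finally show ?thesis .
qed

lemma card_permutations_through:
  assumes "finite U" "B \<subseteq> U"
  shows "card {xs \<in> permutations_of_set U. set (take (card B) xs) = B}
       = fact (card B) * fact (card U - card B)"
  using card_permutations_prefix[OF assms, of "\<lambda>_. True"] assms
  by (simp add: finite_subset)

lemma card_permutations_through_two:
  assumes U: "finite U" "B \<subseteq> U" "A \<subseteq> B"
  shows "card {xs \<in> permutations_of_set U. set (take (card A) xs) = A \<and> set (take (card B) xs) = B}
       = fact (card A) * fact (card B - card A) * fact (card U - card B)"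
proof -
  have "card A \<le> card B" using U by (meson card_mono finite_subset)
  then have "{xs \<in> permutations_of_set U. set (take (card A) xs) = A \<and> set (take (card B) xs) = B}
    = {xs \<in> permutations_of_set U. set (take (card B) xs) = B
         \<and> set (take (card A) (take (card B) xs)) = A}"
    by (auto simp: min_def)
  also have "card \<dots> = card {ys \<in> permutations_of_set B. set (take (card A) ys) = A} * fact (card U - card B)"
    by (rule card_permutations_prefix[OF U(1,2)])
  also have "card {ys \<in> permutations_of_set B. set (take (card A) ys) = A}
      = fact (card A) * fact (card B - card A)"
    using U by (intro card_permutations_through) (auto intro: finite_subset)
  finally show ?thesis .
qed

lemma binomial_ge_self: "0 < k \<Longrightarrow> k < n \<Longrightarrow> n \<le> n choose k"
proof (induction n arbitrary: k)
  case (Suc n)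
  then obtain j where j: "k = Suc j" by (cases k) auto
  show ?case
  proof (cases "j = 0 \<or> Suc j = n")
    case True
    then show ?thesis
      using j Suc.prems binomial_symmetric[of "Suc j" "Suc n"] by auto
  next
    case False
    then have "n \<le> n choose j" "n \<le> n choose Suc j" using Suc j by auto
    then show ?thesis using j Suc.prems by simp
  qed
qed simp

text \<open>For \<open>a \<subseteq> b \<subseteq> U\<close> with \<open>card U = n\<close> this is
  the probability that a uniformly random maximal chain of subsets of \<open>U\<close> passes
  through both \<open>a\<close> and \<open>b\<close>.\<close>

definition chain_weight :: "nat \<Rightarrow> 'a set \<Rightarrow> 'a set \<Rightarrow> real" where
  "chain_weight n a b = fact (card a) * fact (card b - card a) * fact (n - card b) / fact n"

text \<open>A random chain through \<open>a\<close> meets a given larger \<open>b\<close> with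
  probability 1 over the binomial coefficient \<open>(n - card a) choose (card b - card a)\<close>.
  The strict inequalities keep this coefficient away from 1, and then it is at least
  \<open>n - card a\<close>. The next lemma is the mirror image, with \<open>b\<close> fixed
  first.\<close>

lemma chain_weight_le_lower:
  assumes "card a < card b" "card b < n"
  shows "chain_weight n a b \<le> 1 / (n choose card a) / real (n - card a)"
proof -
  let ?a = "card a" and ?b = "card b"
  have 1: "real ((n - ?a) choose (?b - ?a)) = fact (n - ?a) / (fact (?b - ?a) * fact (n - ?b))"
    using assms by (subst binomial_fact) auto
  have 2: "real (n choose ?a) = fact n / (fact ?a * fact (n - ?a))"
    using assms by (subst binomial_fact) auto
  have "chain_weight n a b = 1 / (n choose ?a) / real ((n - ?a) choose (?b - ?a))"
    unfolding chain_weight_def 1 2 by (simp add: field_simps)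
  also have "\<dots> \<le> 1 / (n choose ?a) / real (n - ?a)"
    using assms binomial_ge_self[of "?b - ?a" "n - ?a"]
    by (intro divide_left_mono of_nat_mono) (auto simp: diff_less_mono)
  finally show ?thesis .
qed

lemma chain_weight_le_upper:
  assumes "0 < card a" "card a < card b" "card b \<le> n"
  shows "chain_weight n a b \<le> 1 / (n choose card b) / real (card b)"
proof -
  let ?a = "card a" and ?b = "card b"
  have 1: "real (?b choose ?a) = fact ?b / (fact ?a * fact (?b - ?a))"
    using assms by (subst binomial_fact) auto
  have 2: "real (n choose ?b) = fact n / (fact ?b * fact (n - ?b))"
    using assms by (subst binomial_fact) auto
  have "chain_weight n a b = 1 / (n choose ?b) / real (?b choose ?a)"
    unfolding chain_weight_def 1 2 by (simp add: field_simps)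
  also have "\<dots> \<le> 1 / (n choose ?b) / real ?b"
    using assms binomial_ge_self[of ?a ?b] by (intro divide_left_mono) auto
  finally show ?thesis .
qed

text \<open>A random maximal chain meeting the family in \<open>X\<close> sets contains at least \<open>X - 1\<close> comparable
  pairs of it; the inequality is the expectation of this.\<close>

lemma sum_chain_weight_ge:
  assumes U: "finite U" and F: "\<F> \<subseteq> Pow U"
  shows "(\<Sum>a\<in>\<F>. 1 / real (card U choose card a)) - 1
       \<le> (\<Sum>a\<in>\<F>. \<Sum>b\<in>\<F>. of_bool (a \<subset> b) * chain_weight (card U) a b)"
proof -
  let ?n = "card U"
  let ?P = "permutations_of_set U"
  define on where "on a xs \<longleftrightarrow> set (take (card a) xs) = a" for a :: "'a set" and xs
  have finF: "finite \<F>" using F U by (meson finite_Pow_iff finite_subset)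
  have finP: "finite ?P" by simp
  have pt: "real (card {a \<in> \<F>. on a xs}) \<le> 1 + (\<Sum>a\<in>\<F>. \<Sum>b\<in>\<F>. of_bool (a \<subset> b \<and> on a xs \<and> on b xs))"
    for xs
  proof (cases "{a \<in> \<F>. on a xs} = {}")
    case False
    let ?X = "{a \<in> \<F>. on a xs}"
    have "finite ?X" using finF by simp
    \<comment> \<open>The pairs whose lower set is the smallest member of the family on the chain
      already number \<open>card ?X - 1\<close>.\<close>
    then obtain a where a: "a \<in> ?X" "\<And>b. b \<in> ?X \<Longrightarrow> card a \<le> card b"
      using False by (metis (no_types, lifting) arg_min_if_finite(1) arg_min_least)
    have sub: "a \<subset> b" if "b \<in> ?X - {a}" for b
    proof -
      have "card a \<le> card b" "on a xs" "on b xs" "a \<noteq> b" using a that by auto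
      then have "a \<subseteq> b" unfolding on_def by (metis set_take_subset_set_take)
      then show ?thesis using \<open>a \<noteq> b\<close> by auto
    qed
    have "real (card ?X) = 1 + real (card (?X - {a}))"
      using card.remove[OF \<open>finite ?X\<close> a(1)] by simp
    also have "real (card (?X - {a})) = (\<Sum>b\<in>?X - {a}. 1)" by simp
    also have "\<dots> = (\<Sum>b\<in>?X - {a}. of_bool (a \<subset> b \<and> on a xs \<and> on b xs))"
      using a(1) by (intro sum.cong refl) (simp add: sub)
    also have "\<dots> \<le> (\<Sum>b\<in>\<F>. of_bool (a \<subset> b \<and> on a xs \<and> on b xs))"
      using finF by (intro sum_mono2) auto
    also have "\<dots> \<le> (\<Sum>a\<in>\<F>. \<Sum>b\<in>\<F>. of_bool (a \<subset> b \<and> on a xs \<and> on b xs))"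
      using finF a(1) by (intro member_le_sum[of a \<F> "\<lambda>a. \<Sum>b\<in>\<F>. of_bool (a \<subset> b \<and> on a xs \<and> on b xs)"] sum_nonneg) auto
    finally show ?thesis by simp
  next
    case True
    show ?thesis unfolding True by (simp add: sum_nonneg)
  qed
  have "(\<Sum>a\<in>\<F>. real (card {xs \<in> ?P. on a xs})) = (\<Sum>xs\<in>?P. real (card {a \<in> \<F>. on a xs}))"
    using sum.swap_restrict[OF finF finP, of "\<lambda>_ _. 1::real" "on"] by simp
  also have "\<dots> \<le> (\<Sum>xs\<in>?P. 1 + (\<Sum>a\<in>\<F>. \<Sum>b\<in>\<F>. of_bool (a \<subset> b \<and> on a xs \<and> on b xs)))"
    by (intro sum_mono pt)
  also have "\<dots> = fact ?n + (\<Sum>xs\<in>?P. \<Sum>a\<in>\<F>. \<Sum>b\<in>\<F>. of_bool (a \<subset> b \<and> on a xs \<and> on b xs))"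
    using U by (simp add: sum.distrib)
  also have "(\<Sum>xs\<in>?P. \<Sum>a\<in>\<F>. \<Sum>b\<in>\<F>. of_bool (a \<subset> b \<and> on a xs \<and> on b xs) :: real)
      = (\<Sum>a\<in>\<F>. \<Sum>b\<in>\<F>. \<Sum>xs\<in>?P. of_bool (a \<subset> b \<and> on a xs \<and> on b xs))"
    by (subst sum.swap, intro sum.cong refl, rule sum.swap)
  also have "\<dots> = (\<Sum>a\<in>\<F>. \<Sum>b\<in>\<F>. of_bool (a \<subset> b) * (fact ?n * chain_weight ?n a b))"
  proof (intro sum.cong refl)
    fix a b assume ab: "a \<in> \<F>" "b \<in> \<F>"
    show "(\<Sum>xs\<in>?P. of_bool (a \<subset> b \<and> on a xs \<and> on b xs))
        = of_bool (a \<subset> b) * (fact ?n * chain_weight ?n a b)"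
    proof (cases "a \<subset> b")
      case True
      have "(\<Sum>xs\<in>?P. of_bool (a \<subset> b \<and> on a xs \<and> on b xs) :: real)
          = real (card {xs \<in> ?P. on a xs \<and> on b xs})"
        using True by (simp add: Int_def)
      also have "\<dots> = real (fact (card a) * fact (card b - card a) * fact (?n - card b))"
        unfolding on_def using card_permutations_through_two[of U b a] U F ab True by auto
      finally show ?thesis using True by (simp add: chain_weight_def)
    qed simp
  qed
  also have "\<dots> = fact ?n * (\<Sum>a\<in>\<F>. \<Sum>b\<in>\<F>. of_bool (a \<subset> b) * chain_weight ?n a b)"
    by (simp add: sum_distrib_left mult.left_commute)
  also have "(\<Sum>a\<in>\<F>. real (card {xs \<in> ?P. on a xs})) = fact ?n * (\<Sum>a\<in>\<F>. 1 / real (?n choose card a))"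
    unfolding sum_distrib_left
  proof (intro sum.cong refl)
    fix a assume a: "a \<in> \<F>"
    then have aU: "a \<subseteq> U" using F by auto
    then have "card a \<le> ?n" using U card_mono by blast
    then have "fact ?n * (1 / real (?n choose card a)) = fact (card a) * fact (?n - card a)"
      by (subst binomial_fact) auto
    then show "real (card {xs \<in> ?P. on a xs}) = fact ?n * (1 / real (?n choose card a))"
      unfolding on_def using card_permutations_through[OF U aU] by simp
  qed
  finally have "fact ?n * (\<Sum>a\<in>\<F>. 1 / real (?n choose card a))
      \<le> fact ?n * (1 + (\<Sum>a\<in>\<F>. \<Sum>b\<in>\<F>. of_bool (a \<subset> b) * chain_weight ?n a b))"
    by (simp add: distrib_left)
  then show ?thesis by simp
qed

text \<open>The pair \<open>(A, B)\<close> maximizes the chain weight of the comparable pairs minus a small multiple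
  of the weights of \<open>A\<close> and \<open>B\<close>: removing a set of low degree would increase this.\<close>

lemma exists_min_degree_pair:
  fixes \<F> :: "'a set set"
  assumes U: "finite U" and F: "\<F> \<subseteq> Pow U" and K: "K > 0"
    and mid: "\<And>a. a \<in> \<F> \<Longrightarrow> K \<le> card a \<and> card a + K \<le> card U"
    and big: "(1 - 2 * (real D / real K)) * (\<Sum>a\<in>\<F>. 1 / real (card U choose card a)) > 1"
  obtains A B where "A \<subseteq> \<F>" "B \<subseteq> \<F>" "A \<noteq> {}"
    "\<And>a. a \<in> A \<Longrightarrow> D \<le> card {b \<in> B. a \<subset> b}" "\<And>b. b \<in> B \<Longrightarrow> D \<le> card {a \<in> A. a \<subset> b}"
proof -
  let ?n = "card U"
  define w where "w a = 1 / real (?n choose card a)" for a :: "'a set"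
  \<comment> \<open>All sizes are at least \<open>K\<close> away from 0 and \<open>card U\<close>,
    so a comparable pair with \<open>a\<close> has weight at most \<open>w a / K\<close>. The
    penalty \<open>c * w a\<close> is thus an upper bound for the weight of \<open>D\<close> such
    pairs.\<close>
  define c where "c = real D / real K"
  define p where "p a b = of_bool (a \<subset> b) * chain_weight ?n a b" for a b :: "'a set"
  define \<Phi> where "\<Phi> A B = (\<Sum>a\<in>A. \<Sum>b\<in>B. p a b) - c * sum w A - c * sum w B" for A B
  have finF: "finite \<F>" using F U by (meson finite_Pow_iff finite_subset)
  have c: "c \<ge> 0" by (simp add: c_def)
  have w: "w a > 0" if "a \<in> \<F>" for a
    using mid[OF that] by (simp add: w_def)
  have lt: "card a < card b" if "a \<in> \<F>" "b \<in> \<F>" "a \<subset> b" for a b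
    using that F U by (meson PowD finite_subset psubset_card_mono subsetD)
  have pl: "p a b \<le> of_bool (a \<subset> b) * (w a / K)" if ab: "a \<in> \<F>" "b \<in> \<F>" for a b
  proof (cases "a \<subset> b")
    case True
    have "p a b \<le> w a / real (?n - card a)"
      using chain_weight_le_lower[of a b ?n] lt[OF ab True] mid[OF ab(2)] K True by (simp add: p_def w_def)
    also have "\<dots> \<le> w a / K"
      using mid[OF ab(1)] K w[OF ab(1)] by (intro divide_left_mono) auto
    finally show ?thesis using True by simp
  qed (simp add: p_def)
  have pu: "p a b \<le> of_bool (a \<subset> b) * (w b / K)" if ab: "a \<in> \<F>" "b \<in> \<F>" for a b
  proof (cases "a \<subset> b")
    case True
    have "p a b \<le> w b / real (card b)"
      using chain_weight_le_upper[of a b ?n] lt[OF ab True] mid[OF ab(1)] mid[OF ab(2)] K True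
      by (simp add: p_def w_def)
    also have "\<dots> \<le> w b / K"
      using mid[OF ab(2)] K w[OF ab(2)] by (intro divide_left_mono) auto
    finally show ?thesis using True by simp
  qed (simp add: p_def)
  \<comment> \<open>By \<open>sum_chain_weight_ge\<close> and \<open>big\<close>, the comparable
    pairs in the whole family outweigh both penalties. A maximizing pair then has a positive value
    and cannot have \<open>A\<close> empty.\<close>
  have pos: "\<Phi> \<F> \<F> > 0"
    using sum_chain_weight_ge[OF U F] big
    unfolding \<Phi>_def p_def w_def c_def by (simp add: algebra_simps)
  let ?S = "Pow \<F> \<times> Pow \<F>"
  have "finite ((\<lambda>(A, B). \<Phi> A B) ` ?S)" "(\<lambda>(A, B). \<Phi> A B) ` ?S \<noteq> {}"
    using finF by auto
  from Max_in[OF this] obtain A B where AB: "A \<subseteq> \<F>" "B \<subseteq> \<F>"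
    and M: "\<Phi> A B = Max ((\<lambda>(A, B). \<Phi> A B) ` ?S)" by auto
  have max: "\<Phi> A' B' \<le> \<Phi> A B" if "A' \<subseteq> \<F>" "B' \<subseteq> \<F>" for A' B'
    unfolding M using that finF by (intro Max_ge) auto
  have fin: "finite A" "finite B" using AB finF finite_subset by blast+
  have "A \<noteq> {}"
  proof
    assume "A = {}"
    moreover have "sum w B \<ge> 0" using w AB by (intro sum_nonneg less_imp_le) auto
    ultimately have "\<Phi> A B \<le> 0" using c by (simp add: \<Phi>_def)
    then show False using max[of \<F> \<F>] pos by simp
  qed
  moreover have "D \<le> card {b \<in> B. a \<subset> b}" if a: "a \<in> A" for a
  proof (rule ccontr)
    assume *: "\<not> ?thesis"
    have "(\<Sum>b\<in>B. p a b) \<le> (\<Sum>b\<in>B. of_bool (a \<subset> b) * (w a / K))"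
      by (intro sum_mono pl) (use a AB in auto)
    also have "\<dots> = card {b \<in> B. a \<subset> b} * (w a / K)"
      using fin by (simp add: sum_distrib_right[symmetric] Int_def del: times_divide_eq_right)
    also have "\<dots> < D * (w a / K)"
      using * w[of a] a AB K by (intro mult_strict_right_mono) auto
    also have "\<dots> = c * w a" by (simp add: c_def)
    finally have "\<Phi> A B < \<Phi> (A - {a}) B"
      using fin a by (simp add: \<Phi>_def sum.remove[of A a] algebra_simps)
    then show False using max[of "A - {a}" B] AB by force
  qed
  moreover have "D \<le> card {a \<in> A. a \<subset> b}" if b: "b \<in> B" for b
  proof (rule ccontr)
    assume *: "\<not> ?thesis"
    have "(\<Sum>a\<in>A. p a b) \<le> (\<Sum>a\<in>A. of_bool (a \<subset> b) * (w b / K))"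
      by (intro sum_mono pu) (use b AB in auto)
    also have "\<dots> = card {a \<in> A. a \<subset> b} * (w b / K)"
      using fin by (simp add: sum_distrib_right[symmetric] Int_def del: times_divide_eq_right)
    also have "\<dots> < D * (w b / K)"
      using * w[of b] b AB K by (intro mult_strict_right_mono) auto
    also have "\<dots> = c * w b" by (simp add: c_def)
    finally have "\<Phi> A B < \<Phi> A (B - {b})"
      using fin b by (simp add: \<Phi>_def sum.remove[of B b] sum.distrib algebra_simps)
    then show False using max[of A "B - {b}"] AB by force
  qed
  ultimately show ?thesis using that[of A B] AB by blast
qed

section \<open>Greedy embedding of forests\<close>

text \<open>The hypothesis \<open>degen\<close> makes \<open>r\<close> a forest on \<open>X\<close>.
  Embed everything except a vertex of degree at most one: the image of its neighbour offers
  \<open>D\<close> candidates, and fewer than \<open>D\<close> sets are occupied.\<close>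

lemma greedy_embedding:
  fixes A B :: "'a set set"
  assumes fin: "finite A" "finite B" "A \<noteq> {}"
    and degA: "\<And>a. a \<in> A \<Longrightarrow> D \<le> card {b \<in> B. a \<subset> b}"
    and degB: "\<And>b. b \<in> B \<Longrightarrow> D \<le> card {a \<in> A. a \<subset> b}"
    and r: "\<And>x y. (x, y) \<in> r \<Longrightarrow> x \<in> L \<and> y \<notin> L"
    and degen: "\<And>Y. Y \<subseteq> X \<Longrightarrow> Y \<noteq> {} \<Longrightarrow> \<exists>y\<in>Y. card {z \<in> Y. (y, z) \<in> r \<or> (z, y) \<in> r} \<le> 1"
    and X: "finite X" "card X \<le> D"
  shows "Y \<subseteq> X \<Longrightarrow> \<exists>\<psi>. inj_on \<psi> Y \<and> \<psi> ` (Y \<inter> L) \<subseteq> A \<and> \<psi> ` (Y - L) \<subseteq> B \<and>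
           (\<forall>x\<in>Y. \<forall>y\<in>Y. (x, y) \<in> r \<longrightarrow> \<psi> x \<subset> \<psi> y)"
proof (induction "card Y" arbitrary: Y)
  case 0
  then have "finite Y" using X finite_subset by blast
  then have "Y = {}" using 0 by simp
  then show ?case by auto
next
  case (Suc k)
  have finY: "finite Y" using Suc.prems X finite_subset by blast
  have "Y \<noteq> {}" using Suc.hyps(2) by auto
  then obtain y where y: "y \<in> Y" and deg: "card {z \<in> Y. (y, z) \<in> r \<or> (z, y) \<in> r} \<le> 1"
    using degen Suc.prems by blast
  define Y' where "Y' = Y - {y}"
  have "card Y' = k" "Y' \<subseteq> X" using Suc.hyps(2) Suc.prems y finY by (auto simp: Y'_def)
  then obtain \<psi> where \<psi>: "inj_on \<psi> Y'" "\<psi> ` (Y' \<inter> L) \<subseteq> A" "\<psi> ` (Y' - L) \<subseteq> B"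
    "\<And>u v. u \<in> Y' \<Longrightarrow> v \<in> Y' \<Longrightarrow> (u, v) \<in> r \<Longrightarrow> \<psi> u \<subset> \<psi> v"
    using Suc.hyps(1)[of Y'] by metis
  have D: "Suc k \<le> D" using card_mono[OF X(1) Suc.prems] Suc.hyps(2) X(2) by linarith
  have ext: ?case if t: "D \<le> card T" "T \<subseteq> (if y \<in> L then A else B)"
    and T: "\<And>t z. t \<in> T \<Longrightarrow> z \<in> Y' \<Longrightarrow> ((y, z) \<in> r \<longrightarrow> t \<subset> \<psi> z) \<and> ((z, y) \<in> r \<longrightarrow> \<psi> z \<subset> t)" for T
  proof -
    have "card (\<psi> ` Y') \<le> k" using \<open>card Y' = k\<close> card_image_le[of Y' \<psi>] finY by (simp add: Y'_def)
    then have "\<not> T \<subseteq> \<psi> ` Y'"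
      using t D finY card_mono[of "\<psi> ` Y'" T] by (auto simp: Y'_def)
    then obtain t where t': "t \<in> T" "t \<notin> \<psi> ` Y'" by auto
    define \<psi>' where "\<psi>' = \<psi>(y := t)"
    have eq: "\<psi>' z = \<psi> z" if "z \<in> Y'" for z using that by (auto simp: \<psi>'_def Y'_def)
    have Y: "Y = insert y Y'" "y \<notin> Y'" using y by (auto simp: Y'_def)
    have "inj_on \<psi>' Y" unfolding Y(1) using \<psi>(1) t'(2) Y(2) eq
      by (auto simp: inj_on_def \<psi>'_def)
    moreover have "\<psi>' ` (Y \<inter> L) \<subseteq> A" "\<psi>' ` (Y - L) \<subseteq> B"
      using \<psi>(2,3) t(2) t'(1) Y(2) by (auto simp: Y(1) \<psi>'_def split: if_splits)
    moreover have "\<psi>' u \<subset> \<psi>' v" if uv: "u \<in> Y" "v \<in> Y" "(u, v) \<in> r" for u v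
    proof -
      have "u \<noteq> v" using r[OF uv(3)] by auto
      then consider "u = y" "v \<in> Y'" | "v = y" "u \<in> Y'" | "u \<in> Y'" "v \<in> Y'"
        using uv Y by blast
      then show ?thesis
      proof cases
        case 1
        then have "\<psi>' u = t" "\<psi>' v = \<psi> v" using eq by (simp_all add: \<psi>'_def)
        then show ?thesis using T[OF t'(1) 1(2)] 1 uv by metis
      next
        case 2
        then have "\<psi>' v = t" "\<psi>' u = \<psi> u" using eq by (simp_all add: \<psi>'_def)
        then show ?thesis using T[OF t'(1) 2(2)] 2 uv by metis
      next
        case 3
        then show ?thesis using \<psi>(4) uv eq by metis
      qed
    qed
    ultimately have "inj_on \<psi>' Y \<and> \<psi>' ` (Y \<inter> L) \<subseteq> A \<and> \<psi>' ` (Y - L) \<subseteq> B \<and>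
        (\<forall>x\<in>Y. \<forall>y\<in>Y. (x, y) \<in> r \<longrightarrow> \<psi>' x \<subset> \<psi>' y)"
      by simp
    then show ?thesis by (rule exI[of _ \<psi>'])
  qed
  show ?case
  proof (cases "\<exists>z\<in>Y'. (y, z) \<in> r \<or> (z, y) \<in> r")
    case True
    then obtain z where z: "z \<in> Y'" "(y, z) \<in> r \<or> (z, y) \<in> r" by auto
    have uniq: "z' = z" if "z' \<in> Y'" "(y, z') \<in> r \<or> (z', y) \<in> r" for z'
    proof -
      have "finite {z \<in> Y. (y, z) \<in> r \<or> (z, y) \<in> r}" using finY by simp
      then show ?thesis
        using deg that z card_le_Suc0_iff_eq[of "{z \<in> Y. (y, z) \<in> r \<or> (z, y) \<in> r}"]
        unfolding Y'_def One_nat_def by blast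
    qed
    show ?thesis
    proof (cases "y \<in> L")
      case yL: True
      then have "(y, z) \<in> r" "z \<notin> L" using z r by blast+
      then have "\<psi> z \<in> B" using \<psi>(3) z by auto
      show ?thesis
      proof (rule ext)
        show "D \<le> card {a \<in> A. a \<subset> \<psi> z}" by (rule degB) fact
        show "{a \<in> A. a \<subset> \<psi> z} \<subseteq> (if y \<in> L then A else B)" using yL by auto
        fix t z' assume "t \<in> {a \<in> A. a \<subset> \<psi> z}" "z' \<in> Y'"
        then show "((y, z') \<in> r \<longrightarrow> t \<subset> \<psi> z') \<and> ((z', y) \<in> r \<longrightarrow> \<psi> z' \<subset> t)"
          using uniq r yL by blast
      qed
    next
      case yL: False
      then have "(z, y) \<in> r" "z \<in> L" using z r by blast+
      then have "\<psi> z \<in> A" using \<psi>(2) z by auto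
      show ?thesis
      proof (rule ext)
        show "D \<le> card {b \<in> B. \<psi> z \<subset> b}" by (rule degA) fact
        show "{b \<in> B. \<psi> z \<subset> b} \<subseteq> (if y \<in> L then A else B)" using yL by auto
        fix t z' assume "t \<in> {b \<in> B. \<psi> z \<subset> b}" "z' \<in> Y'"
        then show "((y, z') \<in> r \<longrightarrow> t \<subset> \<psi> z') \<and> ((z', y) \<in> r \<longrightarrow> \<psi> z' \<subset> t)"
          using uniq r yL by blast
      qed
    qed
  next
    case False
    \<comment> \<open>Without an embedded neighbour, any free set on the right side will do. Both
      sides have at least \<open>D\<close> members: \<open>A\<close> is nonempty, \<open>D\<close>
      is positive, and all degrees are at least \<open>D\<close>.\<close>
    obtain a where a: "a \<in> A" using fin by auto
    have "D \<le> card {b \<in> B. a \<subset> b}" by (rule degA[OF a])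
    moreover have "card {b \<in> B. a \<subset> b} \<le> card B" using fin by (intro card_mono) auto
    ultimately have DB: "D \<le> card B" by simp
    then obtain b where b: "b \<in> B" using D by fastforce
    have "D \<le> card {a \<in> A. a \<subset> b}" by (rule degB[OF b])
    moreover have "card {a \<in> A. a \<subset> b} \<le> card A" using fin by (intro card_mono) auto
    ultimately have "D \<le> card A" by simp
    then show ?thesis using DB False by (intro ext[of "if y \<in> L then A else B"]) auto
  qed
qed


section \<open>Families larger than the middle layer contain forests\<close>

lemma card_tails_le:
  assumes "n > 0"
  shows "card {a \<in> Pow {1..n}. card a < K \<or> n < card a + K} \<le> 2 * (K * n ^ K)"
proof -
  let ?L = "{a \<in> Pow {1..n}. card a < K}"
  have "?L = (\<Union>i<K. {a. a \<subseteq> {1..n} \<and> card a = i})" by auto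
  then have "card ?L \<le> (\<Sum>i<K. card {a. a \<subseteq> {1..n} \<and> card a = i})"
    using card_UN_le[of "{..<K}" "\<lambda>i. {a. a \<subseteq> {1..n} \<and> card a = i}"] by simp
  also have "\<dots> = (\<Sum>i<K. n choose i)" by (simp add: n_subsets)
  also have "\<dots> \<le> (\<Sum>i<K. n ^ K)"
  proof (intro sum_mono)
    fix i assume "i \<in> {..<K}"
    have "n choose i \<le> n ^ i"
      using binomial_le_pow[of i n] by (cases "i \<le> n") (auto simp: not_le binomial_eq_0)
    also have "\<dots> \<le> n ^ K" using \<open>i \<in> {..<K}\<close> assms by (intro power_increasing) auto
    finally show "n choose i \<le> n ^ K" .
  qed
  finally have L: "card ?L \<le> K * n ^ K" by simp
  have "{a \<in> Pow {1..n}. card a < K \<or> n < card a + K} \<subseteq> ?L \<union> (\<lambda>a. {1..n} - a) ` ?L"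
  proof
    fix a assume a: "a \<in> {a \<in> Pow {1..n}. card a < K \<or> n < card a + K}"
    then have sub: "a \<subseteq> {1..n}" by auto
    show "a \<in> ?L \<union> (\<lambda>a. {1..n} - a) ` ?L"
    proof (cases "card a < K")
      case False
      have "card a \<le> n" using card_mono[OF _ sub] by simp
      moreover have "card ({1..n} - a) = n - card a"
        using card_Diff_subset[of a "{1..n}"] finite_subset[OF sub] sub by simp
      ultimately have "{1..n} - a \<in> ?L" using False a by auto
      moreover have "a = {1..n} - ({1..n} - a)" using sub by auto
      ultimately show ?thesis by blast
    qed (use a in auto)
  qed
  then have "card {a \<in> Pow {1..n}. card a < K \<or> n < card a + K} \<le> card (?L \<union> (\<lambda>a. {1..n} - a) ` ?L)"
    by (intro card_mono) auto
  also have "\<dots> \<le> card ?L + card ?L"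
    by (intro order_trans[OF card_Un_le] add_left_mono card_image_le) auto
  finally show ?thesis using L by simp
qed

lemma central_binomial_ge: "2 ^ n \<le> (n + 1) * (n choose (n div 2))"
proof -
  have "2 ^ n = (\<Sum>k\<le>n. n choose k)" by (simp add: choose_row_sum)
  also have "\<dots> \<le> (\<Sum>k\<le>n. n choose (n div 2))" by (intro sum_mono binomial_maximum)
  finally show ?thesis by simp
qed

text \<open>For fixed \<open>K\<close> there are only polynomially many sets of extreme size,
  against a middle layer of at least \<open>2 ^ n / (n + 1)\<close> sets.\<close>

lemma eventually_tails_small:
  fixes \<epsilon> :: real
  assumes "\<epsilon> > 0"
  shows "eventually (\<lambda>n. real (card {a \<in> Pow {1..n}. card a < K \<or> n < card a + K})
            \<le> \<epsilon> * real (n choose (n div 2))) sequentially"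
proof -
  have "(\<lambda>n. 2 * (real K * real n ^ K) * (real n + 1) / 2 ^ n) \<longlonglongrightarrow> 0"
    by real_asymp
  then have "eventually (\<lambda>n. 2 * (real K * real n ^ K) * (real n + 1) / 2 ^ n < \<epsilon>) sequentially"
    using assms by (rule order_tendstoD)
  then show ?thesis
    using eventually_gt_at_top[of 0]
  proof eventually_elim
    case (elim n)
    have "real (card {a \<in> Pow {1..n}. card a < K \<or> n < card a + K}) \<le> 2 * (real K * real n ^ K)"
      using of_nat_mono[OF card_tails_le[OF elim(2), of K], where 'a = real] by simp
    moreover have "2 * (real K * real n ^ K) * (real n + 1) \<le> \<epsilon> * 2 ^ n"
      using elim(1) by (simp add: field_simps)
    moreover have "\<epsilon> * 2 ^ n \<le> \<epsilon> * ((real n + 1) * real (n choose (n div 2)))"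
      using of_nat_mono[OF central_binomial_ge[of n], where 'a = real] assms
      by (intro mult_left_mono) (auto simp: algebra_simps)
    ultimately have "real (card {a \<in> Pow {1..n}. card a < K \<or> n < card a + K}) * (real n + 1)
        \<le> \<epsilon> * real (n choose (n div 2)) * (real n + 1)"
      by (smt (verit) mult.assoc mult.commute mult_right_mono of_nat_0_le_iff)
    then show ?case by (rule mult_right_le_imp_le) simp
  qed
qed

lemma finite_weak_free_cards:
  fixes n :: nat
  shows "finite {card \<F> | \<F>. \<F> \<subseteq> Pow {1..n} \<and> weak_free P \<F>}"
proof -
  have "{card \<F> | \<F>. \<F> \<subseteq> Pow {1..n} \<and> weak_free P \<F>} \<subseteq> card ` Pow (Pow {1..n})" by auto
  then show ?thesis by (rule finite_subset) simp
qed

lemma La_attained: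
  assumes "Field P \<noteq> {}"
  obtains \<F> where "\<F> \<subseteq> Pow {1..n}" "weak_free P \<F>" "La n P = card \<F>"
proof -
  let ?X = "{card \<F> | \<F>. \<F> \<subseteq> Pow {1..n} \<and> weak_free P \<F>}"
  have "finite ?X" by (rule finite_weak_free_cards)
  moreover have "card ({} :: nat set set) \<in> ?X"
    using weak_free_empty[OF assms] by blast
  ultimately have "Max ?X \<in> ?X" by (intro Max_in) auto
  then show ?thesis using that La_eq_Max[OF assms, of n] by auto
qed

lemma La_ge:
  assumes "Field P \<noteq> {}" "\<F> \<subseteq> Pow {1..n}" "weak_free P \<F>"
  shows "card \<F> \<le> La n P"
proof -
  let ?X = "{card \<F> | \<F>. \<F> \<subseteq> Pow {1..n} \<and> weak_free P \<F>}"
  have "finite ?X" by (rule finite_weak_free_cards)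
  then show ?thesis unfolding La_eq_Max[OF assms(1)] using assms by (intro Max_ge) auto
qed

lemma not_weak_free_if_dense:
  assumes Q: "finite_poset Q" "Field Q \<noteq> {}"
    and L: "\<And>x y. (x, y) \<in> Q \<Longrightarrow> x \<noteq> y \<Longrightarrow> x \<in> L \<and> y \<notin> L"
    and degen: "\<And>Y. Y \<subseteq> Field Q \<Longrightarrow> Y \<noteq> {} \<Longrightarrow>
       \<exists>y\<in>Y. card {z \<in> Y. z \<noteq> y \<and> ((y, z) \<in> Q \<or> (z, y) \<in> Q)} \<le> 1"
    and U: "finite U" and F: "\<F> \<subseteq> Pow U" and K: "K > 0"
    and mid: "\<And>a. a \<in> \<F> \<Longrightarrow> K \<le> card a \<and> card a + K \<le> card U"
    and big: "(1 - 2 * (real (card (Field Q)) / real K)) * (\<Sum>a\<in>\<F>. 1 / real (card U choose card a)) > 1"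
  shows "\<not> weak_free Q \<F>"
proof -
  obtain A B where AB: "A \<subseteq> \<F>" "B \<subseteq> \<F>" "A \<noteq> {}"
    and dA: "\<And>a. a \<in> A \<Longrightarrow> card (Field Q) \<le> card {b \<in> B. a \<subset> b}"
    and dB: "\<And>b. b \<in> B \<Longrightarrow> card (Field Q) \<le> card {a \<in> A. a \<subset> b}"
    using exists_min_degree_pair[OF U F K mid big] by blast
  have "finite \<F>" using F U by (meson finite_Pow_iff finite_subset)
  then have fin: "finite A" "finite B" using AB finite_subset by blast+
  let ?r = "{(x, y). (x, y) \<in> Q \<and> x \<noteq> y}"
  have "\<exists>\<psi>. inj_on \<psi> (Field Q) \<and> \<psi> ` (Field Q \<inter> L) \<subseteq> A \<and> \<psi> ` (Field Q - L) \<subseteq> B \<and>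
           (\<forall>x\<in>Field Q. \<forall>y\<in>Field Q. (x, y) \<in> ?r \<longrightarrow> \<psi> x \<subset> \<psi> y)"
  proof (rule greedy_embedding[OF fin AB(3) dA dB])
    show "\<exists>y\<in>Y. card {z \<in> Y. (y, z) \<in> ?r \<or> (z, y) \<in> ?r} \<le> 1"
      if "Y \<subseteq> Field Q" "Y \<noteq> {}" for Y
    proof -
      have "{z \<in> Y. (y, z) \<in> ?r \<or> (z, y) \<in> ?r} = {z \<in> Y. z \<noteq> y \<and> ((y, z) \<in> Q \<or> (z, y) \<in> Q)}" for y
        by auto
      moreover from degen[OF that] obtain y
        where "y \<in> Y" "card {z \<in> Y. z \<noteq> y \<and> ((y, z) \<in> Q \<or> (z, y) \<in> Q)} \<le> 1"
        by blast
      ultimately show ?thesis by (intro bexI[of _ y]) simp_all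
    qed
    show "finite (Field Q)" using Q by (simp add: finite_poset_def)
  qed (use L in auto)
  then obtain \<psi> where \<psi>: "inj_on \<psi> (Field Q)" "\<psi> ` (Field Q \<inter> L) \<subseteq> A" "\<psi> ` (Field Q - L) \<subseteq> B"
    "\<forall>x\<in>Field Q. \<forall>y\<in>Field Q. (x, y) \<in> ?r \<longrightarrow> \<psi> x \<subset> \<psi> y"
    by (elim exE conjE) (rule that)
  have "\<psi> p \<subseteq> \<psi> q" if "(p, q) \<in> Q" for p q
  proof (cases "p = q")
    case False
    then have "\<psi> p \<subset> \<psi> q" using \<psi>(4) that by (simp add: FieldI1 FieldI2)
    then show ?thesis by (rule psubset_imp_subset)
  qed simp
  then have "weak_copy Q (\<psi> ` Field Q)"
    unfolding weak_copy_def using \<psi>(1) by (auto simp: bij_betw_def)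
  moreover have "\<psi> ` Field Q \<subseteq> \<F>" using \<psi>(2,3) AB by blast
  ultimately show ?thesis unfolding weak_free_def by blast
qed

lemma pi_minus_le_1:
  assumes Q: "finite_poset Q" "Field Q \<noteq> {}"
    and L: "\<And>x y. (x, y) \<in> Q \<Longrightarrow> x \<noteq> y \<Longrightarrow> x \<in> L \<and> y \<notin> L"
    and degen: "\<And>Y. Y \<subseteq> Field Q \<Longrightarrow> Y \<noteq> {} \<Longrightarrow>
       \<exists>y\<in>Y. card {z \<in> Y. z \<noteq> y \<and> ((y, z) \<in> Q \<or> (z, y) \<in> Q)} \<le> 1"
  shows "pi_minus Q \<le> 1"
proof (rule ccontr)
  assume "\<not> pi_minus Q \<le> 1"
  then obtain c where c: "ereal c < pi_minus Q" "1 < c"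
    using ereal_dense2[of 1 "pi_minus Q"] by (auto simp: not_le one_ereal_def)
  \<comment> \<open>Half of the surplus \<open>c - 1 = 2 * \<delta>\<close> pays for the sets of
    extreme size. The other half has to survive the factor \<open>1 - 2 * (?D / K)\<close> required
    by \<open>not_weak_free_if_dense\<close>, and this determines \<open>K\<close>.\<close>
  define \<delta> where "\<delta> = (c - 1) / 2"
  have \<delta>: "\<delta> > 0" using c by (simp add: \<delta>_def)
  let ?D = "real (card (Field Q))"
  obtain K where K: "2 * ?D * (1 + \<delta>) / \<delta> < real K" using reals_Archimedean2 by blast
  have K0: "K > 0"
  proof -
    have "0 \<le> 2 * ?D * (1 + \<delta>) / \<delta>" using \<delta> by simp
    then show ?thesis using K by linarith
  qed
  have K1: "2 * (?D / real K) * (1 + \<delta>) < \<delta>"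
    using K K0 \<delta> by (simp add: field_simps)
  have K2: "1 - 2 * (?D / real K) \<ge> 0"
  proof (rule ccontr)
    assume "\<not> ?thesis"
    then have "1 * (1 + \<delta>) \<le> 2 * (?D / real K) * (1 + \<delta>)" using \<delta> by (intro mult_right_mono) auto
    then show False using K1 by simp
  qed
  have "eventually (\<lambda>n. ereal c < ereal (real (La n Q) / real (n choose (n div 2)))) sequentially"
    using c(1) unfolding pi_minus_def by (rule less_LiminfD)
  then have "eventually (\<lambda>n::nat. False) sequentially"
    using eventually_tails_small[OF \<delta>, of K]
  proof eventually_elim
    case (elim n)
    let ?T = "{a \<in> Pow {1..n}. card a < K \<or> n < card a + K}"
    let ?b = "real (n choose (n div 2))"
    have b: "?b > 0" by simp
    obtain \<F> where F: "\<F> \<subseteq> Pow {1..n}" "weak_free Q \<F>" "La n Q = card \<F>"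
      using La_attained[OF Q(2)] by blast
    define \<F>' where "\<F>' = \<F> - ?T"
    have finF: "finite \<F>" using F by (meson finite_Pow_iff finite_atLeastAtMost finite_subset)
    have "c * ?b < card \<F>" using elim(1) b F by (simp add: field_simps)
    moreover have "card \<F> \<le> card \<F>' + card ?T"
    proof -
      have "\<F> \<subseteq> \<F>' \<union> ?T" by (auto simp: \<F>'_def)
      then have "card \<F> \<le> card (\<F>' \<union> ?T)" using finF by (intro card_mono) (auto simp: \<F>'_def)
      then show ?thesis using card_Un_le[of \<F>' ?T] by linarith
    qed
    ultimately have "c * ?b \<le> card \<F>' + \<delta> * ?b" using elim(2) by linarith
    then have "(1 + \<delta>) * ?b \<le> card \<F>'" by (simp add: \<delta>_def field_simps)
    then have "1 + \<delta> \<le> card \<F>' / ?b" using b by (simp add: field_simps)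
    also have "\<dots> = (\<Sum>a\<in>\<F>'. 1 / ?b)" by simp
    also have "\<dots> \<le> (\<Sum>a\<in>\<F>'. 1 / real (card {1..n} choose card a))"
    proof (intro sum_mono divide_left_mono)
      fix a assume "a \<in> \<F>'"
      then have "a \<subseteq> {1..n}" using F(1) by (auto simp: \<F>'_def)
      then have "card a \<le> n" using card_mono[of "{1..n}" a] by simp
      then show "?b * real (card {1..n} choose card a) > 0" using b by simp
      show "real (card {1..n} choose card a) \<le> ?b" using binomial_maximum[of n "card a"] by simp
    qed simp
    finally have "(1 - 2 * (?D / real K)) * (1 + \<delta>)
        \<le> (1 - 2 * (?D / real K)) * (\<Sum>a\<in>\<F>'. 1 / real (card {1..n} choose card a))"
      using K2 by (rule mult_left_mono)
    moreover have "(1 - 2 * (?D / real K)) * (1 + \<delta>) > 1"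
      using K1 by (simp add: algebra_simps)
    ultimately have "\<not> weak_free Q \<F>'"
      by (intro not_weak_free_if_dense[OF Q L degen, of "{1..n}" \<F>' K])
         (use F(1) K0 in \<open>auto simp: \<F>'_def not_less\<close>)
    moreover have "weak_free Q \<F>'" using F(2) by (auto simp: weak_free_def \<F>'_def)
    ultimately show False by simp
  qed
  then show False by simp
qed

section \<open>Sparse random graphs\<close>

text \<open>The probability of \<open>G\<close> when each element of the finite set \<open>K\<close>
  is chosen independently with probability \<open>p\<close>.\<close>

definition graph_weight :: "real \<Rightarrow> 'e set \<Rightarrow> 'e set \<Rightarrow> real" where
  "graph_weight p K G = p ^ card G * (1 - p) ^ card (K - G)"

definition graph_prob :: "real \<Rightarrow> 'e set \<Rightarrow> ('e set \<Rightarrow> bool) \<Rightarrow> real" where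
  "graph_prob p K P = (\<Sum>G\<in>Pow K. graph_weight p K G * of_bool (P G))"

lemma sum_Pow_power: "finite V \<Longrightarrow> (\<Sum>S\<in>Pow V. q ^ card S) = (1 + q) ^ card V" for q :: real
  using prod_add[of V "\<lambda>_. q" "\<lambda>_. 1"] by (simp add: add.commute)

text \<open>The probability generating function of the binomially distributed
  \<open>card (G \<inter> X)\<close>; expanding the product over \<open>K\<close> gives the sum over
  its subsets. All tail bounds below result from it by a choice of \<open>t\<close>.\<close>

lemma sum_graph_weight:
  assumes K: "finite K" and X: "X \<subseteq> K"
  shows "(\<Sum>G\<in>Pow K. graph_weight p K G * t ^ card (G \<inter> X)) = (1 - p + p * t) ^ card X"
proof -
  let ?f = "\<lambda>e. p * (if e \<in> X then t else 1)"
  have "(\<Sum>G\<in>Pow K. graph_weight p K G * t ^ card (G \<inter> X))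
      = (\<Sum>G\<in>Pow K. (\<Prod>e\<in>G. ?f e) * (\<Prod>e\<in>K - G. 1 - p))"
  proof (intro sum.cong refl)
    fix G assume "G \<in> Pow K"
    then have "finite G" using K finite_subset by auto
    have "(\<Prod>e\<in>G. ?f e) = p ^ card G * (\<Prod>e\<in>G. if e \<in> X then t else 1)"
      by (simp add: prod.distrib)
    also have "(\<Prod>e\<in>G. if e \<in> X then t else 1) = t ^ card (G \<inter> X)"
      using \<open>finite G\<close> by (simp add: prod.If_cases)
    finally show "graph_weight p K G * t ^ card (G \<inter> X) = (\<Prod>e\<in>G. ?f e) * (\<Prod>e\<in>K - G. 1 - p)"
      by (simp add: graph_weight_def)
  qed
  also have "\<dots> = (\<Prod>e\<in>K. ?f e + (1 - p))" by (rule prod_add[symmetric, OF K])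
  also have "\<dots> = (\<Prod>e\<in>X. 1 - p + p * t)"
    using K X by (intro prod.mono_neutral_cong_right) auto
  finally show ?thesis by simp
qed

context
  fixes p :: real and K :: "'e set"
  assumes p: "0 \<le> p" "p \<le> 1" and K: "finite K"
begin

lemma graph_weight_nonneg: "graph_weight p K G \<ge> 0"
  using p by (simp add: graph_weight_def)

lemma graph_prob_markov:
  assumes "X \<subseteq> K" "t \<ge> 0" "c \<ge> 0"
    and P: "\<And>G. G \<subseteq> K \<Longrightarrow> P G \<Longrightarrow> 1 \<le> c * t ^ card (G \<inter> X)"
  shows "graph_prob p K P \<le> c * (1 - p + p * t) ^ card X"
proof -
  have "graph_prob p K P \<le> (\<Sum>G\<in>Pow K. graph_weight p K G * (c * t ^ card (G \<inter> X)))"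
    unfolding graph_prob_def using P assms(2,3)
    by (intro sum_mono mult_left_mono graph_weight_nonneg) (auto simp: of_bool_def)
  also have "\<dots> = c * (\<Sum>G\<in>Pow K. graph_weight p K G * t ^ card (G \<inter> X))"
    by (simp add: sum_distrib_left mult_ac)
  finally show ?thesis using sum_graph_weight[OF K assms(1)] by simp
qed

lemma graph_prob_disj: "graph_prob p K (\<lambda>G. P G \<or> Q G) \<le> graph_prob p K P + graph_prob p K Q"
  unfolding graph_prob_def sum.distrib[symmetric] distrib_left[symmetric]
  by (intro sum_mono mult_left_mono graph_weight_nonneg) (auto simp: of_bool_def)

lemma graph_prob_bex:
  assumes "finite I"
  shows "graph_prob p K (\<lambda>G. \<exists>i\<in>I. P i G) \<le> (\<Sum>i\<in>I. graph_prob p K (P i))"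
  using assms
proof (induction I rule: finite_induct)
  case empty
  then show ?case by (simp add: graph_prob_def)
next
  case (insert i I)
  have "graph_prob p K (\<lambda>G. \<exists>i\<in>insert i I. P i G) = graph_prob p K (\<lambda>G. P i G \<or> (\<exists>i\<in>I. P i G))"
    by simp
  also have "\<dots> \<le> graph_prob p K (P i) + graph_prob p K (\<lambda>G. \<exists>i\<in>I. P i G)" by (rule graph_prob_disj)
  finally show ?case using insert by simp
qed

lemma graph_prob_less_1D:
  assumes "graph_prob p K P < 1"
  shows "\<exists>G \<subseteq> K. \<not> P G"
proof (rule ccontr)
  assume "\<not> ?thesis"
  then have "graph_prob p K P = (\<Sum>G\<in>Pow K. graph_weight p K G * 1 ^ card (G \<inter> {}))"
    unfolding graph_prob_def by (intro sum.cong refl) auto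
  also have "\<dots> = 1" using sum_graph_weight[OF K, of "{}" p 1] by simp
  finally show False using assms by simp
qed

lemma graph_prob_lower_tail:
  assumes X: "X \<subseteq> K" and \<eta>: "0 < \<eta>" "\<eta> \<le> 1"
  shows "graph_prob p K (\<lambda>G. real (card (G \<inter> X)) < (1 - \<eta>) * p * card X) \<le> exp (- (\<eta>\<^sup>2 / 8 * p * card X))"
proof -
  \<comment> \<open>The Chernoff parameter: \<open>- \<eta> * s + 2 * s\<^sup>2\<close> is smallest
    at \<open>s = \<eta> / 4\<close>, where it equals \<open>- \<eta>\<^sup>2 / 8\<close>. The upper
    tail leads to the same quadratic.\<close>
  define s where "s = \<eta> / 4"
  define a where "a = (1 - \<eta>) * p * card X"
  have s: "0 < s" "s \<le> 1/4" using \<eta> by (auto simp: s_def)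
  have pw: "(1 - s) ^ k = exp (real k * ln (1 - s))" for k
    using s by (simp add: exp_of_nat_mult)
  have "graph_prob p K (\<lambda>G. real (card (G \<inter> X)) < a) \<le> exp (- a * ln (1 - s)) * (1 - p + p * (1 - s)) ^ card X"
  proof (rule graph_prob_markov[OF X])
    fix G assume "real (card (G \<inter> X)) < a"
    then have "a * ln (1 - s) \<le> real (card (G \<inter> X)) * ln (1 - s)"
      using s by (intro mult_right_mono_neg) auto
    then have "1 \<le> exp (- a * ln (1 - s) + real (card (G \<inter> X)) * ln (1 - s))" by simp
    also have "\<dots> = exp (- a * ln (1 - s)) * (1 - s) ^ card (G \<inter> X)"
      by (simp only: exp_add pw)
    finally show "1 \<le> exp (- a * ln (1 - s)) * (1 - s) ^ card (G \<inter> X)" .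
  qed (use s in auto)
  also have "\<dots> \<le> exp (- a * ln (1 - s)) * exp (- (p * s)) ^ card X"
  proof (intro mult_left_mono power_mono)
    show "1 - p + p * (1 - s) \<le> exp (- (p * s))" using exp_ge_add_one_self[of "- (p * s)"] by (simp add: algebra_simps)
    have "0 \<le> p * (1 - s)" using p s by simp
    then show "0 \<le> 1 - p + p * (1 - s)" using p by simp
  qed simp
  also have "\<dots> = exp (p * card X * (- s - (1 - \<eta>) * ln (1 - s)))"
    by (simp add: exp_of_nat_mult[symmetric] exp_add[symmetric] a_def algebra_simps)
  also have "\<dots> \<le> exp (- (\<eta>\<^sup>2 / 8 * p * card X))"
  proof -
    have "- s - 2 * s\<^sup>2 \<le> ln (1 - s)" using s by (intro ln_one_minus_pos_lower_bound) auto
    then have "(1 - \<eta>) * (- s - 2 * s\<^sup>2) \<le> (1 - \<eta>) * ln (1 - s)" using \<eta> by (intro mult_left_mono) auto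
    then have "- s - (1 - \<eta>) * ln (1 - s) \<le> - s + (1 - \<eta>) * (s + 2 * s\<^sup>2)" by (simp add: algebra_simps)
    also have "\<dots> = - \<eta> * s + 2 * s\<^sup>2 - 2 * \<eta> * s\<^sup>2" by (simp add: algebra_simps)
    also have "\<dots> \<le> - \<eta> * s + 2 * s\<^sup>2" using \<eta> by simp
    also have "\<dots> = - (\<eta>\<^sup>2 / 8)" by (simp add: s_def power2_eq_square)
    finally have "p * card X * (- s - (1 - \<eta>) * ln (1 - s)) \<le> p * card X * (- (\<eta>\<^sup>2 / 8))"
      using p by (intro mult_left_mono) auto
    then show ?thesis by (simp add: mult_ac)
  qed
  finally show ?thesis by (simp add: a_def)
qed

lemma graph_prob_upper_tail:
  assumes X: "X \<subseteq> K" and \<eta>: "0 < \<eta>" "\<eta> \<le> 1"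
  shows "graph_prob p K (\<lambda>G. real (card (G \<inter> X)) > (1 + \<eta>) * p * card X) \<le> exp (- (\<eta>\<^sup>2 / 8 * p * card X))"
proof -
  define s where "s = \<eta> / 4"
  define a where "a = (1 + \<eta>) * p * card X"
  have s: "0 < s" "s \<le> 1/4" using \<eta> by (auto simp: s_def)
  have pw: "(1 + s) ^ k = exp (real k * ln (1 + s))" for k
    using s by (simp add: exp_of_nat_mult)
  have "graph_prob p K (\<lambda>G. real (card (G \<inter> X)) > a) \<le> exp (- a * ln (1 + s)) * (1 - p + p * (1 + s)) ^ card X"
  proof (rule graph_prob_markov[OF X])
    fix G assume "real (card (G \<inter> X)) > a"
    then have "a * ln (1 + s) \<le> real (card (G \<inter> X)) * ln (1 + s)"
      using s by (intro mult_right_mono) auto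
    then have "1 \<le> exp (- a * ln (1 + s) + real (card (G \<inter> X)) * ln (1 + s))" by simp
    also have "\<dots> = exp (- a * ln (1 + s)) * (1 + s) ^ card (G \<inter> X)"
      by (simp only: exp_add pw)
    finally show "1 \<le> exp (- a * ln (1 + s)) * (1 + s) ^ card (G \<inter> X)" .
  qed (use s in auto)
  also have "\<dots> \<le> exp (- a * ln (1 + s)) * exp (p * s) ^ card X"
  proof (intro mult_left_mono power_mono)
    show "1 - p + p * (1 + s) \<le> exp (p * s)" using exp_ge_add_one_self[of "p * s"] by (simp add: algebra_simps)
    have "0 \<le> p * (1 + s)" using p s by simp
    then show "0 \<le> 1 - p + p * (1 + s)" using p by simp
  qed simp
  also have "\<dots> = exp (p * card X * (s - (1 + \<eta>) * ln (1 + s)))"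
    by (simp add: exp_of_nat_mult[symmetric] exp_add[symmetric] a_def algebra_simps)
  also have "\<dots> \<le> exp (- (\<eta>\<^sup>2 / 8 * p * card X))"
  proof -
    have "s - s\<^sup>2 \<le> ln (1 + s)" using s by (intro ln_one_plus_pos_lower_bound) auto
    then have "(1 + \<eta>) * (s - s\<^sup>2) \<le> (1 + \<eta>) * ln (1 + s)" using \<eta> by (intro mult_left_mono) auto
    then have "s - (1 + \<eta>) * ln (1 + s) \<le> s - (1 + \<eta>) * (s - s\<^sup>2)" by simp
    also have "\<dots> = - \<eta> * s + (1 + \<eta>) * s\<^sup>2" by (simp add: algebra_simps)
    also have "\<dots> \<le> - \<eta> * s + 2 * s\<^sup>2" using \<eta> by (intro add_left_mono mult_right_mono) auto
    also have "\<dots> = - (\<eta>\<^sup>2 / 8)" by (simp add: s_def power2_eq_square)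
    finally have "p * card X * (s - (1 + \<eta>) * ln (1 + s)) \<le> p * card X * (- (\<eta>\<^sup>2 / 8))"
      using p by (intro mult_left_mono) auto
    then show ?thesis by (simp add: mult_ac)
  qed
  finally show ?thesis by (simp add: a_def)
qed

text \<open>Markov's inequality with \<open>t = 1 / p\<close>, for which
  \<open>1 - p + p * t = 2 - p \<le> 2\<close>. The crude factor \<open>2 ^ card X\<close> does no
  harm, since \<open>X\<close> will consist of the pairs within a vertex set of bounded
  size.\<close>

lemma graph_prob_many:
  assumes X: "X \<subseteq> K" and p0: "0 < p"
  shows "graph_prob p K (\<lambda>G. k \<le> card (G \<inter> X)) \<le> 2 ^ card X * p ^ k"
proof -
  have "graph_prob p K (\<lambda>G. k \<le> card (G \<inter> X)) \<le> p ^ k * (1 - p + p * (1 / p)) ^ card X"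
  proof (rule graph_prob_markov[OF X])
    fix G assume k: "k \<le> card (G \<inter> X)"
    have "p ^ card (G \<inter> X) \<le> p ^ k" using p k by (intro power_decreasing) auto
    then show "1 \<le> p ^ k * (1 / p) ^ card (G \<inter> X)" using p0 by (simp add: power_divide field_simps)
  qed (use p0 in auto)
  also have "\<dots> \<le> p ^ k * 2 ^ card X" using p0 p by (intro mult_left_mono power_mono) auto
  finally show ?thesis by (simp add: mult.commute)
qed

end

section \<open>Graphs with regular cuts and sparse small vertex sets\<close>

lemma card_cut_pairs:
  assumes V: "finite V" and S: "S \<subseteq> V"
  shows "card (cut (pairs V) S) = card S * card (V - S)"
proof -
  have "cut (pairs V) S = (\<lambda>(u, v). {u, v}) ` (S \<times> (V - S))"
  proof
    show "cut (pairs V) S \<subseteq> (\<lambda>(u, v). {u, v}) ` (S \<times> (V - S))"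
    proof
      fix e assume e: "e \<in> cut (pairs V) S"
      then have "e \<in> pairs V" by (simp add: cut_def)
      then obtain u v where uv: "e = {u, v}" "u \<noteq> v" "u \<in> V" "v \<in> V"
        by (rule pairsE)
      then have "u \<in> S \<and> v \<in> V - S \<or> v \<in> S \<and> u \<in> V - S" using e by (auto simp: cut_def)
      then show "e \<in> (\<lambda>(u, v). {u, v}) ` (S \<times> (V - S))"
        using uv by (metis (no_types, lifting) SigmaI case_prod_conv image_eqI insert_commute)
    qed
    show "(\<lambda>(u, v). {u, v}) ` (S \<times> (V - S)) \<subseteq> cut (pairs V) S"
      using S by (auto simp: cut_def pairs_def card_insert_if)
  qed
  moreover have "inj_on (\<lambda>(u, v). {u, v}) (S \<times> (V - S))"
    by (auto simp: inj_on_def doubleton_eq_iff)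
  ultimately show ?thesis by (simp add: card_image card_cartesian_product)
qed

text \<open>It limits the damage when a matching is deleted: a cut loses at most as many edges as
  either side has vertices, and a vertex set at most as many as it has members.\<close>

lemma card_matching_le:
  assumes "finite S" "\<And>e. e \<in> D \<Longrightarrow> e \<inter> S \<noteq> {}"
    and "\<And>d e. d \<in> D \<Longrightarrow> e \<in> D \<Longrightarrow> d \<noteq> e \<Longrightarrow> d \<inter> e = {}"
  shows "card D \<le> card S"
proof -
  define r where "r e = (SOME x. x \<in> e \<inter> S)" for e
  have r: "r e \<in> e \<inter> S" if "e \<in> D" for e
  proof -
    have "\<exists>x. x \<in> e \<inter> S" using assms(2)[OF that] by blast
    then show ?thesis unfolding r_def by (rule someI_ex)
  qed
  have "inj_on r D"
  proof (rule inj_onI, rule ccontr)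
    fix d e assume de: "d \<in> D" "e \<in> D" "r d = r e" "d \<noteq> e"
    then have "r d \<in> d \<inter> e" using r[of d] r[of e] by auto
    then show False using assms(3) de by blast
  qed
  moreover have "r ` D \<subseteq> S" using r by auto
  ultimately show ?thesis using assms(1) by (meson card_inj_on_le)
qed

text \<open>Two overlapping minimal vertex sets with as many edges as vertices would have a union with more
  edges than vertices, so they are disjoint and one edge can be deleted from each.\<close>

lemma exists_sparse_subgraph:
  fixes E :: "'v set set"
  assumes V: "finite V" and E: "E \<subseteq> pairs V"
    and dense: "\<And>W. W \<subseteq> V \<Longrightarrow> W \<noteq> {} \<Longrightarrow> card W \<le> 2 * g \<Longrightarrow> card {e \<in> E. e \<subseteq> W} \<le> card W"
  obtains D where "D \<subseteq> E" "\<And>d e. d \<in> D \<Longrightarrow> e \<in> D \<Longrightarrow> d \<noteq> e \<Longrightarrow> d \<inter> e = {}"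
    "\<And>W. W \<subseteq> V \<Longrightarrow> W \<noteq> {} \<Longrightarrow> card W \<le> g \<Longrightarrow> card {e \<in> E - D. e \<subseteq> W} < card W"
proof -
  have finE: "finite E" using E finite_pairs[OF V] finite_subset by blast
  define ed where "ed W = card {e \<in> E. e \<subseteq> W}" for W
  define M where "M = {W. W \<subseteq> V \<and> W \<noteq> {} \<and> card W \<le> g \<and> card W \<le> ed W \<and>
    (\<forall>W' \<subset> W. W' \<noteq> {} \<longrightarrow> ed W' < card W')}"
  have ed_Un: "ed A + ed B \<le> ed (A \<union> B) + ed (A \<inter> B)" for A B
  proof -
    have "ed A + ed B = card ({e \<in> E. e \<subseteq> A} \<union> {e \<in> E. e \<subseteq> B}) + card ({e \<in> E. e \<subseteq> A} \<inter> {e \<in> E. e \<subseteq> B})"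
      unfolding ed_def using finE by (intro card_Un_Int) auto
    also have "\<dots> \<le> ed (A \<union> B) + ed (A \<inter> B)"
      unfolding ed_def using finE by (intro add_mono card_mono) auto
    finally show ?thesis .
  qed
  have disj: "A \<inter> B = {}" if A: "A \<in> M" and B: "B \<in> M" and AB: "A \<noteq> B" for A B
  proof (rule ccontr)
    assume ne: "A \<inter> B \<noteq> {}"
    have fin: "finite A" "finite B" using A B V finite_subset by (auto simp: M_def)
    have "\<not> A \<subset> B"
    proof
      assume "A \<subset> B"
      then have "ed A < card A" using A B unfolding M_def by blast
      then show False using A by (simp add: M_def)
    qed
    then have "A \<inter> B \<subset> A" using AB by auto
    then have 1: "ed (A \<inter> B) < card (A \<inter> B)" using A ne by (auto simp: M_def)
    have 2: "card (A \<union> B) + card (A \<inter> B) = card A + card B" using card_Un_Int[OF fin] by simp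
    have "card A \<le> ed A" "card B \<le> ed B" using A B by (auto simp: M_def)
    \<comment> \<open>The number of spanned edges is supermodular, and by minimality
      \<open>A \<inter> B\<close> spans too few. The contradiction needs \<open>dense\<close> for a
      union of two sets of size at most \<open>g\<close>, hence the bound \<open>2 * g\<close>
      there.\<close>
    then have "card (A \<union> B) < ed (A \<union> B)" using 1 2 ed_Un[of A B] by linarith
    moreover have "ed (A \<union> B) \<le> card (A \<union> B)"
      unfolding ed_def using A B 2 by (intro dense) (auto simp: M_def)
    ultimately show False by simp
  qed
  have "\<exists>e\<in>E. e \<subseteq> W" if "W \<in> M" for W
  proof -
    have "card W > 0" using that V finite_subset by (auto simp: M_def card_gt_0_iff)
    then have "card {e \<in> E. e \<subseteq> W} \<noteq> 0" using that by (auto simp: M_def ed_def)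
    then show ?thesis by (metis (mono_tags, lifting) card.empty empty_Collect_eq)
  qed
  then obtain d where d: "\<And>W. W \<in> M \<Longrightarrow> d W \<in> E \<and> d W \<subseteq> W" by metis
  show ?thesis
  proof (rule that[of "d ` M"])
    show "d ` M \<subseteq> E" using d by auto
    show "x \<inter> y = {}" if "x \<in> d ` M" "y \<in> d ` M" "x \<noteq> y" for x y
    proof -
      obtain A B where "A \<in> M" "B \<in> M" "x = d A" "y = d B" using \<open>x \<in> d ` M\<close> \<open>y \<in> d ` M\<close> by auto
      then show ?thesis using disj[of A B] d that(3) by blast
    qed
    show "card {e \<in> E - d ` M. e \<subseteq> W} < card W" if W: "W \<subseteq> V" "W \<noteq> {}" "card W \<le> g" for W
    proof (cases "ed W < card W")
      case True
      have "card {e \<in> E - d ` M. e \<subseteq> W} \<le> ed W"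
        unfolding ed_def using finE by (intro card_mono) auto
      then show ?thesis using True by simp
    next
      case False
      have finW: "finite W" using W V finite_subset by auto
      let ?Q = "{W'. W' \<subseteq> W \<and> W' \<noteq> {} \<and> card W' \<le> ed W'}"
      have finQ: "finite ?Q" using finW by simp
      have "W \<in> ?Q" using False W by auto
      from finite_has_minimal2[OF finQ this] obtain A where A: "A \<in> ?Q" "\<forall>B\<in>?Q. B \<subseteq> A \<longrightarrow> A = B"
        by blast
      have "card A \<le> g" using A(1) finW W card_mono[of W A] by auto
      moreover have "ed B < card B" if "B \<subset> A" "B \<noteq> {}" for B
      proof (rule ccontr)
        assume "\<not> ed B < card B"
        then have "B \<in> ?Q" using A(1) that by auto
        then show False using A(2) that by blast
      qed
      ultimately have "A \<in> M" using A(1) W by (auto simp: M_def)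
      then have "d A \<in> {e \<in> E. e \<subseteq> W}" "d A \<in> d ` M" using d[of A] A(1) by auto
      moreover have "{e \<in> E - d ` M. e \<subseteq> W} \<subseteq> {e \<in> E. e \<subseteq> W}" by blast
      ultimately have "{e \<in> E - d ` M. e \<subseteq> W} \<subset> {e \<in> E. e \<subseteq> W}" by blast
      then have "card {e \<in> E - d ` M. e \<subseteq> W} < ed W"
        unfolding ed_def using finE by (intro psubset_card_mono) auto
      also have "ed W \<le> card W" unfolding ed_def using W by (intro dense) auto
      finally show ?thesis .
    qed
  qed
qed


lemma cut_complement: "E \<subseteq> pairs V \<Longrightarrow> cut E (V - S) = cut E S"
  unfolding cut_def pairs_def by blast

lemma card_pairs_le: "finite W \<Longrightarrow> card (pairs W) \<le> (card W)\<^sup>2"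
  unfolding card_pairs power2_eq_square choose_two using div_le_dividend
  by (metis diff_le_self mult_le_mono2 order_trans)

lemma real_choose_two: "real (n choose 2) = real n * (real n - 1) / 2"
  by (induction n) (auto simp: numeral_2_eq_2 field_simps)

text \<open>Union bounds over four kinds of failure; the corresponding terms of \<open>total\<close>
  concern the cuts, the number of edges, the large sets and the small sets. For the cuts a bound
  that is uniform in \<open>S\<close> is too weak, so the failure probability is taken as
  \<open>q ^ card S\<close> and the sum is \<open>(1 + q) ^ N - 1\<close>. For sets of at least
  \<open>N / 20\<close> vertices the trivial factor \<open>2 ^ N\<close> is good enough.\<close>

lemma exists_random_graph:
  fixes p \<eta> :: real and N h :: nat
  defines "V \<equiv> {..<N}"
  assumes p: "0 < p" "p \<le> 1" and \<eta>: "0 < \<eta>" "\<eta> \<le> 1" and N: "40 \<le> N"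
    and total: "exp (N * exp (- (\<eta>\<^sup>2 / 16 * p * N))) - 1 + exp (- (\<eta>\<^sup>2 / 8 * p * (real N * (real N - 1) / 2)))
       + 2 ^ N * exp (- (\<eta>\<^sup>2 / 8 * p * ((real N)\<^sup>2 / 1600)))
       + (\<Sum>w\<in>{1..h}. real N ^ w * 2 ^ w\<^sup>2 * p ^ (w + 1)) < 1"
  obtains G where "G \<subseteq> pairs V"
    "\<And>S. S \<subseteq> V \<Longrightarrow> (1 - \<eta>) * p * (card S * card (V - S)) \<le> card (cut G S)"
    "card G \<le> (1 + \<eta>) * p * (real N * (real N - 1) / 2)"
    "\<And>C. C \<subseteq> V \<Longrightarrow> N \<le> 20 * card C \<Longrightarrow>
       (1 - \<eta>) * p * (real (card C) * (real (card C) - 1) / 2) \<le> card {e \<in> G. e \<subseteq> C}"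
    "\<And>W. W \<subseteq> V \<Longrightarrow> W \<noteq> {} \<Longrightarrow> card W \<le> h \<Longrightarrow> card {e \<in> G. e \<subseteq> W} \<le> card W"
proof -
  let ?K = "pairs V"
  have V: "finite V" "card V = N" by (auto simp: V_def)
  have K: "finite ?K" using V by (simp add: finite_pairs)
  have p': "0 \<le> p" "p \<le> 1" using p by auto
  \<comment> \<open>A cut is counted from its smaller side, so that the other side has at least
    \<open>N / 2\<close> vertices and the exponent is linear in \<open>card S\<close>.\<close>
  define \<C>1 where "\<C>1 = {S. S \<subseteq> V \<and> S \<noteq> {} \<and> 2 * card S \<le> N}"
  define \<C>3 where "\<C>3 = {C. C \<subseteq> V \<and> N \<le> 20 * card C}"
  define \<C>4 where "\<C>4 = {W. W \<subseteq> V \<and> W \<noteq> {} \<and> card W \<le> h}"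
  have fin: "finite \<C>1" "finite \<C>3" "finite \<C>4" using V by (auto simp: \<C>1_def \<C>3_def \<C>4_def)
  define B1 where "B1 G \<longleftrightarrow> (\<exists>S\<in>\<C>1. real (card (G \<inter> cut ?K S)) < (1 - \<eta>) * p * card (cut ?K S))" for G
  define B2 where "B2 G \<longleftrightarrow> real (card (G \<inter> ?K)) > (1 + \<eta>) * p * card ?K" for G
  define B3 where "B3 G \<longleftrightarrow> (\<exists>C\<in>\<C>3. real (card (G \<inter> pairs C)) < (1 - \<eta>) * p * card (pairs C))" for G
  define B4 where "B4 G \<longleftrightarrow> (\<exists>W\<in>\<C>4. card W + 1 \<le> card (G \<inter> pairs W))" for G
  have cK: "real (card (pairs S)) = real (card S) * (real (card S) - 1) / 2" if "S \<subseteq> V" for S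
    using that V finite_subset[of S V] by (simp add: card_pairs real_choose_two)
  have 1: "graph_prob p ?K B1 \<le> exp (N * exp (- (\<eta>\<^sup>2 / 16 * p * N))) - 1"
  proof -
    define q where "q = exp (- (\<eta>\<^sup>2 / 16 * p * N))"
    have "graph_prob p ?K B1 \<le> (\<Sum>S\<in>\<C>1. graph_prob p ?K (\<lambda>G. real (card (G \<inter> cut ?K S)) < (1 - \<eta>) * p * card (cut ?K S)))"
      unfolding B1_def by (rule graph_prob_bex[OF p' K fin(1)])
    also have "\<dots> \<le> (\<Sum>S\<in>\<C>1. q ^ card S)"
    proof (intro sum_mono)
      fix S assume S: "S \<in> \<C>1"
      then have SV: "S \<subseteq> V" "2 * card S \<le> N" by (auto simp: \<C>1_def)
      have cS: "card (V - S) = N - card S"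
        using card_Diff_subset[OF finite_subset[OF SV(1) V(1)] SV(1)] V(2) by simp
      have "graph_prob p ?K (\<lambda>G. real (card (G \<inter> cut ?K S)) < (1 - \<eta>) * p * card (cut ?K S))
          \<le> exp (- (\<eta>\<^sup>2 / 8 * p * card (cut ?K S)))"
        by (rule graph_prob_lower_tail[OF p' K _ \<eta>]) (auto simp: cut_def)
      also have "\<dots> \<le> exp (real (card S) * (- (\<eta>\<^sup>2 / 16 * p * N)))"
      proof -
        have "real (card S) * real N \<le> real (card S) * (2 * real (card (V - S)))"
          using SV cS by (intro mult_left_mono) auto
        then have "real (card S) * real N \<le> 2 * (real (card S) * real (card (V - S)))"
          by (simp only: mult.left_commute)
        then have "\<eta>\<^sup>2 / 16 * p * (real (card S) * real N) \<le> \<eta>\<^sup>2 / 16 * p * (2 * (real (card S) * real (card (V - S))))"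
          using p' by (intro mult_left_mono) auto
        then show ?thesis using card_cut_pairs[OF V(1) SV(1)] by (simp add: mult_ac)
      qed
      also have "\<dots> = q ^ card S" by (simp only: q_def exp_of_nat_mult)
      finally show "graph_prob p ?K (\<lambda>G. real (card (G \<inter> cut ?K S)) < (1 - \<eta>) * p * card (cut ?K S)) \<le> q ^ card S" .
    qed
    also have "\<dots> \<le> (\<Sum>S\<in>Pow V - {{}}. q ^ card S)"
      using V by (intro sum_mono2) (auto simp: \<C>1_def q_def)
    also have "\<dots> = (1 + q) ^ N - 1"
      using V sum_Pow_power[of V q] by (simp add: sum_diff1)
    also have "\<dots> \<le> exp q ^ N - 1"
      using exp_ge_add_one_self[of q] by (intro diff_right_mono power_mono) (auto simp: q_def)
    finally show ?thesis by (simp add: q_def exp_of_nat_mult)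
  qed
  have 2: "graph_prob p ?K B2 \<le> exp (- (\<eta>\<^sup>2 / 8 * p * (real N * (real N - 1) / 2)))"
    using graph_prob_upper_tail[OF p' K order_refl \<eta>] unfolding B2_def cK[OF order_refl] V(2) .
  have 3: "graph_prob p ?K B3 \<le> 2 ^ N * exp (- (\<eta>\<^sup>2 / 8 * p * ((real N)\<^sup>2 / 1600)))"
  proof -
    have "graph_prob p ?K B3 \<le> (\<Sum>C\<in>\<C>3. graph_prob p ?K (\<lambda>G. real (card (G \<inter> pairs C)) < (1 - \<eta>) * p * card (pairs C)))"
      unfolding B3_def by (rule graph_prob_bex[OF p' K fin(2)])
    also have "\<dots> \<le> (\<Sum>C\<in>\<C>3. exp (- (\<eta>\<^sup>2 / 8 * p * ((real N)\<^sup>2 / 1600))))"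
    proof (intro sum_mono)
      fix C assume C: "C \<in> \<C>3"
      then have CV: "C \<subseteq> V" "N \<le> 20 * card C" by (auto simp: \<C>3_def)
      have "graph_prob p ?K (\<lambda>G. real (card (G \<inter> pairs C)) < (1 - \<eta>) * p * card (pairs C))
          \<le> exp (- (\<eta>\<^sup>2 / 8 * p * card (pairs C)))"
        using CV by (intro graph_prob_lower_tail[OF p' K _ \<eta>]) (auto simp: pairs_def)
      also have "\<dots> \<le> exp (- (\<eta>\<^sup>2 / 8 * p * ((real N)\<^sup>2 / 1600)))"
      proof -
        define c where "c = real (card C)"
        have c: "real N \<le> 20 * c" "2 \<le> c" using CV N by (auto simp: c_def)
        \<comment> \<open>The origin of 1600: \<open>c * (c - 1) / 2 \<ge> c\<^sup>2 / 4\<close> for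
          \<open>c \<ge> 2\<close>, and
          \<open>(N / 20)\<^sup>2 / 4 = N\<^sup>2 / 1600\<close>.\<close>
        have "(real N)\<^sup>2 \<le> (20 * c)\<^sup>2" using c by (intro power_mono) auto
        moreover have "c * c / 2 \<le> c * (c - 1)" using c mult_left_mono[of 2 c c] by (simp add: field_simps)
        ultimately have "(real N)\<^sup>2 / 1600 \<le> real (card (pairs C))"
          unfolding cK[OF CV(1)] c_def[symmetric] by (simp add: power2_eq_square)
        then have "\<eta>\<^sup>2 / 8 * p * ((real N)\<^sup>2 / 1600) \<le> \<eta>\<^sup>2 / 8 * p * card (pairs C)"
          using p' by (intro mult_left_mono) auto
        then show ?thesis by simp
      qed
      finally show "graph_prob p ?K (\<lambda>G. real (card (G \<inter> pairs C)) < (1 - \<eta>) * p * card (pairs C))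
          \<le> exp (- (\<eta>\<^sup>2 / 8 * p * ((real N)\<^sup>2 / 1600)))" .
    qed
    also have "\<dots> \<le> 2 ^ N * exp (- (\<eta>\<^sup>2 / 8 * p * ((real N)\<^sup>2 / 1600)))"
    proof -
      have "card \<C>3 \<le> card (Pow V)" using V by (intro card_mono) (auto simp: \<C>3_def)
      then have "real (card \<C>3) \<le> 2 ^ N" using V by (simp add: card_Pow)
      then show ?thesis by simp
    qed
    finally show ?thesis .
  qed
  have 4: "graph_prob p ?K B4 \<le> (\<Sum>w\<in>{1..h}. real N ^ w * 2 ^ w\<^sup>2 * p ^ (w + 1))"
  proof -
    have "graph_prob p ?K B4 \<le> (\<Sum>W\<in>\<C>4. graph_prob p ?K (\<lambda>G. card W + 1 \<le> card (G \<inter> pairs W)))"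
      unfolding B4_def by (rule graph_prob_bex[OF p' K fin(3)])
    also have "\<dots> \<le> (\<Sum>W\<in>\<C>4. 2 ^ (card W)\<^sup>2 * p ^ (card W + 1))"
    proof (intro sum_mono)
      fix W assume W: "W \<in> \<C>4"
      then have WV: "W \<subseteq> V" "finite W" using V finite_subset by (auto simp: \<C>4_def)
      have "graph_prob p ?K (\<lambda>G. card W + 1 \<le> card (G \<inter> pairs W)) \<le> 2 ^ card (pairs W) * p ^ (card W + 1)"
        using WV by (intro graph_prob_many[OF p' K _ p(1)]) (auto simp: pairs_def)
      also have "\<dots> \<le> 2 ^ (card W)\<^sup>2 * p ^ (card W + 1)"
        using p' card_pairs_le[OF WV(2)] by (intro mult_right_mono power_increasing) auto
      finally show "graph_prob p ?K (\<lambda>G. card W + 1 \<le> card (G \<inter> pairs W)) \<le> 2 ^ (card W)\<^sup>2 * p ^ (card W + 1)" .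
    qed
    also have "\<dots> = (\<Sum>w\<in>{1..h}. \<Sum>W\<in>{W \<in> \<C>4. card W = w}. 2 ^ (card W)\<^sup>2 * p ^ (card W + 1))"
    proof (rule sum.group[symmetric])
      show "card ` \<C>4 \<subseteq> {1..h}"
        using V finite_subset by (fastforce simp: \<C>4_def Suc_le_eq card_gt_0_iff)
    qed (use fin in auto)
    also have "\<dots> \<le> (\<Sum>w\<in>{1..h}. real N ^ w * 2 ^ w\<^sup>2 * p ^ (w + 1))"
    proof (intro sum_mono)
      fix w
      have "card {W \<in> \<C>4. card W = w} \<le> card {W. W \<subseteq> V \<and> card W = w}"
        using V by (intro card_mono) (auto simp: \<C>4_def)
      also have "\<dots> = N choose w" using V by (simp add: n_subsets)
      also have "\<dots> \<le> N ^ w" using binomial_le_pow[of w N] by (cases "w \<le> N") (auto simp: not_le binomial_eq_0)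
      finally have le: "real (card {W \<in> \<C>4. card W = w}) \<le> real N ^ w"
        by (metis of_nat_le_iff of_nat_power)
      have "(\<Sum>W\<in>{W \<in> \<C>4. card W = w}. 2 ^ (card W)\<^sup>2 * p ^ (card W + 1))
          = (\<Sum>W\<in>{W \<in> \<C>4. card W = w}. 2 ^ w\<^sup>2 * p ^ (w + 1))"
        by (intro sum.cong) auto
      also have "\<dots> = real (card {W \<in> \<C>4. card W = w}) * (2 ^ w\<^sup>2 * p ^ (w + 1))" by simp
      also have "\<dots> \<le> real N ^ w * (2 ^ w\<^sup>2 * p ^ (w + 1))"
        using le p' by (intro mult_right_mono) auto
      finally show "(\<Sum>W\<in>{W \<in> \<C>4. card W = w}. 2 ^ (card W)\<^sup>2 * p ^ (card W + 1))
          \<le> real N ^ w * 2 ^ w\<^sup>2 * p ^ (w + 1)" by (simp add: mult_ac)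
    qed
    finally show ?thesis .
  qed
  have "graph_prob p ?K (\<lambda>G. B1 G \<or> B2 G \<or> B3 G \<or> B4 G)
      \<le> graph_prob p ?K B1 + (graph_prob p ?K B2 + (graph_prob p ?K B3 + graph_prob p ?K B4))"
    by (intro order_trans[OF graph_prob_disj[OF p' K]] add_left_mono order_refl)
  then have "graph_prob p ?K (\<lambda>G. B1 G \<or> B2 G \<or> B3 G \<or> B4 G) < 1"
    using 1 2 3 4 total by linarith
  from graph_prob_less_1D[OF p' K this] obtain G where G: "G \<subseteq> ?K" "\<not> B1 G" "\<not> B2 G" "\<not> B3 G" "\<not> B4 G"
    by blast
  have GI: "G \<inter> cut ?K S = cut G S" for S using G(1) by (auto simp: cut_def)
  have GP: "G \<inter> pairs S = {e \<in> G. e \<subseteq> S}" for S using G(1) by (auto simp: pairs_def)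
  show ?thesis
  proof (rule that[OF G(1)])
    have half: "(1 - \<eta>) * p * (card S * card (V - S)) \<le> card (cut G S)"
      if S: "S \<subseteq> V" "2 * card S \<le> N" for S
    proof (cases "S = {}")
      case False
      then have "S \<in> \<C>1" using S by (auto simp: \<C>1_def)
      then have "(1 - \<eta>) * p * card (cut ?K S) \<le> card (G \<inter> cut ?K S)" using G(2) by (auto simp: B1_def not_less)
      then show ?thesis unfolding GI card_cut_pairs[OF V(1) S(1)] .
    qed simp
    show "(1 - \<eta>) * p * (card S * card (V - S)) \<le> card (cut G S)" if S: "S \<subseteq> V" for S
    proof (cases "2 * card S \<le> N")
      case True
      then show ?thesis using half S by blast
    next
      case False
      have "card (V - S) = N - card S"
        using card_Diff_subset[OF finite_subset[OF S V(1)] S] V(2) by simp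
      then have "2 * card (V - S) \<le> N" using False by simp
      moreover have "V - (V - S) = S" using S by auto
      ultimately show ?thesis using half[of "V - S"] cut_complement[OF G(1), of S] by (simp add: mult.commute)
    qed
    show "card G \<le> (1 + \<eta>) * p * (real N * (real N - 1) / 2)"
      using G(1,3) cK[OF order_refl] V(2) by (simp add: B2_def not_less Int_absorb2)
    show "(1 - \<eta>) * p * (real (card C) * (real (card C) - 1) / 2) \<le> card {e \<in> G. e \<subseteq> C}"
      if C: "C \<subseteq> V" "N \<le> 20 * card C" for C
    proof -
      have "C \<in> \<C>3" using C by (auto simp: \<C>3_def)
      then have "(1 - \<eta>) * p * card (pairs C) \<le> card (G \<inter> pairs C)" using G(4) by (auto simp: B3_def not_less)
      then show ?thesis unfolding GP cK[OF C(1)] .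
    qed
    show "card {e \<in> G. e \<subseteq> W} \<le> card W" if W: "W \<subseteq> V" "W \<noteq> {}" "card W \<le> h" for W
    proof -
      have "W \<in> \<C>4" using W by (auto simp: \<C>4_def)
      then have "\<not> card W + 1 \<le> card (G \<inter> pairs W)" using G(5) by (auto simp: B4_def)
      then show ?thesis unfolding GP by simp
    qed
  qed
qed


text \<open>Here \<open>p = (ln N)^2 / N\<close>. In the first term
  \<open>N * exp (- c1 * (ln N)^2)\<close> tends to 0; in the third an exponent of order
  \<open>N * (ln N)^2\<close> beats \<open>2 ^ N\<close>; in the last
  \<open>N ^ w * p ^ (w + 1)\<close> is \<open>(ln N) ^ (2 * (w + 1)) / N\<close>.\<close>

lemma eventually_random_graph_bound:
  fixes c1 c2 c3 :: real and h :: nat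
  assumes c: "c1 > 0" "c2 > 0" "c3 > 0"
  shows "eventually (\<lambda>N. exp (real N * exp (- (c1 * ((ln (real N))\<^sup>2 / real N) * real N))) - 1
     + exp (- (c2 * ((ln (real N))\<^sup>2 / real N) * (real N * (real N - 1) / 2)))
     + 2 ^ N * exp (- (c3 * ((ln (real N))\<^sup>2 / real N) * ((real N)\<^sup>2 / 1600)))
     + (\<Sum>w\<in>{1..h}. real N ^ w * 2 ^ w\<^sup>2 * ((ln (real N))\<^sup>2 / real N) ^ (w + 1)) < 1) sequentially"
proof -
  have 1: "(\<lambda>N::nat. exp (real N * exp (- (c1 * ((ln (real N))\<^sup>2 / real N) * real N))) - 1) \<longlonglongrightarrow> 0"
    using c by real_asymp
  have 2: "(\<lambda>N::nat. exp (- (c2 * ((ln (real N))\<^sup>2 / real N) * (real N * (real N - 1) / 2)))) \<longlonglongrightarrow> 0"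
    using c by real_asymp
  have 3: "(\<lambda>N::nat. 2 ^ N * exp (- (c3 * ((ln (real N))\<^sup>2 / real N) * ((real N)\<^sup>2 / 1600)))) \<longlonglongrightarrow> 0"
    using c by real_asymp
  have 4: "(\<lambda>N::nat. \<Sum>w\<in>{1..h}. real N ^ w * 2 ^ w\<^sup>2 * ((ln (real N))\<^sup>2 / real N) ^ (w + 1)) \<longlonglongrightarrow> (\<Sum>w\<in>{1..h}. 0)"
  proof (intro tendsto_sum)
    fix w :: nat
    have "(\<lambda>N::nat. 2 ^ w\<^sup>2 * (ln (real N) ^ (2 * (w + 1)) / real N)) \<longlonglongrightarrow> 0"
      by real_asymp
    moreover have "eventually (\<lambda>N::nat. 2 ^ w\<^sup>2 * (ln (real N) ^ (2 * (w + 1)) / real N)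
        = real N ^ w * 2 ^ w\<^sup>2 * ((ln (real N))\<^sup>2 / real N) ^ (w + 1)) sequentially"
      using eventually_gt_at_top[of 0]
      by eventually_elim (simp add: power_divide power_mult[symmetric] power_add[symmetric] field_simps)
    ultimately show "(\<lambda>N::nat. real N ^ w * 2 ^ w\<^sup>2 * ((ln (real N))\<^sup>2 / real N) ^ (w + 1)) \<longlonglongrightarrow> 0"
      by (rule Lim_transform_eventually)
  qed
  have "(\<lambda>N. exp (real N * exp (- (c1 * ((ln (real N))\<^sup>2 / real N) * real N))) - 1
     + exp (- (c2 * ((ln (real N))\<^sup>2 / real N) * (real N * (real N - 1) / 2)))
     + 2 ^ N * exp (- (c3 * ((ln (real N))\<^sup>2 / real N) * ((real N)\<^sup>2 / 1600)))
     + (\<Sum>w\<in>{1..h}. real N ^ w * 2 ^ w\<^sup>2 * ((ln (real N))\<^sup>2 / real N) ^ (w + 1)))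
     \<longlonglongrightarrow> 0 + 0 + 0 + (\<Sum>w\<in>{1..h}. 0)"
    by (intro tendsto_add 1 2 3 4)
  then show ?thesis by (rule order_tendstoD) simp
qed

lemma exists_sparse_expander:
  fixes g :: nat
  obtains N :: nat and E :: "nat set set" and \<theta> :: real
  where "120 \<le> N" "E \<subseteq> pairs {..<N}" "\<theta> > 0"
    "\<And>S. S \<subseteq> {..<N} \<Longrightarrow> \<theta> * card S * card ({..<N} - S) \<le> card (cut E S)"
    "2 * card E \<le> \<theta> * ((1 + 1/60) * (real N)\<^sup>2)"
    "\<And>C. C \<subseteq> {..<N} \<Longrightarrow> N \<le> 20 * card C \<Longrightarrow> 2 \<le> card {e \<in> E. e \<subseteq> C}"
    "\<And>W. W \<subseteq> {..<N} \<Longrightarrow> W \<noteq> {} \<Longrightarrow> card W \<le> g \<Longrightarrow> card {e \<in> E. e \<subseteq> W} < card W"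
proof -
  \<comment> \<open>With \<open>p * N \<ge> 400\<close> this gives
    \<open>\<theta> \<ge> 99/100 * p\<close>: one half of the lost hundredth is due to the
    fluctuation of the cuts, the other to the deleted matching. Then
    \<open>1 + \<eta> = 201/200\<close> is below \<open>99/100 * (1 + 1/60)\<close>, as the bound on
    the number of edges demands.\<close>
  define \<eta> :: real where "\<eta> = 1/200"
  have \<eta>: "0 < \<eta>" "\<eta> \<le> 1" by (auto simp: \<eta>_def)
  have "eventually (\<lambda>N::nat. (ln (real N))\<^sup>2 / real N \<le> 1 \<and> (ln (real N))\<^sup>2 \<ge> 400) sequentially"
    by (intro eventually_conj; real_asymp)
  moreover have "eventually (\<lambda>N. exp (real N * exp (- (\<eta>\<^sup>2 / 16 * ((ln (real N))\<^sup>2 / real N) * real N))) - 1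
     + exp (- (\<eta>\<^sup>2 / 8 * ((ln (real N))\<^sup>2 / real N) * (real N * (real N - 1) / 2)))
     + 2 ^ N * exp (- (\<eta>\<^sup>2 / 8 * ((ln (real N))\<^sup>2 / real N) * ((real N)\<^sup>2 / 1600)))
     + (\<Sum>w\<in>{1..2 * g}. real N ^ w * 2 ^ w\<^sup>2 * ((ln (real N))\<^sup>2 / real N) ^ (w + 1)) < 1) sequentially"
    using \<eta> by (intro eventually_random_graph_bound) auto
  ultimately have "eventually (\<lambda>N. 120 \<le> N \<and> (ln (real N))\<^sup>2 / real N \<le> 1 \<and> (ln (real N))\<^sup>2 \<ge> 400 \<and>
     exp (real N * exp (- (\<eta>\<^sup>2 / 16 * ((ln (real N))\<^sup>2 / real N) * real N))) - 1
     + exp (- (\<eta>\<^sup>2 / 8 * ((ln (real N))\<^sup>2 / real N) * (real N * (real N - 1) / 2)))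
     + 2 ^ N * exp (- (\<eta>\<^sup>2 / 8 * ((ln (real N))\<^sup>2 / real N) * ((real N)\<^sup>2 / 1600)))
     + (\<Sum>w\<in>{1..2 * g}. real N ^ w * 2 ^ w\<^sup>2 * ((ln (real N))\<^sup>2 / real N) ^ (w + 1)) < 1) sequentially"
    using eventually_ge_at_top[of "120::nat"] by eventually_elim blast
  then obtain N :: nat where N: "120 \<le> N" "(ln (real N))\<^sup>2 / real N \<le> 1" "(ln (real N))\<^sup>2 \<ge> 400"
    and total: "exp (real N * exp (- (\<eta>\<^sup>2 / 16 * ((ln (real N))\<^sup>2 / real N) * real N))) - 1
     + exp (- (\<eta>\<^sup>2 / 8 * ((ln (real N))\<^sup>2 / real N) * (real N * (real N - 1) / 2)))
     + 2 ^ N * exp (- (\<eta>\<^sup>2 / 8 * ((ln (real N))\<^sup>2 / real N) * ((real N)\<^sup>2 / 1600)))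
     + (\<Sum>w\<in>{1..2 * g}. real N ^ w * 2 ^ w\<^sup>2 * ((ln (real N))\<^sup>2 / real N) ^ (w + 1)) < 1"
    unfolding eventually_sequentially by blast
  define p where "p = (ln (real N))\<^sup>2 / real N"
  define V where "V = {..<N}"
  have V: "finite V" "card V = N" by (auto simp: V_def)
  have N0: "real N > 0" using N by simp
  have pN: "p * N \<ge> 400" using N by (simp add: p_def)
  have p: "0 < p" "p \<le> 1"
  proof -
    show "p > 0" using pN N0 by (smt (verit) mult_nonneg_nonneg mult_nonpos_nonneg)
  qed (use N in \<open>simp add: p_def\<close>)
  have "40 \<le> N" using N by simp
  from exists_random_graph[OF p \<eta> this total[folded p_def], folded V_def]
  obtain G where G: "G \<subseteq> pairs V"
    and cutG: "\<And>S. S \<subseteq> V \<Longrightarrow> (1 - \<eta>) * p * (card S * card (V - S)) \<le> card (cut G S)"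
    and cardG: "card G \<le> (1 + \<eta>) * p * (real N * (real N - 1) / 2)"
    and denseG: "\<And>C. C \<subseteq> V \<Longrightarrow> N \<le> 20 * card C \<Longrightarrow>
       (1 - \<eta>) * p * (real (card C) * (real (card C) - 1) / 2) \<le> card {e \<in> G. e \<subseteq> C}"
    and sparseG: "\<And>W. W \<subseteq> V \<Longrightarrow> W \<noteq> {} \<Longrightarrow> card W \<le> 2 * g \<Longrightarrow> card {e \<in> G. e \<subseteq> W} \<le> card W"
    by blast
  have finG: "finite G" using G finite_pairs[OF V(1)] finite_subset by blast
  obtain D where D: "D \<subseteq> G" and mat: "\<And>d e. d \<in> D \<Longrightarrow> e \<in> D \<Longrightarrow> d \<noteq> e \<Longrightarrow> d \<inter> e = {}"
    and sparse: "\<And>W. W \<subseteq> V \<Longrightarrow> W \<noteq> {} \<Longrightarrow> card W \<le> g \<Longrightarrow> card {e \<in> G - D. e \<subseteq> W} < card W"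
    using exists_sparse_subgraph[OF V(1) G sparseG] by blast
  have removed: "card {e \<in> G. P e} \<le> card {e \<in> G - D. P e} + card S"
    if "finite S" "\<And>e. e \<in> D \<Longrightarrow> P e \<Longrightarrow> e \<inter> S \<noteq> {}" for P and S :: "nat set"
  proof -
    have "{e \<in> G. P e} \<subseteq> {e \<in> G - D. P e} \<union> {e \<in> D. P e}" by auto
    then have "card {e \<in> G. P e} \<le> card ({e \<in> G - D. P e} \<union> {e \<in> D. P e})"
      using finG finite_subset[OF D finG] by (intro card_mono) auto
    also have "\<dots> \<le> card {e \<in> G - D. P e} + card {e \<in> D. P e}" by (rule card_Un_le)
    also have "card {e \<in> D. P e} \<le> card S" using that mat by (intro card_matching_le) auto
    finally show ?thesis by simp
  qed
  \<comment> \<open>If the sides of a cut have \<open>a\<close> and \<open>b\<close> vertices, it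
    loses at most \<open>min a b\<close> edges, which is at most \<open>2 / N * (a * b)\<close>
    because the larger side has at least \<open>N / 2\<close> vertices.\<close>
  define \<theta> where "\<theta> = (1 - \<eta>) * p - 2 / N"
  have pN2: "p \<ge> 400 / N" using pN N0 by (simp add: field_simps)
  have "2 / real N \<le> p / 200" using pN2 by (simp add: field_simps)
  then have \<theta>: "\<theta> \<ge> 99/100 * p" by (simp add: \<theta>_def \<eta>_def)
  show ?thesis
  proof (rule that[of N "G - D" \<theta>, folded V_def])
    show "120 \<le> N" "G - D \<subseteq> pairs V" using N G by auto
    show "\<theta> > 0" using \<theta> p by simp
    show "\<theta> * card S * card (V - S) \<le> card (cut (G - D) S)" if S: "S \<subseteq> V" for S
    proof -
      define a b where "a = real (card S)" and "b = real (card (V - S))"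
      have finS: "finite S" using S V finite_subset by blast
      have "card S \<le> N" using card_mono[OF V(1) S] V by simp
      moreover have "card (V - S) = N - card S" using card_Diff_subset[OF finS S] V by simp
      ultimately have ab: "a + b = N" by (simp add: a_def b_def)
      have ab0: "a \<ge> 0" "b \<ge> 0" by (auto simp: a_def b_def)
      have cut_eq: "cut F S = {e \<in> F. e \<inter> S \<noteq> {} \<and> \<not> e \<subseteq> S}" for F :: "nat set set"
        by (simp add: cut_def)
      have DV: "e \<subseteq> V" if "e \<in> D" for e using that D G by (auto simp: pairs_def)
      have "card (cut G S) \<le> card (cut (G - D) S) + card S"
        unfolding cut_eq using finS by (rule removed) auto
      moreover have "card (cut G S) \<le> card (cut (G - D) S) + card (V - S)"
        unfolding cut_eq by (rule removed) (use V DV in auto)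
      ultimately have "real (card (cut G S)) - min a b \<le> card (cut (G - D) S)"
        by (simp add: a_def b_def min_def)
      moreover have "(1 - \<eta>) * p * (a * b) \<le> card (cut G S)"
        using cutG[OF S] by (simp add: a_def b_def)
      moreover have "min a b \<le> 2 / N * (a * b)"
      proof (cases "a \<le> b")
        case True
        then have "a * N \<le> a * (2 * b)" using ab ab0 by (intro mult_left_mono) auto
        then show ?thesis using N0 True by (simp add: field_simps)
      next
        case False
        then have "b * N \<le> b * (2 * a)" using ab ab0 by (intro mult_left_mono) auto
        then show ?thesis using N0 False by (simp add: field_simps)
      qed
      ultimately have "(1 - \<eta>) * p * (a * b) - 2 / N * (a * b) \<le> card (cut (G - D) S)" by linarith
      then show ?thesis by (simp add: \<theta>_def a_def b_def algebra_simps)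
    qed
    show "2 * card (G - D) \<le> \<theta> * ((1 + 1/60) * (real N)\<^sup>2)"
    proof -
      have "real (card (G - D)) \<le> card G" using finG by (simp add: card_mono)
      then have "2 * real (card (G - D)) \<le> (1 + \<eta>) * p * (real N * (real N - 1))" using cardG by simp
      also have "\<dots> \<le> (1 + \<eta>) * p * (real N * real N)"
        using p \<eta> by (intro mult_left_mono) auto
      also have "\<dots> \<le> (99/100 * p * (1 + 1/60)) * (real N * real N)"
        using p by (intro mult_right_mono) (auto simp: \<eta>_def)
      also have "\<dots> \<le> (\<theta> * (1 + 1/60)) * (real N * real N)"
        using \<theta> by (intro mult_right_mono) auto
      finally show ?thesis by (simp add: power2_eq_square)
    qed
    show "2 \<le> card {e \<in> G - D. e \<subseteq> C}" if C: "C \<subseteq> V" "N \<le> 20 * card C" for C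
    proof -
      define c where "c = real (card C)"
      have finC: "finite C" using C V finite_subset by blast
      have ne: "e \<noteq> {}" if "e \<in> D" for e using that D G by (auto simp: pairs_def)
      have "card {e \<in> G. e \<subseteq> C} \<le> card {e \<in> G - D. e \<subseteq> C} + card C"
        using finC by (rule removed) (use ne in auto)
      moreover have "(1 - \<eta>) * p * (c * (c - 1) / 2) \<le> card {e \<in> G. e \<subseteq> C}"
        using denseG[OF C] by (simp add: c_def)
      moreover have "c \<ge> 6" "real N \<le> 40 * (c - 1)" using C(2) N by (auto simp: c_def)
      \<comment> \<open>Of at least \<open>4 * c\<close> edges inside \<open>C\<close> the matching
        contains at most \<open>c\<close>, so at least \<open>3 * c\<close> remain.\<close>
      moreover have "4 * c \<le> (1 - \<eta>) * p * (c * (c - 1) / 2)"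
      proof -
        have "400 \<le> p * (40 * (c - 1))" using pN \<open>real N \<le> 40 * (c - 1)\<close> p
          by (smt (verit) mult_left_mono)
        moreover have "p * (40 * (c - 1)) = 40 * (p * (c - 1))" by (rule mult.left_commute)
        ultimately have "10 \<le> p * (c - 1)" by linarith
        then have "199/200 * 10 \<le> (1 - \<eta>) * (p * (c - 1))"
          by (intro mult_mono) (auto simp: \<eta>_def)
        then have "8 \<le> (1 - \<eta>) * (p * (c - 1))" by simp
        then have "c / 2 * 8 \<le> c / 2 * ((1 - \<eta>) * (p * (c - 1)))"
          using \<open>c \<ge> 6\<close> by (intro mult_left_mono) auto
        then show ?thesis by (simp add: mult_ac)
      qed
      ultimately have "2 \<le> real (card {e \<in> G - D. e \<subseteq> C})" unfolding c_def by linarith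
      then show ?thesis by simp
    qed
    show "card {e \<in> G - D. e \<subseteq> W} < card W" if "W \<subseteq> V" "W \<noteq> {}" "card W \<le> g" for W
      using sparse that by blast
  qed
qed

section \<open>Incidence posets of graphs\<close>

lemma weakly_contained_trans:
  assumes "weakly_contained P Q" "weakly_contained Q R"
  shows "weakly_contained P R"
proof -
  obtain f where f: "inj_on f (Field P)" "f ` Field P \<subseteq> Field Q" "\<And>x y. (x, y) \<in> P \<Longrightarrow> (f x, f y) \<in> Q"
    using assms(1) unfolding weakly_contained_def by blast
  obtain h where h: "inj_on h (Field Q)" "h ` Field Q \<subseteq> Field R" "\<And>x y. (x, y) \<in> Q \<Longrightarrow> (h x, h y) \<in> R"
    using assms(2) unfolding weakly_contained_def by blast
  have "inj_on (h \<circ> f) (Field P)" using f(1) inj_on_subset[OF h(1) f(2)] by (rule comp_inj_on)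
  moreover have "(h \<circ> f) ` Field P \<subseteq> Field R" using f(2) h(2) by auto
  ultimately show ?thesis unfolding weakly_contained_def using f(3) h(3) by (intro exI[of _ "h \<circ> f"]) auto
qed

lemma finite_poset_finite: "finite_poset P \<Longrightarrow> finite P"
  by (rule finite_subset[of _ "Field P \<times> Field P"]) (auto simp: finite_poset_def FieldI1 FieldI2)

text \<open>A weak embedding is injective on elements and on relations. If neither number grows, it
  is onto for both and hence an isomorphism. So minimizing the number of elements plus the number of
  relations yields minimal posets.\<close>

lemma poset_iso_if_size_le:
  assumes P: "finite_poset P" and Q: "finite_poset Q" and QP: "weakly_contained Q P"
    and size: "card (Field P) + card P \<le> card (Field Q) + card Q"
  shows "poset_iso Q P"
proof -
  obtain f where f: "inj_on f (Field Q)" "f ` Field Q \<subseteq> Field P" "\<And>x y. (x, y) \<in> Q \<Longrightarrow> (f x, f y) \<in> P"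
    using QP unfolding weakly_contained_def by blast
  let ?F = "\<lambda>(x, y). (f x, f y)"
  have finP: "finite P" "finite (Field P)" using P finite_poset_finite by (auto simp: finite_poset_def)
  have inj: "inj_on ?F Q" using f(1) by (auto simp: inj_on_def FieldI1 FieldI2)
  have sub: "?F ` Q \<subseteq> P" using f(3) by auto
  have "card Q \<le> card P" using card_inj_on_le[OF inj sub finP(1)] .
  moreover have "card (Field Q) \<le> card (Field P)" using card_inj_on_le[OF f(1,2) finP(2)] .
  ultimately have eq: "card Q = card P" "card (Field Q) = card (Field P)" using size by linarith+
  have FQ: "f ` Field Q = Field P"
    using f(1,2) finP(2) eq(2) by (intro card_subset_eq) (simp_all add: card_image)
  have FP: "?F ` Q = P"
    using sub finP(1) eq(1) inj by (intro card_subset_eq) (simp_all add: card_image)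
  have "(x, y) \<in> Q" if xy: "x \<in> Field Q" "y \<in> Field Q" "(f x, f y) \<in> P" for x y
  proof -
    obtain a b where ab: "(a, b) \<in> Q" "f a = f x" "f b = f y" using xy(3) unfolding FP[symmetric] by auto
    then have "a = x" "b = y" using f(1) xy by (auto dest: inj_onD simp: FieldI1 FieldI2)
    then show ?thesis using ab by simp
  qed
  moreover have "bij_betw f (Field Q) (Field P)" using f(1) FQ by (simp add: bij_betw_def)
  ultimately show ?thesis unfolding poset_iso_def using f(3) by (intro exI[of _ f] conjI ballI iffI)
qed

lemma exists_minimal_poset:
  assumes "P \<in> \<C>" "\<And>Q. Q \<in> \<C> \<Longrightarrow> finite_poset Q"
  obtains Q where "minimal_poset \<C> Q" "weakly_contained Q P"
proof -
  let ?m = "\<lambda>Q. card (Field Q) + card Q"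
  have refl: "weakly_contained P P"
    unfolding weakly_contained_def by (intro exI[of _ id]) auto
  have "\<exists>Q. (Q \<in> \<C> \<and> weakly_contained Q P) \<and> (\<forall>R. R \<in> \<C> \<and> weakly_contained R P \<longrightarrow> ?m Q \<le> ?m R)"
    using assms(1) refl by (intro ex_has_least_nat[of _ P]) auto
  then obtain Q where Q: "Q \<in> \<C>" "weakly_contained Q P"
    and least: "\<And>R. R \<in> \<C> \<Longrightarrow> weakly_contained R P \<Longrightarrow> ?m Q \<le> ?m R" by blast
  have "minimal_poset \<C> Q"
    unfolding minimal_poset_def
  proof (intro conjI ballI impI)
    fix R assume R: "R \<in> \<C>" "weakly_contained R Q"
    then have "?m Q \<le> ?m R" using least weakly_contained_trans Q(2) by blast
    then show "poset_iso R Q" using R Q assms(2) by (intro poset_iso_if_size_le) auto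
  qed (rule Q(1))
  then show ?thesis using that Q(2) by blast
qed

text \<open>A minimal poset below the \<open>P\<close> supplied by \<open>big\<close> has more than
  \<open>g\<close> elements, so the sizes of minimal posets are unbounded. One minimal poset is
  selected for each size that occurs; different sizes exclude isomorphism.\<close>

lemma infinitely_many_minimal:
  fixes \<C> :: "nat rel set"
  assumes fin: "\<And>Q. Q \<in> \<C> \<Longrightarrow> finite_poset Q"
    and big: "\<And>g. \<exists>P\<in>\<C>. \<forall>Q\<in>\<C>. weakly_contained Q P \<longrightarrow> g < card (Field Q)"
  shows "\<exists>S. infinite S \<and> (\<forall>P\<in>S. minimal_poset \<C> P) \<and> pairwise (\<lambda>P Q. \<not> poset_iso P Q) S"
proof -
  have ex: "\<exists>Q. minimal_poset \<C> Q \<and> g < card (Field Q)" for g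
  proof -
    obtain P where P: "P \<in> \<C>" "\<forall>Q\<in>\<C>. weakly_contained Q P \<longrightarrow> g < card (Field Q)" using big by blast
    obtain Q where Q: "minimal_poset \<C> Q" "weakly_contained Q P" using exists_minimal_poset[OF P(1) fin] by blast
    then show ?thesis using P(2) by (auto simp: minimal_poset_def)
  qed
  define A where "A = (\<lambda>Q. card (Field Q)) ` {Q. minimal_poset \<C> Q}"
  have "infinite A"
    unfolding infinite_nat_iff_unbounded
  proof
    fix g
    obtain Q where "minimal_poset \<C> Q" "g < card (Field Q)" using ex by blast
    then show "\<exists>n>g. n \<in> A" by (auto simp: A_def)
  qed
  define r where "r c = (SOME Q. minimal_poset \<C> Q \<and> card (Field Q) = c)" for c
  have r: "minimal_poset \<C> (r c) \<and> card (Field (r c)) = c" if "c \<in> A" for c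
    unfolding r_def by (rule someI_ex) (use that in \<open>auto simp: A_def\<close>)
  have "inj_on r A" using r by (metis inj_onI)
  then have "infinite (r ` A)" using \<open>infinite A\<close> by (simp add: finite_image_iff)
  moreover have "pairwise (\<lambda>P Q. \<not> poset_iso P Q) (r ` A)"
  proof (rule pairwiseI)
    fix P Q assume PQ: "P \<in> r ` A" "Q \<in> r ` A" "P \<noteq> Q"
    then have "card (Field P) \<noteq> card (Field Q)" using r by fastforce
    then show "\<not> poset_iso P Q" unfolding poset_iso_def by (auto dest: bij_betw_same_card)
  qed
  ultimately show ?thesis using r by (intro exI[of _ "r ` A"]) auto
qed

section \<open>The incidence poset of a graph\<close>

text \<open>The class consists of relations on \<open>nat\<close>, so vertices become even numbers
  and edges odd ones. \<open>set_encode\<close> is injective on finite sets, which edges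
  are.\<close>

definition edge_code :: "nat set \<Rightarrow> nat" where
  "edge_code e = 2 * set_encode e + 1"

definition incidence_poset :: "nat \<Rightarrow> nat set set \<Rightarrow> nat rel" where
  "incidence_poset N E = (\<lambda>v. (2 * v, 2 * v)) ` {..<N} \<union> (\<lambda>e. (edge_code e, edge_code e)) ` E
     \<union> {(2 * v, edge_code e) | v e. e \<in> E \<and> v \<in> e}"

lemma strict_incidence_poset:
  assumes "(x, y) \<in> incidence_poset N E" "x \<noteq> y"
  obtains v e where "x = 2 * v" "y = edge_code e" "e \<in> E" "v \<in> e"
  using assms unfolding incidence_poset_def by blast

context
  fixes N :: nat and E :: "nat set set"
  assumes E: "E \<subseteq> pairs {..<N}"
begin

lemma finite_edge: "e \<in> E \<Longrightarrow> finite e"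
  using E by (auto simp: pairs_def intro: finite_subset)

lemma finite_edges: "finite E"
  using E finite_pairs[of "{..<N}"] finite_subset by blast

lemma inj_on_edge_code: "inj_on edge_code E"
  using inj_on_set_encode finite_edge by (auto simp: inj_on_def edge_code_def)

lemma even_neq_edge_code: "2 * v \<noteq> edge_code e"
  unfolding edge_code_def by presburger

lemma Field_incidence_poset:
  "Field (incidence_poset N E) = (\<lambda>v. 2 * v) ` {..<N} \<union> edge_code ` E"
  using E by (auto simp: incidence_poset_def Field_def pairs_def)

lemma finite_poset_incidence_poset: "finite_poset (incidence_poset N E)"
proof -
  let ?P = "incidence_poset N E"
  have "Partial_order ?P"
    unfolding partial_order_on_def preorder_on_def
  proof (intro conjI)
    show "?P \<subseteq> Field ?P \<times> Field ?P" by (auto intro: FieldI1 FieldI2)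
    show "refl_on (Field ?P) ?P"
      unfolding refl_on_def Field_incidence_poset by (auto simp: incidence_poset_def)
    show "trans ?P"
    proof (rule transI)
      fix x y z assume xy: "(x, y) \<in> ?P" and yz: "(y, z) \<in> ?P"
      show "(x, z) \<in> ?P"
      proof (cases "x = y \<or> y = z")
        case False
        then show ?thesis
          using strict_incidence_poset[OF xy] strict_incidence_poset[OF yz] even_neq_edge_code by metis
      qed (use xy yz in auto)
    qed
    show "antisym ?P"
    proof (rule antisymI, rule ccontr)
      fix x y assume xy: "(x, y) \<in> ?P" "(y, x) \<in> ?P" "x \<noteq> y"
      then show False
        using strict_incidence_poset[OF xy(1)] strict_incidence_poset[OF xy(2)] even_neq_edge_code by metis
    qed
  qed
  then show ?thesis using finite_edges by (simp add: finite_poset_def Field_incidence_poset)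
qed

text \<open>The singletons and the pairs given by the edges are a copy inside layers 1 and 2. A
  ground set of \<open>N + k\<close> elements has room for the \<open>N\<close> vertices, shifted by
  \<open>Suc\<close>, and for the layers \<open>1, ..., k\<close>.\<close>

lemma not_layers_free_incidence_poset:
  assumes "2 \<le> k"
  shows "\<not> layers_free (incidence_poset N E) k"
proof
  let ?P = "incidence_poset N E"
  assume "layers_free ?P k"
  moreover have "1 + k \<le> (N + k) + 1" by simp
  ultimately have free: "weak_free ?P (\<Union>i\<in>{1..<1 + k}. layer (N + k) i)"
    unfolding layers_free_def by blast
  define \<psi> where "\<psi> x = (if even x then {Suc (x div 2)} else Suc ` set_decode (x div 2))" for x
  have \<psi>v: "\<psi> (2 * v) = {Suc v}" for v by (simp add: \<psi>_def)
  have \<psi>e: "\<psi> (edge_code e) = Suc ` e" if "e \<in> E" for e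
  proof -
    have "edge_code e div 2 = set_encode e" "odd (edge_code e)" by (auto simp: edge_code_def)
    then show ?thesis using finite_edge[OF that] by (simp add: \<psi>_def set_encode_inverse)
  qed
  have card_e: "card (Suc ` e) = 2" if "e \<in> E" for e
    using that E by (auto simp: pairs_def card_image)
  have "inj_on \<psi> (Field ?P)"
  proof (rule inj_onI)
    fix x y assume xy: "x \<in> Field ?P" "y \<in> Field ?P" "\<psi> x = \<psi> y"
    consider v w where "x = 2 * v" "y = 2 * w" | v e where "e \<in> E" "x = 2 * v" "y = edge_code e"
      | v e where "e \<in> E" "y = 2 * v" "x = edge_code e"
      | d e where "d \<in> E" "e \<in> E" "x = edge_code d" "y = edge_code e"
      using xy(1,2) unfolding Field_incidence_poset by blast
    then show "x = y"
    proof cases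
      case 1
      then show ?thesis using xy(3) by (simp add: \<psi>v)
    next
      case 2
      then have "{Suc v} = Suc ` e" using xy(3) by (simp add: \<psi>v \<psi>e)
      then show ?thesis using card_e[OF 2(1)] by (metis One_nat_def card.empty card_insert_disjoint empty_iff finite.emptyI n_not_Suc_n numeral_2_eq_2)
    next
      case 3
      then have "{Suc v} = Suc ` e" using xy(3) by (simp add: \<psi>v \<psi>e)
      then show ?thesis using card_e[OF 3(1)] by (metis One_nat_def card.empty card_insert_disjoint empty_iff finite.emptyI n_not_Suc_n numeral_2_eq_2)
    next
      case 4
      then have "Suc ` d = Suc ` e" using xy(3) by (simp add: \<psi>e)
      then have "d = e" by (simp add: inj_image_eq_iff)
      then show ?thesis using 4 by simp
    qed
  qed
  moreover have "\<psi> x \<subseteq> \<psi> y" if xy: "(x, y) \<in> ?P" for x y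
  proof (cases "x = y")
    case False
    then obtain v e where "x = 2 * v" "y = edge_code e" "e \<in> E" "v \<in> e"
      using strict_incidence_poset[OF xy] by blast
    then show ?thesis by (simp add: \<psi>v \<psi>e)
  qed simp
  ultimately have "weak_copy ?P (\<psi> ` Field ?P)"
    unfolding weak_copy_def by (intro exI[of _ \<psi>]) (auto simp: bij_betw_def)
  moreover have "\<psi> ` Field ?P \<subseteq> (\<Union>i\<in>{1..<1 + k}. layer (N + k) i)"
  proof
    fix Y assume "Y \<in> \<psi> ` Field ?P"
    then consider v where "v < N" "Y = {Suc v}" | e where "e \<in> E" "Y = Suc ` e"
      unfolding Field_incidence_poset by (auto simp: \<psi>v \<psi>e)
    then show "Y \<in> (\<Union>i\<in>{1..<1 + k}. layer (N + k) i)"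
    proof cases
      case 1
      then have "Y \<in> layer (N + k) 1" by (auto simp: layer_def)
      then show ?thesis using assms by (intro UN_I[of 1]) auto
    next
      case 2
      then have "Y \<subseteq> {1..N + k}" using E by (fastforce simp: pairs_def)
      then have "Y \<in> layer (N + k) 2" using 2 card_e by (auto simp: layer_def)
      then show ?thesis using assms by (intro UN_I[of 2]) auto
    qed
  qed
  ultimately show False using free by (auto simp: weak_free_def)
qed

lemma weak_copy_incidence_poset_psubset:
  assumes inj: "inj_on \<psi> (Field (incidence_poset N E))"
    and mono: "\<And>p q. (p, q) \<in> incidence_poset N E \<Longrightarrow> \<psi> p \<subseteq> \<psi> q"
    and e: "e \<in> E" "v \<in> e"
  shows "\<psi> (2 * v) \<subset> \<psi> (edge_code e)"
proof -
  have P: "(2 * v, edge_code e) \<in> incidence_poset N E" using e by (auto simp: incidence_poset_def)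
  then have "\<psi> (2 * v) \<noteq> \<psi> (edge_code e)"
    using inj even_neq_edge_code[of v e] by (auto dest: inj_onD FieldI1 FieldI2)
  then show ?thesis using mono[OF P] by auto
qed

text \<open>A single layer is an antichain, whereas an edge and one of its ends are mapped to a
  proper inclusion.\<close>

lemma e_num_incidence_poset:
  assumes "E \<noteq> {}"
  shows "e_num (incidence_poset N E) = 1"
proof -
  let ?P = "incidence_poset N E"
  obtain e where e: "e \<in> E" using assms by auto
  then obtain u v where uv: "e = {u, v}" "u \<in> {..<N}" using E pairsE by blast
  have "Field ?P \<noteq> {}" using uv by (auto simp: Field_incidence_poset)
  then have "layers_free ?P 0" by (simp add: layers_free_def weak_free_empty)
  moreover have "layers_free ?P 1"
    unfolding layers_free_def weak_free_def
  proof (intro allI impI notI, elim exE conjE)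
    fix n s \<G> assume sub: "\<G> \<subseteq> (\<Union>i\<in>{s..<s + 1}. layer n i)" and "weak_copy ?P \<G>"
    then obtain \<psi> where \<psi>: "bij_betw \<psi> (Field ?P) \<G>" "\<And>p q. (p, q) \<in> ?P \<Longrightarrow> \<psi> p \<subseteq> \<psi> q"
      unfolding weak_copy_def by blast
    have lt: "\<psi> (2 * u) \<subset> \<psi> (edge_code e)"
      by (rule weak_copy_incidence_poset_psubset[OF bij_betw_imp_inj_on[OF \<psi>(1)] \<psi>(2) e])
         (simp_all add: uv)
    have "\<psi> (2 * u) \<in> \<G>" "\<psi> (edge_code e) \<in> \<G>"
      using \<psi>(1) uv(2) e by (auto simp: bij_betw_def Field_incidence_poset)
    then have "\<psi> (2 * u) \<in> layer n s" "\<psi> (edge_code e) \<in> layer n s" using sub by auto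
    then have "card (\<psi> (2 * u)) = card (\<psi> (edge_code e))" "finite (\<psi> (edge_code e))"
      by (auto simp: layer_def intro: finite_subset)
    then show False using psubset_card_mono[OF _ lt] by simp
  qed
  ultimately have "layers_free ?P k \<longleftrightarrow> k \<in> {0, 1}" for k
    using not_layers_free_incidence_poset[of k] by (cases "2 \<le> k") (auto simp: not_le less_2_cases_iff)
  then have "{k. layers_free ?P k} = {0, 1}" by blast
  then show ?thesis unfolding e_num_def by (simp add: cSup_eq_Max)
qed

text \<open>Suppose that all degrees in some nonempty \<open>Y\<close> are at least two. Then each
  edge in the image of \<open>Y\<close> has both its ends there, and each vertex there is on two
  such edges. Double counting yields a vertex set \<open>W\<close> of size at most \<open>g\<close>
  with at least \<open>card W\<close> edges, against sparsity. So \<open>Q\<close> is a forest of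
  height at most two.\<close>

lemma pi_minus_subposet_incidence_poset:
  fixes Q :: "nat rel"
  assumes sparse: "\<And>W. W \<subseteq> {..<N} \<Longrightarrow> W \<noteq> {} \<Longrightarrow> card W \<le> g \<Longrightarrow> card {e \<in> E. e \<subseteq> W} < card W"
    and Q: "finite_poset Q" "Field Q \<noteq> {}" "card (Field Q) \<le> g"
    and QP: "weakly_contained Q (incidence_poset N E)"
  shows "pi_minus Q \<le> 1"
proof -
  let ?P = "incidence_poset N E"
  obtain \<phi> where \<phi>: "inj_on \<phi> (Field Q)" "\<phi> ` Field Q \<subseteq> Field ?P" "\<And>x y. (x, y) \<in> Q \<Longrightarrow> (\<phi> x, \<phi> y) \<in> ?P"
    using QP unfolding weakly_contained_def by blast
  have strict: "\<exists>v e. \<phi> x = 2 * v \<and> \<phi> y = edge_code e \<and> e \<in> E \<and> v \<in> e"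
    if xy: "(x, y) \<in> Q" "x \<noteq> y" for x y
  proof -
    have "\<phi> x \<noteq> \<phi> y" using \<phi>(1) xy by (auto dest: inj_onD FieldI1 FieldI2)
    then show ?thesis using strict_incidence_poset[OF \<phi>(3)[OF xy(1)]] by metis
  qed
  show ?thesis
  proof (rule pi_minus_le_1[OF Q(1,2), of "{x. even (\<phi> x)}"])
    show "x \<in> {x. even (\<phi> x)} \<and> y \<notin> {x. even (\<phi> x)}" if "(x, y) \<in> Q" "x \<noteq> y" for x y
      using strict[OF that] by (auto simp: edge_code_def)
    fix Y assume Y: "Y \<subseteq> Field Q" "Y \<noteq> {}"
    define nb where "nb y = {z \<in> Y. z \<noteq> y \<and> ((y, z) \<in> Q \<or> (z, y) \<in> Q)}" for y
    have finY: "finite Y" using Y Q by (auto simp: finite_poset_def intro: finite_subset)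
    have "\<exists>y\<in>Y. card (nb y) \<le> 1"
    proof (rule ccontr)
      assume "\<not> ?thesis"
      then have deg: "2 \<le> card (nb y)" if "y \<in> Y" for y using that by force
      have card_nb: "card (\<phi> ` nb y) = card (nb y)" for y
        using Y(1) by (intro card_image inj_on_subset[OF \<phi>(1)]) (auto simp: nb_def)
      define W where "W = {v. v < N \<and> 2 * v \<in> \<phi> ` Y}"
      define EY where "EY = {e \<in> E. edge_code e \<in> \<phi> ` Y}"
      have finEY: "finite EY" using finite_edges by (simp add: EY_def)
      have finW: "finite W" by (simp add: W_def)
      have inW: "v \<in> W" if "2 * v \<in> \<phi> ` Y" for v
      proof -
        have "2 * v \<in> Field ?P" using that Y(1) \<phi>(2) by blast
        then have "v < N" unfolding Field_incidence_poset using even_neq_edge_code by auto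
        then show ?thesis using that by (simp add: W_def)
      qed
      have EYW: "e \<subseteq> W" if e: "e \<in> EY" for e
      proof -
        have eE: "e \<in> E" and card_e: "card e = 2" and fin_e: "finite e"
          using e E finite_edge by (auto simp: EY_def pairs_def)
        obtain y where y: "y \<in> Y" "\<phi> y = edge_code e" using e by (auto simp: EY_def)
        have "\<phi> ` nb y \<subseteq> (\<lambda>v. 2 * v) ` (e \<inter> W)"
        proof
          fix t assume "t \<in> \<phi> ` nb y"
          then obtain z where z: "z \<in> Y" "z \<noteq> y" "(y, z) \<in> Q \<or> (z, y) \<in> Q" "t = \<phi> z"
            by (auto simp: nb_def)
          have "(y, z) \<notin> Q" using strict[of y z] z(2) y(2) even_neq_edge_code by metis
          then obtain v d where vd: "\<phi> z = 2 * v" "\<phi> y = edge_code d" "d \<in> E" "v \<in> d"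
            using strict[of z y] z by blast
          have "d = e" using inj_on_edge_code vd(2,3) y(2) eE by (auto dest: inj_onD)
          moreover have "v \<in> W" using inW z(1) vd(1) by (metis imageI)
          ultimately show "t \<in> (\<lambda>v. 2 * v) ` (e \<inter> W)" using vd z(4) by auto
        qed
        then have "card (\<phi> ` nb y) \<le> card ((\<lambda>v. 2 * v) ` (e \<inter> W))"
          using fin_e by (intro card_mono) auto
        also have "\<dots> \<le> card (e \<inter> W)" using fin_e by (intro card_image_le) auto
        finally have "card (\<phi> ` nb y) \<le> card (e \<inter> W)" .
        then have "card e \<le> card (e \<inter> W)" using deg[OF y(1)] card_nb[of y] card_e by simp
        then have "e \<inter> W = e" using fin_e by (intro card_seteq) auto
        then show ?thesis by auto
      qed
      have degW: "2 \<le> card {e \<in> EY. v \<in> e}" if v: "v \<in> W" for v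
      proof -
        obtain y where y: "y \<in> Y" "\<phi> y = 2 * v" using v by (auto simp: W_def)
        have "\<phi> ` nb y \<subseteq> edge_code ` {e \<in> EY. v \<in> e}"
        proof
          fix t assume "t \<in> \<phi> ` nb y"
          then obtain z where z: "z \<in> Y" "z \<noteq> y" "(y, z) \<in> Q \<or> (z, y) \<in> Q" "t = \<phi> z"
            by (auto simp: nb_def)
          have "(z, y) \<notin> Q" using strict[of z y] z(2) y(2) even_neq_edge_code by metis
          then obtain w e where we: "\<phi> y = 2 * w" "\<phi> z = edge_code e" "e \<in> E" "w \<in> e"
            using strict[of y z] z by blast
          then have "w = v" using y(2) by simp
          moreover have "e \<in> EY" using we z(1) by (auto simp: EY_def intro: rev_image_eqI)
          ultimately show "t \<in> edge_code ` {e \<in> EY. v \<in> e}" using we z(4) by auto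
        qed
        then have "card (\<phi> ` nb y) \<le> card (edge_code ` {e \<in> EY. v \<in> e})"
          using finEY by (intro card_mono) auto
        also have "\<dots> \<le> card {e \<in> EY. v \<in> e}" using finEY by (intro card_image_le) auto
        finally have "card (\<phi> ` nb y) \<le> card {e \<in> EY. v \<in> e}" .
        then show ?thesis using deg[OF y(1)] card_nb[of y] by linarith
      qed
      have "2 * card W = (\<Sum>v\<in>W. 2)" by simp
      also have "\<dots> \<le> (\<Sum>v\<in>W. card {e \<in> EY. v \<in> e})" by (intro sum_mono degW)
      also have "\<dots> = (\<Sum>e\<in>EY. card {v \<in> W. v \<in> e})"
        using sum.swap_restrict[OF finW finEY, of "\<lambda>_ _. 1::nat" "\<lambda>v e. v \<in> e"] by simp
      also have "\<dots> \<le> (\<Sum>e\<in>EY. 2)"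
      proof (intro sum_mono)
        fix e assume "e \<in> EY"
        then have "finite e" "card e = 2" using E finite_edge by (auto simp: EY_def pairs_def)
        then show "card {v \<in> W. v \<in> e} \<le> 2" by (metis (no_types, lifting) card_mono mem_Collect_eq subsetI)
      qed
      finally have "card W \<le> card EY" by simp
      also have "card EY \<le> card {e \<in> E. e \<subseteq> W}"
        using finite_edges EYW by (intro card_mono) (auto simp: EY_def)
      finally have "card W \<le> card {e \<in> E. e \<subseteq> W}" .
      moreover have "card {e \<in> E. e \<subseteq> W} < card W"
      proof (rule sparse)
        show "W \<subseteq> {..<N}" by (auto simp: W_def)
        obtain y where y: "y \<in> Y" using Y by auto
        then have "\<phi> y \<in> Field ?P" using Y \<phi>(2) by blast
        then consider v where "\<phi> y = 2 * v" | e where "e \<in> E" "\<phi> y = edge_code e"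
          unfolding Field_incidence_poset by blast
        then show "W \<noteq> {}"
        proof cases
          case 1
          then show ?thesis using inW y by (metis empty_iff imageI)
        next
          case 2
          then have "edge_code e \<in> \<phi> ` Y" using y by (metis imageI)
          then have "e \<subseteq> W" using 2 by (intro EYW) (simp add: EY_def)
          moreover have "e \<noteq> {}" using 2 E by (auto simp: pairs_def)
          ultimately show ?thesis by auto
        qed
        have "card W \<le> card (\<phi> ` Y)"
          using finY by (intro card_inj_on_le[of "\<lambda>v. 2 * v"]) (auto simp: W_def inj_on_def)
        also have "\<dots> \<le> card Y" using finY by (rule card_image_le)
        also have "\<dots> \<le> card (Field Q)" using Y Q by (intro card_mono) (auto simp: finite_poset_def)
        finally show "card W \<le> g" using Q(3) by simp
      qed
      ultimately show False by simp
    qed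
    then show "\<exists>y\<in>Y. card {z \<in> Y. z \<noteq> y \<and> ((y, z) \<in> Q \<or> (z, y) \<in> Q)} \<le> 1"
      by (simp add: nb_def)
  qed
qed

text \<open>No vertex is isolated, because its cut has positive size. In a family on two levels all
  vertices are therefore mapped to layer \<open>m\<close> and all edges to \<open>H\<close>, and the
  image of an edge is the union of the images of its ends, which are distinct \<open>m\<close>-sets.
  Now \<open>nearly_independent_set\<close> contradicts \<open>dense\<close>.\<close>

lemma weak_free_incidence_poset:
  fixes \<theta> :: real
  assumes N: "120 \<le> N" and \<theta>: "\<theta> > 0"
    and cut: "\<And>S. S \<subseteq> {..<N} \<Longrightarrow> \<theta> * card S * card ({..<N} - S) \<le> card (cut E S)"
    and cardE: "2 * card E \<le> \<theta> * ((1 + 1/60) * (real N)\<^sup>2)"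
    and dense: "\<And>C. C \<subseteq> {..<N} \<Longrightarrow> N \<le> 20 * card C \<Longrightarrow> 2 \<le> card {e \<in> E. e \<subseteq> C}"
    and H: "H \<subseteq> layer n (Suc m)" "link_colourable 8 (m - 1) H"
  shows "weak_free (incidence_poset N E) (layer n m \<union> H)"
  unfolding weak_free_def
proof (intro notI, elim exE conjE)
  let ?P = "incidence_poset N E" and ?V = "{..<N}"
  fix \<G> assume sub: "\<G> \<subseteq> layer n m \<union> H" and "weak_copy ?P \<G>"
  then obtain \<psi> where bij: "bij_betw \<psi> (Field ?P) \<G>" and mono: "\<And>p q. (p, q) \<in> ?P \<Longrightarrow> \<psi> p \<subseteq> \<psi> q"
    unfolding weak_copy_def by blast
  have inj: "inj_on \<psi> (Field ?P)" using bij by (simp add: bij_betw_def)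
  define f where "f v = \<psi> (2 * v)" for v
  define h where "h e = \<psi> (edge_code e)" for e
  have fG: "f v \<in> layer n m \<union> H" if "v < N" for v
    using bij that sub by (auto simp: bij_betw_def Field_incidence_poset f_def)
  have hG: "h e \<in> layer n m \<union> H" if "e \<in> E" for e
    using bij that sub by (auto simp: bij_betw_def Field_incidence_poset h_def)
  have fh: "f v \<subset> h e" if "e \<in> E" "v \<in> e" for v e
    using weak_copy_incidence_poset_psubset[OF inj mono that] by (simp add: f_def h_def)
  have fin: "finite A" "card A = m \<or> card A = Suc m" if "A \<in> layer n m \<union> H" for A
    using that H(1) by (auto simp: layer_def intro: finite_subset)
  have levels: "card (f v) = m \<and> card (h e) = Suc m" if e: "e \<in> E" "v \<in> e" for v e
  proof -
    have "v < N" using e E by (auto simp: pairs_def)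
    have "card (f v) < card (h e)" using psubset_card_mono[OF fin(1)[OF hG[OF e(1)]] fh[OF e]] .
    then show ?thesis using fin(2)[OF fG[OF \<open>v < N\<close>]] fin(2)[OF hG[OF e(1)]] by auto
  qed
  have isolated: "\<exists>e\<in>E. v \<in> e" if "v < N" for v
  proof -
    have "0 < \<theta> * card {v} * card (?V - {v})" using \<theta> N that by simp
    also have "\<dots> \<le> card (cut E {v})" using that by (intro cut) auto
    finally have "cut E {v} \<noteq> {}" by auto
    then show ?thesis by (auto simp: cut_def)
  qed
  have f: "finite (f v) \<and> card (f v) = m" if "v \<in> ?V" for v
    using fin(1)[OF fG] isolated[of v] levels that by auto
  have injf: "inj_on f ?V"
  proof (rule inj_onI)
    fix u v assume "u \<in> ?V" "v \<in> ?V" "f u = f v"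
    then have "2 * u = 2 * v"
      by (intro inj_onD[OF inj]) (simp_all add: f_def Field_incidence_poset)
    then show "u = v" by simp
  qed
  have injh: "inj_on h E"
  proof (rule inj_onI)
    fix d e assume de: "d \<in> E" "e \<in> E" "h d = h e"
    then have "edge_code d = edge_code e"
      by (intro inj_onD[OF inj]) (simp_all add: h_def Field_incidence_poset)
    then show "d = e" using inj_on_edge_code de by (auto dest: inj_onD)
  qed
  have e_ne: "e \<noteq> {}" if "e \<in> E" for e using that E by (auto simp: pairs_def)
  have hH: "h e \<in> H \<and> card (h e) = Suc m" if e: "e \<in> E" for e
  proof -
    obtain v where "v \<in> e" using e_ne[OF e] by auto
    then have "card (h e) = Suc m" using levels e by blast
    then show ?thesis using hG[OF e] by (auto simp: layer_def)
  qed
  have hU: "h {u, v} = f u \<union> f v" if e: "{u, v} \<in> E" for u v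
  proof -
    have uv: "u \<noteq> v" "u \<in> ?V" "v \<in> ?V" using e E by (auto simp: pairs_def)
    have ne: "f u \<noteq> f v" using injf uv by (auto dest: inj_onD)
    have "\<not> f v \<subseteq> f u" using ne f[OF uv(2)] f[OF uv(3)] card_subset_eq[of "f u" "f v"] by auto
    then have "f u \<subset> f u \<union> f v" by auto
    then have "m < card (f u \<union> f v)" using f[OF uv(2)] f[OF uv(3)] psubset_card_mono[of "f u \<union> f v" "f u"] by auto
    moreover have "f u \<union> f v \<subseteq> h {u, v}" using fh[OF e, of u] fh[OF e, of v] by auto
    moreover have "finite (h {u, v})" by (rule fin(1)[OF hG[OF e]])
    ultimately show ?thesis using hH[OF e] card_seteq[of "h {u, v}" "f u \<union> f v"] by auto
  qed
  have "\<exists>C \<subseteq> ?V. card ?V \<le> 20 * card C \<and> card {e \<in> E. e \<subseteq> C} \<le> 1"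
  proof (rule nearly_independent_set[where f = f and h = h and H = H and m = m and \<theta> = \<theta>])
    show "2 * card E \<le> \<theta> * ((1 + 1/60) * (real (card ?V))\<^sup>2)" using cardE by simp
  qed (use N E f injf hU hH injh H(2) cut \<theta> in auto)
  then obtain C where "C \<subseteq> ?V" "N \<le> 20 * card C" "card {e \<in> E. e \<subseteq> C} \<le> 1" by auto
  then show False using dense[of C] by simp
qed

end

section \<open>The lower bound for the extremal number, and the conclusion\<close>

text \<open>The layer above the middle one has at least half its size, and \<open>H\<close> takes at
  least half of that layer, which gives the factor \<open>1 + 1/2 * 1/2 = 5/4\<close>.\<close>

lemma La_incidence_poset_ge:
  fixes \<theta> :: real
  assumes E: "E \<subseteq> pairs {..<N}" and N: "120 \<le> N" and \<theta>: "\<theta> > 0"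
    and cut: "\<And>S. S \<subseteq> {..<N} \<Longrightarrow> \<theta> * card S * card ({..<N} - S) \<le> card (cut E S)"
    and cardE: "2 * card E \<le> \<theta> * ((1 + 1/60) * (real N)\<^sup>2)"
    and dense: "\<And>C. C \<subseteq> {..<N} \<Longrightarrow> N \<le> 20 * card C \<Longrightarrow> 2 \<le> card {e \<in> E. e \<subseteq> C}"
    and n: "2 \<le> n"
  shows "5 * (n choose (n div 2)) \<le> 4 * La n (incidence_poset N E)"
proof -
  let ?P = "incidence_poset N E"
  obtain m where m: "n div 2 = Suc m" using n by (cases "n div 2") auto
  obtain H where H: "H \<subseteq> layer n (m + 2)" "link_colourable 8 m H" "card (layer n (m + 2)) \<le> 2 * card H"
    using exists_link_colourable by blast
  have card_layer: "card (layer n k) = n choose k" for k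
    unfolding layer_def by (simp add: n_subsets)
  have fin_layer: "finite (layer n k)" for k
    by (rule finite_subset[of _ "Pow {1..n}"]) (auto simp: layer_def)
  have "2 * 0 \<in> Field ?P" unfolding Field_incidence_poset[OF E] using N by (intro UnI1 imageI) simp
  then have Field: "Field ?P \<noteq> {}" by blast
  have "weak_free ?P (layer n (Suc m) \<union> H)"
    using H by (intro weak_free_incidence_poset[OF E N \<theta> cut cardE dense]) auto
  then have "card (layer n (Suc m) \<union> H) \<le> La n ?P"
    using H(1) by (intro La_ge[OF Field]) (auto simp: layer_def)
  moreover have "card (layer n (Suc m) \<union> H) = (n choose Suc m) + card H"
    using H(1) finite_subset[OF H(1) fin_layer] fin_layer[of "Suc m"]
    by (subst card_Un_disjoint) (auto simp: card_layer, auto simp: layer_def)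
  moreover have "(n choose Suc m) \<le> 2 * (n choose (m + 2))"
  proof -
    have "(m + 2) * (n choose Suc m) \<le> 2 * ((n - Suc m) * (n choose Suc m))"
      using m by (simp only: mult.assoc[symmetric]) (intro mult_le_mono1, linarith)
    also have "(n - Suc m) * (n choose Suc m) = (m + 2) * (n choose (m + 2))"
      using binomial_absorb_comp[of n "Suc m"] Suc_times_binomial_eq[of "n - 1" "Suc m"] n
      by (simp add: mult.commute)
    finally have "(m + 2) * (n choose Suc m) \<le> (m + 2) * (2 * (n choose (m + 2)))" by simp
    then show ?thesis unfolding mult_le_cancel1 by simp
  qed
  ultimately show ?thesis using H(3) unfolding m card_layer by simp
qed

lemma pi_minus_incidence_poset:
  fixes \<theta> :: real
  assumes E: "E \<subseteq> pairs {..<N}" and N: "120 \<le> N" and \<theta>: "\<theta> > 0"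
    and cut: "\<And>S. S \<subseteq> {..<N} \<Longrightarrow> \<theta> * card S * card ({..<N} - S) \<le> card (cut E S)"
    and cardE: "2 * card E \<le> \<theta> * ((1 + 1/60) * (real N)\<^sup>2)"
    and dense: "\<And>C. C \<subseteq> {..<N} \<Longrightarrow> N \<le> 20 * card C \<Longrightarrow> 2 \<le> card {e \<in> E. e \<subseteq> C}"
  shows "pi_minus (incidence_poset N E) > 1"
proof -
  have "ereal (5/4) \<le> pi_minus (incidence_poset N E)"
    unfolding pi_minus_def
  proof (rule Liminf_bounded)
    show "\<forall>\<^sub>F n in sequentially. ereal (5/4) \<le> ereal (real (La n (incidence_poset N E)) / real (n choose (n div 2)))"
      using eventually_ge_at_top[of "2::nat"]
    proof eventually_elim
      case (elim n)
      have "real (5 * (n choose (n div 2))) \<le> real (4 * La n (incidence_poset N E))"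
        by (intro of_nat_mono La_incidence_poset_ge[OF E N \<theta> cut cardE dense elim])
      then show ?case by (simp add: field_simps)
    qed
  qed
  then show ?thesis by (rule less_le_trans[rotated]) (simp add: one_ereal_def)
qed

text \<open>The empty family is a copy of the empty poset, so no number of layers is free of it, and
  \<open>Sup {} = 0\<close> keeps it out of the class.\<close>

lemma Field_nonempty_if_e_num:
  assumes "e_num Q = 1"
  shows "Field Q \<noteq> {}"
proof
  assume "Field Q = {}"
  then have "\<not> weak_free Q \<F>" for \<F> :: "nat set set"
    unfolding weak_free_def weak_copy_def by (auto simp: bij_betw_def Field_def intro!: exI[of _ "{}"])
  moreover have "weak_free Q (\<Union>i\<in>{0..<0 + k}. layer k i)" if "layers_free Q k" for k
    using that unfolding layers_free_def by (metis add_0 le_add1)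
  ultimately have "{k. layers_free Q k} = {}" by blast
  then show False using assms by (simp add: e_num_def Sup_nat_empty)
qed

theorem theorem2:
  shows "\<exists>S :: nat rel set. infinite S \<and>
           (\<forall>P\<in>S. minimal_poset {Q. finite_poset Q \<and> e_num Q = 1 \<and> pi_minus Q > 1} P) \<and>
           pairwise (\<lambda>P Q. \<not> poset_iso P Q) S"
proof (rule infinitely_many_minimal)
  let ?\<C> = "{Q :: nat rel. finite_poset Q \<and> e_num Q = 1 \<and> pi_minus Q > 1}"
  fix g
  obtain N :: nat and E :: "nat set set" and \<theta> :: real
    where N: "120 \<le> N" and E: "E \<subseteq> pairs {..<N}" and \<theta>: "\<theta> > 0"
    and cut: "\<And>S. S \<subseteq> {..<N} \<Longrightarrow> \<theta> * card S * card ({..<N} - S) \<le> card (cut E S)"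
    and cardE: "2 * card E \<le> \<theta> * ((1 + 1/60) * (real N)\<^sup>2)"
    and dense: "\<And>C. C \<subseteq> {..<N} \<Longrightarrow> N \<le> 20 * card C \<Longrightarrow> 2 \<le> card {e \<in> E. e \<subseteq> C}"
    and sparse: "\<And>W. W \<subseteq> {..<N} \<Longrightarrow> W \<noteq> {} \<Longrightarrow> card W \<le> g \<Longrightarrow> card {e \<in> E. e \<subseteq> W} < card W"
    by (rule exists_sparse_expander[of g]) blast
  let ?P = "incidence_poset N E"
  have "E \<noteq> {}" using dense[of "{..<N}"] by auto
  then have "?P \<in> ?\<C>"
    using finite_poset_incidence_poset[OF E] e_num_incidence_poset[OF E]
      pi_minus_incidence_poset[OF E N \<theta> cut cardE dense] by simp
  moreover have "g < card (Field Q)" if Q: "Q \<in> ?\<C>" "weakly_contained Q ?P" for Q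
  proof (rule ccontr)
    assume "\<not> ?thesis"
    then have "pi_minus Q \<le> 1"
      using Q Field_nonempty_if_e_num
      by (intro pi_minus_subposet_incidence_poset[OF E sparse]) auto
    moreover have "1 < pi_minus Q" using Q(1) by simp
    ultimately show False by (meson leD)
  qed
  ultimately show "\<exists>P\<in>?\<C>. \<forall>Q\<in>?\<C>. weakly_contained Q P \<longrightarrow> g < card (Field Q)" by blast
qed auto

end
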